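(* Let $m,n\ge 2$ be integers, let $G$ be the $m\times n$ rectangular graph, $R=[0,m-1]\times[0,n-1]$, and work over the field $K=\mathbb{Z}/(2)$. Let $\mathcal{T}_b$ (resp. $\mathcal{T}_w$) be the set of tilings of $R$ all of whose tiles are black (resp. white). Then there exist bijections $$\Phi_b:\ker BW_{\mathbb{Z}/(2)}\setminus\{0\}\to\mathcal{T}_b\qquad\text{and}\qquad \Phi_w:\ker \mathit{WB}_{\mathbb{Z}/(2)}\setminus\{0\}\to\mathcal{T}_w .$$
   Context: The $m\times n$ rectangular graph is $G=\{(x,y)\in\mathbb{Z}^2: 0\le x\le m-1,\ 0\le y\le n-1\}$, two points adjacent iff they differ by exactly $1$ in exactly one coordinate; $(x,y)$ is black if $x+y$ is even and white if odd. Over a field $K$, $BW_K$ maps a function $v$ on the black points to the function on white points $w\mapsto\sum_{b\text{ black},\,b\sim w}v(b)$; $\mathit{WB}_K$ is defined analogously from white to black points. Tiles. For positive integers $a,b$, the following closed polygons (given by their vertices in order) are tiles, as are all their images under translations and rotations by integer multiples of $\pi/2$; some sides are designated "dashed": (1) the square with vertices $(0,0),(2,0),(2,2),(0,2)$ (no dashed side); (2) the square with vertices $(0,0),(1,1),(0,2),(-1,1)$ (no dashed side); (3) the hexagon with vertices $(0,0),(2,0),(2,2),(2-a,2+a),(-a,2+a),(-a,a)$ (no dashed side); (4) the octagon with vertices $(0,0),(2,0),(2+a,a),(2+a,a+2),(2+a-b,a+b+2),(a-b,a+b+2),(-b,b+2),(-b,b)$ (no dashed side); (5) the trapezoid with vertices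 $(0,0),(2a+2,0),(a+2,a),(a,a)$, whose side from $(0,0)$ to $(2a+2,0)$ is dashed; (6) the right isosceles triangle with vertices $(0,0),(a,0),(0,a)$, whose two legs (the sides through $(0,0)$) are dashed. A tiling of $R$ is a finite collection of tiles whose union is $R$, whose interiors are pairwise disjoint, and such that every dashed side of every tile is contained in the boundary $\partial R$. A tile all of whose vertices lie in $\mathbb{Z}^2$ is called black (resp. white) if the common color of its vertices is black (resp. white), where for a triangle tile one uses the color of its two vertices at the angles $\pi/4$ (the vertices of the other tiles all have the same color). *)

theory Defs
  imports "HOL-Analysis.Analysis" "HOL-Library.Z2"
begin

definition grid :: "int \<Rightarrow> int \<Rightarrow> (int \<times> int) set" where
  "grid m n = {0..m - 1} \<times> {0..n - 1}"

definition adjacent :: "int \<times> int \<Rightarrow> int \<times> int \<Rightarrow> bool" where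
  "adjacent p q \<longleftrightarrow>
     (\<bar>fst p - fst q\<bar> = 1 \<and> snd p = snd q) \<or> (fst p = fst q \<and> \<bar>snd p - snd q\<bar> = 1)"

definition blacks :: "int \<Rightarrow> int \<Rightarrow> (int \<times> int) set" where
  "blacks m n = {p \<in> grid m n. even (fst p + snd p)}"

definition whites :: "int \<Rightarrow> int \<Rightarrow> (int \<times> int) set" where
  "whites m n = {p \<in> grid m n. odd (fst p + snd p)}"

text \<open>
  A function on a subset of the grid is represented by its extensional extension to
  all of \<open>int \<times> int\<close>, so that it is determined by its values on that subset.
\<close>

definition nbr_sum ::
    "(int \<times> int) set \<Rightarrow> (int \<times> int) set \<Rightarrow> (int \<times> int \<Rightarrow> 'k::field) \<Rightarrow> (int \<times> int \<Rightarrow> 'k)" where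
  "nbr_sum A B v = (\<lambda>q\<in>B. \<Sum>p\<in>{p \<in> A. adjacent p q}. v p)"

definition BW :: "int \<Rightarrow> int \<Rightarrow> (int \<times> int \<Rightarrow> 'k::field) \<Rightarrow> (int \<times> int \<Rightarrow> 'k)" where
  "BW m n = nbr_sum (blacks m n) (whites m n)"

definition WB :: "int \<Rightarrow> int \<Rightarrow> (int \<times> int \<Rightarrow> 'k::field) \<Rightarrow> (int \<times> int \<Rightarrow> 'k)" where
  "WB m n = nbr_sum (whites m n) (blacks m n)"

definition zero_on :: "(int \<times> int) set \<Rightarrow> (int \<times> int \<Rightarrow> 'k::field)" where
  "zero_on A = (\<lambda>p\<in>A. 0)"

definition ker_BW :: "int \<Rightarrow> int \<Rightarrow> (int \<times> int \<Rightarrow> 'k::field) set" where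
  "ker_BW m n = {v \<in> blacks m n \<rightarrow>\<^sub>E UNIV. BW m n v = zero_on (whites m n)}"

definition ker_WB :: "int \<Rightarrow> int \<Rightarrow> (int \<times> int \<Rightarrow> 'k::field) set" where
  "ker_WB m n = {v \<in> whites m n \<rightarrow>\<^sub>E UNIV. WB m n v = zero_on (blacks m n)}"


type_synonym point = "real \<times> real"

text \<open>
  \<open>prototile vs ds cs\<close>: the tiles in standard position.  \<open>vs\<close> lists the vertices in
  (counterclockwise) order, \<open>ds\<close> lists the dashed sides by their endpoints, and \<open>cs\<close> lists the
  vertices whose common color is the color of the tile, i.e. all of them except in the case of the
  triangle, where the right-angled vertex is left out.
\<close>

inductive prototile :: "point list \<Rightarrow> (point \<times> point) list \<Rightarrow> point list \<Rightarrow> bool" where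
  square: "vs = [(0, 0), (2, 0), (2, 2), (0, 2)] \<Longrightarrow> prototile vs [] vs"
| diamond: "vs = [(0, 0), (1, 1), (0, 2), (-1, 1)] \<Longrightarrow> prototile vs [] vs"
| hexagon: "a = real k \<Longrightarrow> k > 0 \<Longrightarrow>
    vs = [(0, 0), (2, 0), (2, 2), (2 - a, 2 + a), (-a, 2 + a), (-a, a)] \<Longrightarrow>
    prototile vs [] vs"
| octagon: "a = real k \<Longrightarrow> k > 0 \<Longrightarrow> b = real l \<Longrightarrow> l > 0 \<Longrightarrow>
    vs = [(0, 0), (2, 0), (2 + a, a), (2 + a, a + 2), (2 + a - b, a + b + 2),
          (a - b, a + b + 2), (-b, b + 2), (-b, b)] \<Longrightarrow>
    prototile vs [] vs"
| trapezoid: "a = real k \<Longrightarrow> k > 0 \<Longrightarrow>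
    vs = [(0, 0), (2 * a + 2, 0), (a + 2, a), (a, a)] \<Longrightarrow>
    prototile vs [((0, 0), (2 * a + 2, 0))] vs"
| triangle: "a = real k \<Longrightarrow> k > 0 \<Longrightarrow>
    vs = [(0, 0), (a, 0), (0, a)] \<Longrightarrow>
    prototile vs [((0, 0), (a, 0)), ((0, 0), (0, a))] [(a, 0), (0, a)]"

definition quarter_turn :: "point \<Rightarrow> point" where
  "quarter_turn p = (- snd p, fst p)"

definition move :: "nat \<Rightarrow> point \<Rightarrow> point \<Rightarrow> point" where
  "move k t p = t + (quarter_turn ^^ k) p"

text \<open>
  \<open>presents T V D C\<close>: the point set \<open>T\<close> is the image of a prototile under a translation and a
  rotation, and \<open>V\<close>, \<open>D\<close>, \<open>C\<close> are its vertices, its dashed sides and its color-determining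
  vertices.  All prototiles are convex, so the closed polygon is the convex hull of its vertices.
  The sets \<open>V\<close>, \<open>D\<close> and \<open>C\<close> are determined by \<open>T\<close>, so a tile may be identified with the
  point set \<open>T\<close>; several choices of the prototile and the motion can give the same tile.
\<close>

definition presents :: "point set \<Rightarrow> point set \<Rightarrow> point set set \<Rightarrow> point set \<Rightarrow> bool" where
  "presents T V D C \<longleftrightarrow>
     (\<exists>vs ds cs k t. prototile vs ds cs \<and>
        T = convex hull (move k t ` set vs) \<and>
        V = move k t ` set vs \<and>
        D = (\<lambda>(p, q). closed_segment (move k t p) (move k t q)) ` set ds \<and>
        C = move k t ` set cs)"

definition is_tile :: "point set \<Rightarrow> bool" where
  "is_tile T \<longleftrightarrow> (\<exists>V D C. presents T V D C)"

definition dashed_side :: "point set \<Rightarrow> point set \<Rightarrow> bool" where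
  "dashed_side T s \<longleftrightarrow> (\<exists>V D C. presents T V D C \<and> s \<in> D)"

definition black_points :: "point set" where
  "black_points = {(of_int i, of_int j) |i j. even (i + j)}"

definition white_points :: "point set" where
  "white_points = {(of_int i, of_int j) |i j. odd (i + j)}"

definition black_tile :: "point set \<Rightarrow> bool" where
  "black_tile T \<longleftrightarrow> (\<exists>V D C. presents T V D C \<and> V \<subseteq> \<int> \<times> \<int> \<and> C \<subseteq> black_points)"

definition white_tile :: "point set \<Rightarrow> bool" where
  "white_tile T \<longleftrightarrow> (\<exists>V D C. presents T V D C \<and> V \<subseteq> \<int> \<times> \<int> \<and> C \<subseteq> white_points)"

definition is_tiling :: "point set \<Rightarrow> point set set \<Rightarrow> bool" where
  "is_tiling R \<T> \<longleftrightarrow>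
     finite \<T> \<and> (\<forall>T\<in>\<T>. is_tile T) \<and> \<Union>\<T> = R \<and>
     (\<forall>S\<in>\<T>. \<forall>T\<in>\<T>. S \<noteq> T \<longrightarrow> interior S \<inter> interior T = {}) \<and>
     (\<forall>T\<in>\<T>. \<forall>s. dashed_side T s \<longrightarrow> s \<subseteq> frontier R)"

definition rect :: "int \<Rightarrow> int \<Rightarrow> point set" where
  "rect m n = {0..of_int (m - 1)} \<times> {0..of_int (n - 1)}"

definition black_tilings :: "int \<Rightarrow> int \<Rightarrow> point set set set" where
  "black_tilings m n = {\<T>. is_tiling (rect m n) \<T> \<and> (\<forall>T\<in>\<T>. black_tile T)}"

definition white_tilings :: "int \<Rightarrow> int \<Rightarrow> point set set set" where
  "white_tilings m n = {\<T>. is_tiling (rect m n) \<T> \<and> (\<forall>T\<in>\<T>. white_tile T)}"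

end

theory Submission
  imports Defs
begin

text \<open>
  Fix a color \<open>c\<close> and number the points of that color as \<open>(p + q + c, p - q)\<close>.  A kernel element
  extends to the whole plane by reflection in the lines \<open>x = -1\<close>, \<open>x = m\<close>, \<open>y = -1\<close>, \<open>y = n\<close>, on
  which it vanishes.  The extension has even sum over the corners of every unit square of the
  \<open>(p, q)\<close>-lattice and is therefore, modulo 2, a function of \<open>p\<close> plus a function of \<open>q\<close>.  Hence
  its zeros fall into maximal rectangular blocks, each framed by ones.  The frame of a block bounds an
  octagon, possibly degenerate to a hexagon or a square; the rest of the plane is covered by diamonds
  whose four corners are ones.  An octagon that leaves \<open>R\<close> is symmetric in one or two of the mirror
  lines, and its part in \<open>R\<close> is a trapezoid or a triangle whose dashed sides lie in the boundary of
  \<open>R\<close>.  Conversely, marking as zeros the colored points of a tiling that lie in the blocks of its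
  tiles gives a kernel element: the tiles that meet at an uncolored point fix the values at its
  neighbours.  Both sides are compared through the triangular cells into which the colored diamonds
  are cut by their diagonals, since every tile is a union of such cells.
\<close>

section \<open>Tiles as intersections of half-planes\<close>

text \<open>At a boundary point of \<open>R\<close> the kernel equation lacks a neighbour, as if
  that neighbour had the value 0; so the mirrors stand one unit outside \<open>R\<close>, and modulo
  2 the sign of an odd reflection disappears. This unit is the origin of the length
  \<open>2 * a + 2\<close>: a mirror bisects two sides of length 2 of a symmetric octagon, and the
  boundary of \<open>R\<close> passes through their ends, where the octagon has its full width. The
  geometric obstacle is that tilings consist of point sets, whereas the algebra sees lattice points
  only. All sides of colored tiles and of \<open>R\<close> lie on integer horizontals and verticals
  or on lines of slope 1 and -1 through colored points. The cells are the pieces cut out by these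
  lines, so one test point per cell decides containment and overlap. The second obstacle is that
  intersecting with \<open>R\<close> may forget the block: a priori, different octagons can have the
  same part in \<open>R\<close>. Only the zeros inside \<open>R\<close> have to be recovered from a
  tile, and they can be.\<close>

definition oct :: "real \<Rightarrow> real \<Rightarrow> real \<Rightarrow> real \<Rightarrow> real \<Rightarrow> real \<Rightarrow> real \<Rightarrow> real \<Rightarrow> point set" where
  "oct x1 x2 y1 y2 s1 s2 d1 d2 =
     {(x, y). x1 \<le> x \<and> x \<le> x2 \<and> y1 \<le> y \<and> y \<le> y2 \<and>
              s1 \<le> x + y \<and> x + y \<le> s2 \<and> d1 \<le> x - y \<and> x - y \<le> d2}"

lemma mem_oct:
  "(x, y) \<in> oct x1 x2 y1 y2 s1 s2 d1 d2 \<longleftrightarrow>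
     x1 \<le> x \<and> x \<le> x2 \<and> y1 \<le> y \<and> y \<le> y2 \<and>
     s1 \<le> x + y \<and> x + y \<le> s2 \<and> d1 \<le> x - y \<and> x - y \<le> d2"
  by (simp add: oct_def)

lemma convex_oct: "convex (oct x1 x2 y1 y2 s1 s2 d1 d2)"
proof -
  have "oct x1 x2 y1 y2 s1 s2 d1 d2 =
    {z. (1, 0) \<bullet> z \<ge> x1} \<inter> {z. (1, 0) \<bullet> z \<le> x2} \<inter> {z. (0, 1) \<bullet> z \<ge> y1} \<inter> {z. (0, 1) \<bullet> z \<le> y2} \<inter>
    {z. (1, 1) \<bullet> z \<ge> s1} \<inter> {z. (1, 1) \<bullet> z \<le> s2} \<inter> {z. (1, -1) \<bullet> z \<ge> d1} \<inter> {z. (1, -1) \<bullet> z \<le> d2}"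
    by (auto simp: oct_def)
  then show ?thesis
    by (simp add: convex_Int convex_halfspace_le convex_halfspace_ge)
qed

section \<open>Convex hulls of the prototiles\<close>

lemma convex_between:
  fixes x y :: real
  assumes "convex S" "(x, y) \<in> S" "(x + L * a, y + L * b) \<in> S" "0 \<le> u" "u \<le> L"
  shows "(x + u * a, y + u * b) \<in> S"
proof (cases "L = 0")
  case True
  then show ?thesis using assms by auto
next
  case False
  then have "(1 - u / L) *\<^sub>R (x, y) + (u / L) *\<^sub>R (x + L * a, y + L * b) \<in> S"
    using assms by (intro convexD) auto
  moreover have "(1 - u / L) *\<^sub>R (x, y) + (u / L) *\<^sub>R (x + L * a, y + L * b) = (x + u * a, y + u * b)"
    using False by (simp add: field_simps)
  ultimately show ?thesis by simp
qed

lemma convex_horizontal: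
  fixes x y :: real
  assumes "convex S" "(l, y) \<in> S" "(r, y) \<in> S" "l \<le> x" "x \<le> r"
  shows "(x, y) \<in> S"
  using convex_between[of S l y "r - l" 1 0 "x - l"] assms by simp

text \<open>Allowing \<open>a = 0\<close> or \<open>b = 0\<close> covers the square and the hexagon
  too. Each horizontal slice is a segment with ends on the left and right boundary chains, so every
  point lies between two hull points of its own height.\<close>

lemma hull_octagon:
  fixes a b :: real
  assumes "0 \<le> a" "0 \<le> b"
  shows "convex hull {(0, 0), (2, 0), (2 + a, a), (2 + a, a + 2), (2 + a - b, a + b + 2),
          (a - b, a + b + 2), (- b, b + 2), (- b, b)}
       = oct (- b) (2 + a) 0 (a + b + 2) 0 (2 * a + 4) (- 2 * b - 2) 2" (is "convex hull ?V = ?O")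
proof
  show "convex hull ?V \<subseteq> ?O"
    by (rule hull_minimal) (use assms in \<open>auto simp: convex_oct mem_oct\<close>)
  let ?H = "convex hull ?V"
  have V: "v \<in> ?H" if "v \<in> ?V" for v
    using that by (rule hull_inc)
  have cv: "convex ?H" by (rule convex_convex_hull)
  show "?O \<subseteq> ?H"
  proof clarify
    fix x y assume "(x, y) \<in> ?O"
    then have xy: "- b \<le> x" "x \<le> 2 + a" "0 \<le> y" "y \<le> a + b + 2"
      "0 \<le> x + y" "x + y \<le> 2 * a + 4" "- 2 * b - 2 \<le> x - y" "x - y \<le> 2"
      by (auto simp: mem_oct)
    obtain l where l: "(l, y) \<in> ?H" "l \<le> x"
    proof -
      consider "y \<le> b" | "b \<le> y" "y \<le> b + 2" | "b + 2 \<le> y" by linarith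
      then show thesis
      proof cases
        case 1
        have "(- y, y) \<in> ?H"
          using convex_between[OF cv, of 0 0 b "-1" 1 y] V 1 xy by simp
        then show thesis using that xy by auto
      next
        case 2
        have "(- b, y) \<in> ?H"
          using convex_between[OF cv, of "-b" b 2 0 1 "y - b"] V 2 xy by (simp add: add.commute)
        then show thesis using that xy by auto
      next
        case 3
        have "(y - 2 * b - 2, y) \<in> ?H"
          using convex_between[OF cv, of "-b" "b + 2" a 1 1 "y - b - 2"] V 3 xy
          by (simp add: algebra_simps)
        then show thesis using that xy by auto
      qed
    qed
    obtain r where r: "(r, y) \<in> ?H" "x \<le> r"
    proof -
      consider "y \<le> a" | "a \<le> y" "y \<le> a + 2" | "a + 2 \<le> y" by linarith
      then show thesis
      proof cases
        case 1
        have "(2 + y, y) \<in> ?H"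
          using convex_between[OF cv, of 2 0 a 1 1 y] V 1 xy by simp
        then show thesis using that xy by auto
      next
        case 2
        have "(2 + a, y) \<in> ?H"
          using convex_between[OF cv, of "2 + a" a 2 0 1 "y - a"] V 2 xy by (simp add: add.commute)
        then show thesis using that xy by auto
      next
        case 3
        have "(2 + a - (y - a - 2), y) \<in> ?H"
          using convex_between[OF cv, of "2 + a" "a + 2" b "-1" 1 "y - a - 2"] V 3 xy
          by (simp add: algebra_simps)
        then show thesis using that[of "2 + a - (y - a - 2)"] xy by auto
      qed
    qed
    show "(x, y) \<in> ?H"
      using convex_horizontal[OF cv l(1) r(1)] l r by simp
  qed
qed

lemma hull_diamond:
  "convex hull {(0, 0), (1, 1), (0, 2), (- 1, 1)} = oct (- 1) 1 0 2 0 2 (- 2) 0" (is "convex hull ?V = ?O")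
proof
  show "convex hull ?V \<subseteq> ?O"
    by (rule hull_minimal) (auto simp: convex_oct mem_oct)
  let ?H = "convex hull ?V"
  have V: "v \<in> ?H" if "v \<in> ?V" for v
    using that by (rule hull_inc)
  have cv: "convex ?H" by (rule convex_convex_hull)
  show "?O \<subseteq> ?H"
  proof clarify
    fix x y assume "(x, y) \<in> ?O"
    then have xy: "0 \<le> x + y" "x + y \<le> 2" "- 2 \<le> x - y" "x - y \<le> 0"
      by (auto simp: mem_oct)
    show "(x, y) \<in> ?H"
    proof (cases "y \<le> 1")
      case True
      have "(- y, y) \<in> ?H" "(y, y) \<in> ?H"
        using convex_between[OF cv, of 0 0 1 "-1" 1 y] convex_between[OF cv, of 0 0 1 1 1 y] V True xy
        by auto
      then show ?thesis using convex_horizontal[OF cv, of "- y" y y x] xy by auto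
    next
      case False
      have "(y - 2, y) \<in> ?H" "(2 - y, y) \<in> ?H"
        using convex_between[OF cv, of "-1" 1 1 1 1 "y - 1"] convex_between[OF cv, of 1 1 1 "-1" 1 "y - 1"] V False xy
        by auto
      then show ?thesis using convex_horizontal[OF cv, of "y - 2" y "2 - y" x] xy by auto
    qed
  qed
qed

lemma hull_trapezoid:
  fixes a :: real
  assumes "0 \<le> a"
  shows "convex hull {(0, 0), (2 * a + 2, 0), (a + 2, a), (a, a)}
       = oct 0 (2 * a + 2) 0 a 0 (2 * a + 2) 0 (2 * a + 2)" (is "convex hull ?V = ?O")
proof
  show "convex hull ?V \<subseteq> ?O"
    by (rule hull_minimal) (use assms in \<open>auto simp: convex_oct mem_oct\<close>)
  let ?H = "convex hull ?V"
  have V: "v \<in> ?H" if "v \<in> ?V" for v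
    using that by (rule hull_inc)
  have cv: "convex ?H" by (rule convex_convex_hull)
  show "?O \<subseteq> ?H"
  proof clarify
    fix x y assume "(x, y) \<in> ?O"
    then have xy: "0 \<le> y" "y \<le> a" "x + y \<le> 2 * a + 2" "0 \<le> x - y"
      by (auto simp: mem_oct)
    have "(y, y) \<in> ?H" "(2 * a + 2 - y, y) \<in> ?H"
      using convex_between[OF cv, of 0 0 a 1 1 y] convex_between[OF cv, of "2 * a + 2" 0 a "-1" 1 y] V xy
      by auto
    then show "(x, y) \<in> ?H" using convex_horizontal[OF cv, of y y "2 * a + 2 - y" x] xy by auto
  qed
qed

lemma hull_triangle:
  fixes a :: real
  assumes "0 \<le> a"
  shows "convex hull {(0, 0), (a, 0), (0, a)} = oct 0 a 0 a 0 a (- a) a" (is "convex hull ?V = ?O")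
proof
  show "convex hull ?V \<subseteq> ?O"
    by (rule hull_minimal) (use assms in \<open>auto simp: convex_oct mem_oct\<close>)
  let ?H = "convex hull ?V"
  have V: "v \<in> ?H" if "v \<in> ?V" for v
    using that by (rule hull_inc)
  have cv: "convex ?H" by (rule convex_convex_hull)
  show "?O \<subseteq> ?H"
  proof clarify
    fix x y assume "(x, y) \<in> ?O"
    then have xy: "0 \<le> x" "0 \<le> y" "y \<le> a" "x + y \<le> a"
      by (auto simp: mem_oct)
    have "(0, y) \<in> ?H" "(a - y, y) \<in> ?H"
      using convex_between[OF cv, of 0 0 a 0 1 y] convex_between[OF cv, of a 0 a "-1" 1 y] V xy
      by auto
    then show "(x, y) \<in> ?H" using convex_horizontal[OF cv, of 0 y "a - y" x] xy by auto
  qed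
qed

section \<open>Quarter turns and translations\<close>

lemma funpow_quarter_turn_mod_4: "quarter_turn ^^ k = quarter_turn ^^ (k mod 4)"
proof -
  have 4: "quarter_turn ^^ 4 = id"
    by (auto simp: fun_eq_iff quarter_turn_def eval_nat_numeral)
  have "(quarter_turn ^^ 4) ^^ j = id" for j
    unfolding 4 by (induction j) auto
  then have "quarter_turn ^^ (4 * j) = id" for j
    by (simp add: funpow_mult)
  then have "quarter_turn ^^ (4 * (k div 4) + k mod 4) = quarter_turn ^^ (k mod 4)"
    by (simp only: funpow_add) simp
  then show ?thesis by simp
qed

lemma move_simps:
  "move 0 (t, u) (x, y) = (t + x, u + y)"
  "move (Suc 0) (t, u) (x, y) = (t - y, u + x)"
  "move 2 (t, u) (x, y) = (t - x, u - y)"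
  "move 3 (t, u) (x, y) = (t + y, u - x)"
  by (auto simp: move_def quarter_turn_def eval_nat_numeral)

lemma move_cases:
  obtains j where "j \<in> {0, 1, 2, 3}" "move k = move j"
proof -
  have "k mod 4 < 4" by simp
  then have "k mod 4 \<in> {0, 1, 2, 3}" by (simp; presburger)
  moreover have "move k = move (k mod 4)"
    unfolding move_def fun_eq_iff using funpow_quarter_turn_mod_4[of k] by metis
  ultimately show thesis by (rule that)
qed

lemma hull_move: "convex hull (move k t ` S) = move k t ` (convex hull S)"
proof -
  have q: "linear quarter_turn"
    by (rule linearI) (auto simp: quarter_turn_def)
  have "linear (quarter_turn ^^ k)"
  proof (induction k)
    case 0
    show ?case by (simp add: linear_id[unfolded id_def])
  next
    case (Suc k)
    then show ?case by (simp add: linear_compose q del: o_apply)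
  qed
  then have *: "convex hull ((quarter_turn ^^ k) ` S) = (quarter_turn ^^ k) ` (convex hull S)"
    by (rule convex_hull_linear_image[symmetric])
  have "move k t = (\<lambda>z. t + z) \<circ> (quarter_turn ^^ k)"
    by (auto simp: move_def)
  then show ?thesis
    by (simp only: image_comp[symmetric] convex_hull_translation *)
qed

text \<open>A quarter turn replaces \<open>(x, y)\<close> by \<open>(- y, x)\<close>, hence
  \<open>(x + y, x - y)\<close> by \<open>(x - y, - x - y)\<close>. It permutes the four pairs of
  parallel bounds up to sign.\<close>

lemma move_oct:
  "move 0 (t, u) ` oct x1 x2 y1 y2 s1 s2 d1 d2 =
     oct (t + x1) (t + x2) (u + y1) (u + y2) (t + u + s1) (t + u + s2) (t - u + d1) (t - u + d2)"
  "move 1 (t, u) ` oct x1 x2 y1 y2 s1 s2 d1 d2 =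
     oct (t - y2) (t - y1) (u + x1) (u + x2) (t + u + d1) (t + u + d2) (t - u - s2) (t - u - s1)"
  "move 2 (t, u) ` oct x1 x2 y1 y2 s1 s2 d1 d2 =
     oct (t - x2) (t - x1) (u - y2) (u - y1) (t + u - s2) (t + u - s1) (t - u - d2) (t - u - d1)"
  "move 3 (t, u) ` oct x1 x2 y1 y2 s1 s2 d1 d2 =
     oct (t + y1) (t + y2) (u - x2) (u - x1) (t + u - d2) (t + u - d1) (t - u + s1) (t - u + s2)"
proof -
  have *: "f ` A = B" if "\<And>z. z \<in> A \<Longrightarrow> f z \<in> B" "\<And>z. z \<in> B \<Longrightarrow> g z \<in> A \<and> f (g z) = z"
    for f g :: "point \<Rightarrow> point" and A B
    using that by (metis image_subsetI imageI subsetI subset_antisym)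
  show "move 0 (t, u) ` oct x1 x2 y1 y2 s1 s2 d1 d2 =
     oct (t + x1) (t + x2) (u + y1) (u + y2) (t + u + s1) (t + u + s2) (t - u + d1) (t - u + d2)"
    by (rule *[where g="\<lambda>(x, y). (x - t, y - u)"]) (auto simp: move_simps mem_oct)
  show "move 1 (t, u) ` oct x1 x2 y1 y2 s1 s2 d1 d2 =
     oct (t - y2) (t - y1) (u + x1) (u + x2) (t + u + d1) (t + u + d2) (t - u - s2) (t - u - s1)"
    by (rule *[where g="\<lambda>(x, y). (y - u, t - x)"]) (auto simp: move_simps mem_oct)
  show "move 2 (t, u) ` oct x1 x2 y1 y2 s1 s2 d1 d2 =
     oct (t - x2) (t - x1) (u - y2) (u - y1) (t + u - s2) (t + u - s1) (t - u - d2) (t - u - d1)"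
    by (rule *[where g="\<lambda>(x, y). (t - x, u - y)"]) (auto simp: move_simps mem_oct)
  show "move 3 (t, u) ` oct x1 x2 y1 y2 s1 s2 d1 d2 =
     oct (t + y1) (t + y2) (u - x2) (u - x1) (t + u - d2) (t + u - d1) (t - u + s1) (t - u + s2)"
    by (rule *[where g="\<lambda>(x, y). (u - y, x - t)"]) (auto simp: move_simps mem_oct)
qed

text \<open>
  The point \<open>(x, y)\<close> is the lower left corner of the bounding box of \<open>octform\<close>, the centre of \<open>diaform\<close>, the
  first endpoint of the dashed side of \<open>trapform\<close> and the right-angled vertex of \<open>triform\<close>; \<open>k\<close> counts
  quarter turns.  Squares and hexagons are octagons with \<open>a = 0\<close> or \<open>b = 0\<close>.
\<close>
definition octform :: "real \<Rightarrow> real \<Rightarrow> real \<Rightarrow> real \<Rightarrow> point set" where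
  "octform x y a b = oct x (x + a + b + 2) y (y + a + b + 2)
     (x + y + b) (x + y + 2 * a + b + 4) (x - y - b - 2) (x - y + b + 2)"

definition diaform :: "real \<Rightarrow> real \<Rightarrow> point set" where
  "diaform x y = oct (x - 1) (x + 1) (y - 1) (y + 1) (x + y - 1) (x + y + 1) (x - y - 1) (x - y + 1)"

definition trapform :: "nat \<Rightarrow> real \<Rightarrow> real \<Rightarrow> real \<Rightarrow> point set" where
  "trapform k x y a =
     (if k = 0 then oct x (x + 2 * a + 2) y (y + a) (x + y) (x + y + 2 * a + 2) (x - y) (x - y + 2 * a + 2)
      else if k = 1 then oct (x - a) x y (y + 2 * a + 2) (x + y) (x + y + 2 * a + 2) (x - y - 2 * a - 2) (x - y)
      else if k = 2 then oct (x - 2 * a - 2) x (y - a) y (x + y - 2 * a - 2) (x + y) (x - y - 2 * a - 2) (x - y)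
      else oct x (x + a) (y - 2 * a - 2) y (x + y - 2 * a - 2) (x + y) (x - y) (x - y + 2 * a + 2))"

definition trapside :: "nat \<Rightarrow> real \<Rightarrow> real \<Rightarrow> real \<Rightarrow> point set" where
  "trapside k x y a = closed_segment (x, y)
     (if k = 0 then (x + 2 * a + 2, y) else if k = 1 then (x, y + 2 * a + 2)
      else if k = 2 then (x - 2 * a - 2, y) else (x, y - 2 * a - 2))"

definition triform :: "nat \<Rightarrow> real \<Rightarrow> real \<Rightarrow> real \<Rightarrow> point set" where
  "triform k x y a =
     (if k = 0 then oct x (x + a) y (y + a) (x + y) (x + y + a) (x - y - a) (x - y + a)
      else if k = 1 then oct (x - a) x y (y + a) (x + y - a) (x + y + a) (x - y - a) (x - y)
      else if k = 2 then oct (x - a) x (y - a) y (x + y - a) (x + y) (x - y - a) (x - y + a)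
      else oct x (x + a) (y - a) y (x + y - a) (x + y + a) (x - y) (x - y + a))"

definition tripoint :: "nat \<Rightarrow> real \<Rightarrow> real \<Rightarrow> real \<Rightarrow> point" where
  "tripoint k x y a =
     (if k = 0 then (x + a, y) else if k = 1 then (x, y + a) else if k = 2 then (x - a, y) else (x, y - a))"

text \<open>Rotations are absorbed into four normal forms; the octagons form a single family because
  a quarter turn only exchanges \<open>a\<close> and \<open>b\<close>. Besides \<open>D\<close> and
  \<open>C\<close>, one vertex is recorded, which fixes the position of the tile relative to the
  lattice.\<close>

lemma presents_forms:
  assumes "presents T V D C"
  shows "(\<exists>x y a b. T = octform x y (real a) (real b) \<and> D = {} \<and> C = V \<and> (x + real b, y) \<in> V) \<or>
    (\<exists>x y. T = diaform x y \<and> D = {} \<and> C = V \<and> (x, y - 1) \<in> V) \<or>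
    (\<exists>k x y a. k < 4 \<and> 0 < a \<and> T = trapform k x y (real a) \<and> D = {trapside k x y (real a)} \<and> C = V \<and> (x, y) \<in> V) \<or>
    (\<exists>k x y a. k < 4 \<and> 0 < a \<and> T = triform k x y (real a) \<and> (x, y) \<in> V \<and>
        D = {closed_segment (x, y) (tripoint k x y (real a)), closed_segment (x, y) (tripoint ((k + 1) mod 4) x y (real a))} \<and>
        C = {tripoint k x y (real a), tripoint ((k + 1) mod 4) x y (real a)})"
    (is "?O \<or> ?S \<or> ?Z \<or> ?A")
proof -
  obtain vs ds cs k0 t0 where p: "prototile vs ds cs" and
    T0: "T = convex hull (move k0 t0 ` set vs)" and V0: "V = move k0 t0 ` set vs" and
    D0: "D = (\<lambda>(p, q). closed_segment (move k0 t0 p) (move k0 t0 q)) ` set ds" and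
    C0: "C = move k0 t0 ` set cs"
    using assms unfolding presents_def by blast
  obtain t u where t0: "t0 = (t, u)" by fastforce
  obtain k where k: "k \<in> {0, 1, 2, 3}" and "move k0 = move k" by (rule move_cases)
  then have V: "V = move k (t, u) ` set vs" and C: "C = move k (t, u) ` set cs"
    and D: "D = (\<lambda>(p, q). closed_segment (move k (t, u) p) (move k (t, u) q)) ` set ds"
    and T: "T = move k (t, u) ` (convex hull (set vs))"
    using T0 V0 C0 D0 t0 by (simp_all add: hull_move)
  \<comment> \<open>The four listed vertices are those that the four rotations move to the left end
    of the bottom side.\<close>
  have octcase: ?O if vs: "convex hull (set vs) = oct (- real b) (2 + real a) 0 (real a + real b + 2) 0 (2 * real a + 4) (- 2 * real b - 2) 2"
      "(0, 0) \<in> set vs" "(- real b, real b + 2) \<in> set vs"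
      "(2 + real a - real b, real a + real b + 2) \<in> set vs" "(2 + real a, real a) \<in> set vs"
      and "ds = []" "cs = vs" for a b
  proof -
    have DC: "D = {}" "C = V" using that V D C by auto
    show ?O
    using k proof (elim insertE emptyE)
      assume k: "k = 0"
      have "move 0 (t, u) (0, 0) = (t, u)" by (simp only: move_simps add_0_right)
      then have "(t, u) \<in> V" unfolding V k using vs(2) by (metis imageI)
      then show ?O
        unfolding T vs(1) move_oct k using DC
        by (intro exI[of _ "t - real b"] exI[of _ u] exI[of _ a] exI[of _ b]) (simp add: octform_def algebra_simps)
    next
      assume k: "k = 1"
      have "(t - (real b + 2), u - real b) \<in> V"
        using imageI[OF vs(3), of "move 1 (t, u)"] unfolding V k by (simp add: move_simps algebra_simps)
      then show ?O
        unfolding T vs(1) move_oct k using DC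
        by (intro exI[of _ "t - (real a + real b + 2)"] exI[of _ "u - real b"] exI[of _ b] exI[of _ a]) (simp add: octform_def algebra_simps)
    next
      assume k: "k = 2"
      have "(t - (2 + real a - real b), u - (real a + real b + 2)) \<in> V"
        using imageI[OF vs(4), of "move 2 (t, u)"] unfolding V k by (simp add: move_simps algebra_simps)
      then show ?O
        unfolding T vs(1) move_oct k using DC
        by (intro exI[of _ "t - (2 + real a)"] exI[of _ "u - (real a + real b + 2)"] exI[of _ a] exI[of _ b]) (simp add: octform_def algebra_simps)
    next
      assume k: "k = 3"
      have "(t + real a, u - (2 + real a)) \<in> V"
        using imageI[OF vs(5), of "move 3 (t, u)"] unfolding V k by (simp add: move_simps algebra_simps)
      then show ?O
        unfolding T vs(1) move_oct k using DC
        by (intro exI[of _ t] exI[of _ "u - (2 + real a)"] exI[of _ b] exI[of _ a]) (simp add: octform_def algebra_simps)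
    qed
  qed
  from p show ?thesis
  proof cases
    case square
    show ?thesis
      using octcase[of 0 0] hull_octagon[of 0 0] square by (simp add: insert_commute)
  next
    case diamond
    have DC: "D = {}" "C = V" using diamond V D C by auto
    have vs: "convex hull (set vs) = oct (- 1) 1 0 2 0 2 (- 2) 0"
      using diamond hull_diamond by simp
    have "?S"
    using k proof (elim insertE emptyE)
      assume k: "k = 0"
      have "(t, u) \<in> V" using diamond unfolding V k by (simp add: move_simps)
      then show ?S unfolding T vs move_oct k using DC
        by (intro exI[of _ t] exI[of _ "u + 1"]) (simp add: diaform_def algebra_simps)
    next
      assume k: "k = 1"
      have "(t - 1, u - 1) \<in> V" using diamond unfolding V k by (simp add: move_simps)
      then show ?S unfolding T vs move_oct k using DC
        by (intro exI[of _ "t - 1"] exI[of _ "u"]) (simp add: diaform_def algebra_simps)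
    next
      assume k: "k = 2"
      have "(t, u - 2) \<in> V" using diamond unfolding V k by (simp add: move_simps)
      then show ?S unfolding T vs move_oct k using DC
        by (intro exI[of _ "t"] exI[of _ "u - 1"]) (simp add: diaform_def algebra_simps)
    next
      assume k: "k = 3"
      have "(t + 1, u - 1) \<in> V" using diamond unfolding V k by (simp add: move_simps)
      then show ?S unfolding T vs move_oct k using DC
        by (intro exI[of _ "t + 1"] exI[of _ "u"]) (simp add: diaform_def algebra_simps)
    qed
    then show ?thesis by blast
  next
    case (hexagon a k)
    show ?thesis
      using octcase[of k 0] hull_octagon[of 0 "real k"] hexagon by (simp add: insert_commute algebra_simps)
  next
    case (octagon a k b l)
    show ?thesis
      using octcase[of l k] hull_octagon[of "real k" "real l"] octagon by (simp add: insert_commute algebra_simps)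
  next
    case (trapezoid a j)
    then have a: "a = real j" by simp
    have vs: "convex hull (set vs) = oct 0 (2 * a + 2) 0 a 0 (2 * a + 2) 0 (2 * a + 2)"
      using trapezoid hull_trapezoid[of a] by simp
    have "(t, u) \<in> V" using k trapezoid unfolding V by (auto simp: move_simps)
    moreover have "T = trapform k t u (real j)"
      using k unfolding T vs a
      by (elim insertE emptyE; simp add: move_oct move_oct(2)[unfolded One_nat_def] trapform_def algebra_simps)
    moreover have "D = {trapside k t u (real j)}"
      using k trapezoid unfolding D by (elim insertE emptyE; simp add: move_simps trapside_def algebra_simps)
    moreover have "C = V" using trapezoid V C by auto
    moreover have "k < 4" using k by auto
    ultimately show ?thesis using trapezoid by blast
  next
    case (triangle a j)
    then have a: "a = real j" by simp
    have vs: "convex hull (set vs) = oct 0 a 0 a 0 a (- a) a"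
      using triangle hull_triangle[of a] by simp
    have "(t, u) \<in> V" using k triangle unfolding V by (auto simp: move_simps)
    moreover have "T = triform k t u (real j)"
      using k unfolding T vs a
      by (elim insertE emptyE; simp add: move_oct move_oct(2)[unfolded One_nat_def] triform_def algebra_simps)
    moreover have "D = {closed_segment (t, u) (tripoint k t u (real j)), closed_segment (t, u) (tripoint ((k + 1) mod 4) t u (real j))}"
      using k triangle unfolding D by (elim insertE emptyE; simp add: move_simps tripoint_def algebra_simps)
    moreover have "C = {tripoint k t u (real j), tripoint ((k + 1) mod 4) t u (real j)}"
      using k triangle unfolding C by (elim insertE emptyE; simp add: move_simps tripoint_def algebra_simps)
    moreover have "k < 4" using k by auto
    ultimately show ?thesis using triangle by blast
  qed
qed

section \<open>Tiles of a given color\<close>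

definition colored :: "int \<Rightarrow> point set" where
  "colored c = {(of_int i, of_int j) |i j. even (i + j + c)}"

definition ctile :: "int \<Rightarrow> point set \<Rightarrow> bool" where
  "ctile c T \<longleftrightarrow> (\<exists>V D C. presents T V D C \<and> V \<subseteq> \<int> \<times> \<int> \<and> C \<subseteq> colored c)"

lemma black_tile_iff: "black_tile T \<longleftrightarrow> ctile 0 T"
  by (simp add: black_tile_def ctile_def black_points_def colored_def)

lemma white_tile_iff: "white_tile T \<longleftrightarrow> ctile 1 T"
  by (simp add: white_tile_def ctile_def white_points_def colored_def)

lemma colored_subset_Ints: "colored c \<subseteq> \<int> \<times> \<int>"
  by (auto simp: colored_def)

lemma colored_shift:
  assumes "(x, y) \<in> colored c" "x' = x + of_int i" "y' = y + of_int j" "even (i + j)"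
  shows "(x', y') \<in> colored c"
proof -
  obtain k l where "x = of_int k" "y = of_int l" "even (k + l + c)"
    using assms by (auto simp: colored_def)
  then have "x' = of_int (k + i) \<and> y' = of_int (l + j) \<and> even ((k + i) + (l + j) + c)"
    using assms by auto
  then show ?thesis
    unfolding colored_def by blast
qed

lemma less_4_cases: "(k::nat) < 4 \<Longrightarrow> k = 0 \<or> k = 1 \<or> k = 2 \<or> k = 3"
  by linarith

lemma presents_move:
  assumes "prototile vs [] vs" "T = move k t ` (convex hull (set vs))"
  shows "presents T (move k t ` set vs) {} (move k t ` set vs)"
  unfolding presents_def hull_move assms(2)
  by (rule exI[of _ vs], rule exI[of _ "[]"], rule exI[of _ vs], rule exI[of _ k], rule exI[of _ t]) (simp add: assms(1))

lemma ctile_move: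
  assumes "prototile vs [] vs" "T = move k t ` (convex hull (set vs))" "move k t ` set vs \<subseteq> colored c"
  shows "ctile c T"
  using presents_move[OF assms(1,2)] assms(3) colored_subset_Ints unfolding ctile_def by blast

lemma ctile_octform:
  assumes "(x + real b, y) \<in> colored c"
  shows "ctile c (octform x y (real a) (real b))"
proof -
  note sh = colored_shift[OF assms]
  have s2: "(x + real b + real_of_int i, y + real_of_int j) \<in> colored c" if "even (i + j)" for i j
    using sh[OF refl refl that] .
  consider "a = 0" "b = 0" | "a = 0" "b > 0" | "a > 0" "b = 0" | "a > 0" "b > 0" by linarith
  then show ?thesis
  proof cases
    case 1
    show ?thesis
    proof (rule ctile_move[OF prototile.square[OF refl], of _ 0 "(x, y)"])
      show "octform x y (real a) (real b) = move 0 (x, y) ` (convex hull set [(0, 0), (2, 0), (2, 2), (0, 2)])"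
        using hull_octagon[of 0 0] 1 by (simp add: insert_commute move_oct octform_def algebra_simps)
      show "move 0 (x, y) ` set [(0, 0), (2, 0), (2, 2), (0, 2)] \<subseteq> colored c"
        using 1 s2[of 0 0] s2[of 2 0] s2[of 2 2] s2[of 0 2] by (auto simp: move_simps)
    qed
  next
    case 2
    show ?thesis
    proof (rule ctile_move[OF prototile.hexagon[OF refl 2(2) refl], of _ 0 "(x + real b, y)"])
      let ?vs = "[(0, 0), (2, 0), (2, 2), (2 - real b, 2 + real b), (- real b, 2 + real b), (- real b, real b)]"
      show "octform x y (real a) (real b) = move 0 (x + real b, y) ` (convex hull set ?vs)"
        using hull_octagon[of 0 b] 2 by (simp add: insert_commute move_oct octform_def algebra_simps)
      show "move 0 (x + real b, y) ` set ?vs \<subseteq> colored c"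
        using 2 s2[of 0 0] s2[of 2 0] s2[of 2 2] s2[of "2 - int b" "2 + int b"] s2[of "- int b" "2 + int b"] s2[of "- int b" "int b"]
        by (auto simp: move_simps algebra_simps)
    qed
  next
    case 3
    show ?thesis
    \<comment> \<open>The prototile hexagon has \<open>a = 0\<close>, so this one is its image under
      a quarter turn. The translation brings the lower left corner of the bounding box back to
      \<open>(x, y)\<close>.\<close>
    proof (rule ctile_move[OF prototile.hexagon[OF refl 3(1) refl], of _ 1 "(x + real a + 2, y + real a)"])
      let ?vs = "[(0, 0), (2, 0), (2, 2), (2 - real a, 2 + real a), (- real a, 2 + real a), (- real a, real a)]"
      show "octform x y (real a) (real b) = move 1 (x + real a + 2, y + real a) ` (convex hull set ?vs)"
        using hull_octagon[of 0 a] 3 by (simp add: insert_commute move_oct move_oct(2)[unfolded One_nat_def] octform_def algebra_simps)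
      show "move 1 (x + real a + 2, y + real a) ` set ?vs \<subseteq> colored c"
        using 3 s2[of "int a + 2" "int a"] s2[of "int a + 2" "int a + 2"] s2[of "int a" "int a + 2"] s2[of 0 2] s2[of 0 0] s2[of 2 0]
        by (auto simp: move_simps algebra_simps)
    qed
  next
    case 4
    show ?thesis
    proof (rule ctile_move[OF prototile.octagon[OF refl 4(1) refl 4(2) refl], of _ 0 "(x + real b, y)"])
      let ?a = "real a" and ?b = "real b"
      let ?vs = "[(0, 0), (2, 0), (2 + ?a, ?a), (2 + ?a, ?a + 2), (2 + ?a - ?b, ?a + ?b + 2),
          (?a - ?b, ?a + ?b + 2), (- ?b, ?b + 2), (- ?b, ?b)]"
      show "octform x y (real a) (real b) = move 0 (x + real b, y) ` (convex hull set ?vs)"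
        using hull_octagon[of a b] by (simp add: move_oct octform_def algebra_simps)
      show "move 0 (x + real b, y) ` set ?vs \<subseteq> colored c"
        using s2[of 0 0] s2[of 2 0] s2[of "2 + int a" "int a"] s2[of "2 + int a" "int a + 2"]
          s2[of "2 + int a - int b" "int a + int b + 2"] s2[of "int a - int b" "int a + int b + 2"]
          s2[of "- int b" "int b + 2"] s2[of "- int b" "int b"]
        by (auto simp: move_simps algebra_simps)
    qed
  qed
qed

lemma ctile_diaform:
  assumes "(x, y - 1) \<in> colored c"
  shows "ctile c (diaform x y)"
proof (rule ctile_move[OF prototile.diamond[OF refl], of _ 0 "(x, y - 1)"])
  note sh = colored_shift[OF assms]
  have s2: "(x + real_of_int i, y - 1 + real_of_int j) \<in> colored c" if "even (i + j)" for i j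
    using sh[OF refl refl that] .
  show "diaform x y = move 0 (x, y - 1) ` (convex hull set [(0, 0), (1, 1), (0, 2), (- 1, 1)])"
    by (simp add: hull_diamond move_oct diaform_def algebra_simps)
  show "move 0 (x, y - 1) ` set [(0, 0), (1, 1), (0, 2), (- 1, 1)] \<subseteq> colored c"
    using s2[of 0 0] s2[of 1 1] s2[of 0 2] s2[of "-1" 1] by (auto simp: move_simps)
qed

lemma presents_trapform:
  assumes "k < 4" "0 < a"
  shows "presents (trapform k x y (real a)) (move k (x, y) ` set [(0, 0), (2 * real a + 2, 0), (real a + 2, real a), (real a, real a)])
    {trapside k x y (real a)} (move k (x, y) ` set [(0, 0), (2 * real a + 2, 0), (real a + 2, real a), (real a, real a)])"
proof -
  have k: "k \<in> {0, 1, 2, 3}" using assms by auto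
  let ?vs = "[(0, 0), (2 * real a + 2, 0), (real a + 2, real a), (real a, real a)]"
  have "trapform k x y (real a) = move k (x, y) ` (convex hull (set ?vs))"
    using hull_trapezoid[of a] k
    by (elim insertE emptyE; simp add: move_oct move_oct(2)[unfolded One_nat_def] trapform_def algebra_simps)
  then have T: "trapform k x y (real a) = convex hull (move k (x, y) ` (set ?vs))"
    by (simp only: hull_move)
  show ?thesis
    unfolding presents_def
  proof (intro exI conjI)
    show "prototile ?vs [((0, 0), (2 * real a + 2, 0))] ?vs"
      by (rule prototile.trapezoid[OF refl]) (use assms in auto)
    show "{trapside k x y (real a)} = (\<lambda>(p, q). closed_segment (move k (x, y) p) (move k (x, y) q)) ` set [((0, 0), (2 * real a + 2, 0))]"
      using k by (elim insertE emptyE; simp add: move_simps trapside_def algebra_simps)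
  qed (fact T refl)+
qed

lemma ctile_trapform:
  assumes "k < 4" "0 < a" "(x, y) \<in> colored c"
  shows "ctile c (trapform k x y (real a))"
proof -
  note sh = colored_shift[OF assms(3)]
  have s2: "(x + real_of_int i, y + real_of_int j) \<in> colored c" if "even (i + j)" for i j
    using sh[OF refl refl that] .
  have k: "k \<in> {0, 1, 2, 3}" using assms by auto
  have "move k (x, y) ` set [(0, 0), (2 * real a + 2, 0), (real a + 2, real a), (real a, real a)] \<subseteq> colored c"
    using k s2[of 0 0] s2[of "2 * int a + 2" 0] s2[of "int a + 2" "int a"] s2[of "int a" "int a"]
      s2[of 0 "2 * int a + 2"] s2[of "- int a" "int a + 2"] s2[of "- int a" "int a"]
      s2[of "- 2 * int a - 2" 0] s2[of "- int a - 2" "- int a"] s2[of "- int a" "- int a"]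
      s2[of 0 "- 2 * int a - 2"] s2[of "int a" "- int a - 2"] s2[of "int a" "- int a"]
    by (elim insertE emptyE; simp add: move_simps algebra_simps)
  then show ?thesis
    using presents_trapform[OF assms(1,2)] colored_subset_Ints unfolding ctile_def by blast
qed

lemma presents_triform:
  assumes "k < 4" "0 < a"
  shows "presents (triform k x y (real a)) (move k (x, y) ` set [(0, 0), (real a, 0), (0, real a)])
    {closed_segment (x, y) (tripoint k x y (real a)), closed_segment (x, y) (tripoint ((k + 1) mod 4) x y (real a))}
    {tripoint k x y (real a), tripoint ((k + 1) mod 4) x y (real a)}"
proof -
  have k: "k \<in> {0, 1, 2, 3}" using assms by auto
  let ?vs = "[(0, 0), (real a, 0), (0, real a)]"
  have "triform k x y (real a) = move k (x, y) ` (convex hull (set ?vs))"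
    using hull_triangle[of a] k
    by (elim insertE emptyE; simp add: move_oct move_oct(2)[unfolded One_nat_def] triform_def algebra_simps)
  then have T: "triform k x y (real a) = convex hull (move k (x, y) ` (set ?vs))"
    by (simp only: hull_move)
  show ?thesis
    unfolding presents_def
  proof (intro exI conjI)
    show "prototile ?vs [((0, 0), (real a, 0)), ((0, 0), (0, real a))] [(real a, 0), (0, real a)]"
      by (rule prototile.triangle[OF refl]) (use assms in auto)
    show "{closed_segment (x, y) (tripoint k x y (real a)), closed_segment (x, y) (tripoint ((k + 1) mod 4) x y (real a))} =
        (\<lambda>(p, q). closed_segment (move k (x, y) p) (move k (x, y) q)) ` set [((0, 0), (real a, 0)), ((0, 0), (0, real a))]"
      using k by (elim insertE emptyE; simp add: move_simps tripoint_def algebra_simps)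
    show "{tripoint k x y (real a), tripoint ((k + 1) mod 4) x y (real a)} = move k (x, y) ` set [(real a, 0), (0, real a)]"
      using k by (elim insertE emptyE; simp add: move_simps tripoint_def algebra_simps)
  qed (fact T refl)+
qed

text \<open>The two acute vertices differ by \<open>a\<close> in each coordinate, up to signs, so
  the difference has even coordinate sum.\<close>

lemma tripoint_colored:
  assumes "k < 4"
  shows "tripoint ((k + 1) mod 4) x y (real a) \<in> colored c \<longleftrightarrow> tripoint k x y (real a) \<in> colored c"
proof -
  have *: "(x, y) \<in> colored c \<longleftrightarrow> (x', y') \<in> colored c"
    if *: "x' = x + of_int i" "y' = y + of_int j" "even (i + j)" for x y x' y' i j
  proof
    show "(x', y') \<in> colored c" if "(x, y) \<in> colored c"
      by (rule colored_shift[OF that *])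
    show "(x, y) \<in> colored c" if "(x', y') \<in> colored c"
      by (rule colored_shift[OF that, of _ "- i" _ "- j"]) (use * in auto)
  qed
  show ?thesis
    using less_4_cases[OF assms]
  proof (elim disjE)
    assume "k = 0" then show ?thesis
      by (simp add: tripoint_def) (rule *[where i="int a" and j="- int a"]; simp)
  next
    assume "k = 1" then show ?thesis
      by (simp add: tripoint_def) (rule *[where i="int a" and j="int a"]; simp)
  next
    assume "k = 2" then show ?thesis
      by (simp add: tripoint_def) (rule *[where i="- int a" and j="int a"]; simp)
  next
    assume "k = 3" then show ?thesis
      by (simp add: tripoint_def) (rule *[where i="- int a" and j="- int a"]; simp)
  qed
qed

lemma ctile_triform:
  assumes "k < 4" "0 < a" "x \<in> \<int>" "y \<in> \<int>" "tripoint k x y (real a) \<in> colored c"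
  shows "ctile c (triform k x y (real a))"
proof -
  have k: "k \<in> {0, 1, 2, 3}" using assms by auto
  have "move k (x, y) ` set [(0, 0), (real a, 0), (0, real a)] \<subseteq> \<int> \<times> \<int>"
    using k assms by (elim insertE emptyE; simp add: move_simps)
  moreover have "tripoint ((k + 1) mod 4) x y (real a) \<in> colored c"
    using tripoint_colored assms by blast
  ultimately show ?thesis
    unfolding ctile_def using presents_triform[OF assms(1,2)] assms(5) by blast
qed

text \<open>Attained bounds are determined by the set, so the dashed sides of a tile do not depend on its presentation.\<close>
definition tight :: "point set \<Rightarrow> real \<times> real \<times> real \<times> real \<times> real \<times> real \<times> real \<times> real \<Rightarrow> bool" where
  "tight T = (\<lambda>(x1, x2, y1, y2, s1, s2, d1, d2).
     T \<subseteq> oct x1 x2 y1 y2 s1 s2 d1 d2 \<and>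
     (\<exists>z\<in>T. fst z = x1) \<and> (\<exists>z\<in>T. fst z = x2) \<and> (\<exists>z\<in>T. snd z = y1) \<and> (\<exists>z\<in>T. snd z = y2) \<and>
     (\<exists>z\<in>T. fst z + snd z = s1) \<and> (\<exists>z\<in>T. fst z + snd z = s2) \<and>
     (\<exists>z\<in>T. fst z - snd z = d1) \<and> (\<exists>z\<in>T. fst z - snd z = d2))"

lemma tight_unique:
  assumes "tight T t" "tight T t'"
  shows "t = t'"
proof -
  obtain x1 x2 y1 y2 s1 s2 d1 d2 where t: "t = (x1, x2, y1, y2, s1, s2, d1, d2)"
    by (metis surj_pair)
  obtain x1' x2' y1' y2' s1' s2' d1' d2' where t': "t' = (x1', x2', y1', y2', s1', s2', d1', d2')"
    by (metis surj_pair)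
  have lower: "l = l'" if "\<exists>z\<in>T. f z = l" "\<exists>z\<in>T. f z = l'" "\<forall>z\<in>T. l \<le> f z" "\<forall>z\<in>T. l' \<le> f z"
    for f and l l' :: real
    using that by force
  have upper: "l = l'" if "\<exists>z\<in>T. f z = l" "\<exists>z\<in>T. f z = l'" "\<forall>z\<in>T. f z \<le> l" "\<forall>z\<in>T. f z \<le> l'"
    for f and l l' :: real
    using that by force
  have "T \<subseteq> oct x1 x2 y1 y2 s1 s2 d1 d2" "T \<subseteq> oct x1' x2' y1' y2' s1' s2' d1' d2'"
    using assms unfolding tight_def t t' by simp_all
  then have bounds:
    "\<forall>z\<in>T. x1 \<le> fst z" "\<forall>z\<in>T. fst z \<le> x2" "\<forall>z\<in>T. y1 \<le> snd z" "\<forall>z\<in>T. snd z \<le> y2"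
    "\<forall>z\<in>T. s1 \<le> fst z + snd z" "\<forall>z\<in>T. fst z + snd z \<le> s2"
    "\<forall>z\<in>T. d1 \<le> fst z - snd z" "\<forall>z\<in>T. fst z - snd z \<le> d2"
    "\<forall>z\<in>T. x1' \<le> fst z" "\<forall>z\<in>T. fst z \<le> x2'" "\<forall>z\<in>T. y1' \<le> snd z" "\<forall>z\<in>T. snd z \<le> y2'"
    "\<forall>z\<in>T. s1' \<le> fst z + snd z" "\<forall>z\<in>T. fst z + snd z \<le> s2'"
    "\<forall>z\<in>T. d1' \<le> fst z - snd z" "\<forall>z\<in>T. fst z - snd z \<le> d2'"
    unfolding oct_def by auto
  have att: "(\<exists>z\<in>T. fst z = x1) \<and> (\<exists>z\<in>T. fst z = x2) \<and> (\<exists>z\<in>T. snd z = y1) \<and> (\<exists>z\<in>T. snd z = y2) \<and>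
     (\<exists>z\<in>T. fst z + snd z = s1) \<and> (\<exists>z\<in>T. fst z + snd z = s2) \<and>
     (\<exists>z\<in>T. fst z - snd z = d1) \<and> (\<exists>z\<in>T. fst z - snd z = d2)"
    "(\<exists>z\<in>T. fst z = x1') \<and> (\<exists>z\<in>T. fst z = x2') \<and> (\<exists>z\<in>T. snd z = y1') \<and> (\<exists>z\<in>T. snd z = y2') \<and>
     (\<exists>z\<in>T. fst z + snd z = s1') \<and> (\<exists>z\<in>T. fst z + snd z = s2') \<and>
     (\<exists>z\<in>T. fst z - snd z = d1') \<and> (\<exists>z\<in>T. fst z - snd z = d2')"
    using assms unfolding tight_def t t' by simp_all
  have "x1 = x1'"
    using att bounds by (intro lower[of fst]) blast+
  moreover have "x2 = x2'"
    using att bounds by (intro upper[of fst]) blast+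
  moreover have "y1 = y1'"
    using att bounds by (intro lower[of snd]) blast+
  moreover have "y2 = y2'"
    using att bounds by (intro upper[of snd]) blast+
  moreover have "s1 = s1'"
    using att bounds by (intro lower[of "\<lambda>z. fst z + snd z"]) blast+
  moreover have "s2 = s2'"
    using att bounds by (intro upper[of "\<lambda>z. fst z + snd z"]) blast+
  moreover have "d1 = d1'"
    using att bounds by (intro lower[of "\<lambda>z. fst z - snd z"]) blast+
  moreover have "d2 = d2'"
    using att bounds by (intro upper[of "\<lambda>z. fst z - snd z"]) blast+
  ultimately show ?thesis using t t' by simp
qed

lemma tightI:
  assumes "V \<subseteq> oct x1 x2 y1 y2 s1 s2 d1 d2"
    "(\<exists>z\<in>V. fst z = x1)" "(\<exists>z\<in>V. fst z = x2)" "(\<exists>z\<in>V. snd z = y1)" "(\<exists>z\<in>V. snd z = y2)"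
    "(\<exists>z\<in>V. fst z + snd z = s1)" "(\<exists>z\<in>V. fst z + snd z = s2)"
    "(\<exists>z\<in>V. fst z - snd z = d1)" "(\<exists>z\<in>V. fst z - snd z = d2)"
  shows "tight (oct x1 x2 y1 y2 s1 s2 d1 d2) (x1, x2, y1, y2, s1, s2, d1, d2)"
  using assms unfolding tight_def by auto

lemma tight_octform:
  assumes "0 \<le> a" "0 \<le> b"
  shows "tight (octform x y a b) (x, x + a + b + 2, y, y + a + b + 2,
     x + y + b, x + y + 2 * a + b + 4, x - y - b - 2, x - y + b + 2)"
  unfolding octform_def
  by (rule tightI[of "{(x + b, y), (x + b + 2, y), (x, y + b), (x, y + b + 2),
     (x + a + b + 2, y + a + 2), (x + a + b + 2, y + a), (x + a, y + a + b + 2)}"])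
    (use assms in \<open>auto simp: mem_oct\<close>)

lemma tight_diaform:
  "tight (diaform x y) (x - 1, x + 1, y - 1, y + 1, x + y - 1, x + y + 1, x - y - 1, x - y + 1)"
  unfolding diaform_def
  by (rule tightI[of "{(x - 1, y), (x + 1, y), (x, y - 1), (x, y + 1)}"]) (auto simp: mem_oct)

lemma tight_trapform:
  assumes "0 \<le> a"
  shows "tight (trapform k x y a)
     (if k = 0 then (x, x + 2 * a + 2, y, y + a, x + y, x + y + 2 * a + 2, x - y, x - y + 2 * a + 2)
      else if k = 1 then (x - a, x, y, y + 2 * a + 2, x + y, x + y + 2 * a + 2, x - y - 2 * a - 2, x - y)
      else if k = 2 then (x - 2 * a - 2, x, y - a, y, x + y - 2 * a - 2, x + y, x - y - 2 * a - 2, x - y)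
      else (x, x + a, y - 2 * a - 2, y, x + y - 2 * a - 2, x + y, x - y, x - y + 2 * a + 2))"
proof -
  note tight1 = tightI[of "{(x, y), (x + 2 * a + 2, y), (x + a + 2, y + a), (x + a, y + a)}"]
    tightI[of "{(x, y), (x, y + 2 * a + 2), (x - a, y + a + 2), (x - a, y + a)}"]
    tightI[of "{(x, y), (x - 2 * a - 2, y), (x - a - 2, y - a), (x - a, y - a)}"]
    tightI[of "{(x, y), (x, y - 2 * a - 2), (x + a, y - a - 2), (x + a, y - a)}"]
  consider "k = 0" | "k = 1" | "k = 2" | "k > 2" by linarith
  then show ?thesis
    by cases (simp_all add: trapform_def, (rule tight1(1) tight1(2) tight1(3) tight1(4); use assms in \<open>auto simp: mem_oct; fail\<close>)+)
qed

lemma tight_triform: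
  assumes "0 \<le> a"
  shows "tight (triform k x y a)
     (if k = 0 then (x, x + a, y, y + a, x + y, x + y + a, x - y - a, x - y + a)
      else if k = 1 then (x - a, x, y, y + a, x + y - a, x + y + a, x - y - a, x - y)
      else if k = 2 then (x - a, x, y - a, y, x + y - a, x + y, x - y - a, x - y + a)
      else (x, x + a, y - a, y, x + y - a, x + y + a, x - y, x - y + a))"
proof -
  note tight1 = tightI[of "{(x, y), (x + a, y), (x, y + a)}"]
    tightI[of "{(x, y), (x - a, y), (x, y + a)}"]
    tightI[of "{(x, y), (x - a, y), (x, y - a)}"]
    tightI[of "{(x, y), (x + a, y), (x, y - a)}"]
  consider "k = 0" | "k = 1" | "k = 2" | "k > 2" by linarith
  then show ?thesis
    by cases (simp_all add: triform_def, (rule tight1(1) tight1(2) tight1(3) tight1(4); use assms in \<open>auto simp: mem_oct; fail\<close>)+)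
qed

lemma dashed_side_cases:
  assumes "dashed_side T s"
  obtains k x y a where "k < 4" "0 < a" "T = trapform k x y (real a)" "s = trapside k x y (real a)"
  | k x y a j where "k < 4" "0 < a" "T = triform k x y (real a)"
      "j = k \<or> j = (k + 1) mod 4" "s = closed_segment (x, y) (tripoint j x y (real a))"
proof -
  obtain V D C where p: "presents T V D C" and s: "s \<in> D"
    using assms unfolding dashed_side_def by blast
  from presents_forms[OF p] s show thesis
    by (elim disjE exE conjE) (use that in blast)+
qed

text \<open>\<open>dashed_side\<close> ranges over all presentations of a set, so it must be
  excluded that an octagon is also a trapezoid or a triangle. The eight attained bounds tell these
  shapes apart.\<close>

lemma not_dashed_octform:
  assumes "0 \<le> a" "0 \<le> b"
  shows "\<not> dashed_side (octform x y a b) s"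
proof
  assume "dashed_side (octform x y a b) s"
  then show False
  proof (cases rule: dashed_side_cases)
    case (1 k x' y' a')
    show False
      using tight_unique[OF tight_octform[OF assms, of x y] tight_trapform[OF of_nat_0_le_iff, of k x' y' a', folded 1(3)]]
        less_4_cases[OF 1(1)] 1(2) assms
      by (elim disjE; simp; (elim conjE)?; (intro conjI)?; linarith)
  next
    case (2 k x' y' a' j)
    show False
      using tight_unique[OF tight_octform[OF assms, of x y] tight_triform[OF of_nat_0_le_iff, of k x' y' a', folded 2(3)]]
        less_4_cases[OF 2(1)] 2(2) assms
      by (elim disjE; simp; (elim conjE)?; (intro conjI)?; linarith)
  qed
qed

lemma not_dashed_diaform: "\<not> dashed_side (diaform x y) s"
proof
  assume "dashed_side (diaform x y) s"
  then show False
  proof (cases rule: dashed_side_cases)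
    case (1 k x' y' a')
    show False
      using tight_unique[OF tight_diaform[of x y] tight_trapform[OF of_nat_0_le_iff, of k x' y' a', folded 1(3)]]
        less_4_cases[OF 1(1)] 1(2)
      by (elim disjE; simp; (elim conjE)?; (intro conjI)?; linarith)
  next
    case (2 k x' y' a' j)
    show False
      using tight_unique[OF tight_diaform[of x y] tight_triform[OF of_nat_0_le_iff, of k x' y' a', folded 2(3)]]
        less_4_cases[OF 2(1)] 2(2)
      by (elim disjE; simp; (elim conjE)?; (intro conjI)?; linarith)
  qed
qed

lemma dashed_trapform:
  assumes "dashed_side (trapform k x y a) s" "0 < a" "k < 4"
  shows "s = trapside k x y a"
proof -
  note A = tight_trapform[OF less_imp_le[OF assms(2)], of k x y]
  show ?thesis
    using assms(1)
  proof (cases rule: dashed_side_cases)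
    case (1 k' x' y' a')
    note tight_unique[OF A tight_trapform[OF of_nat_0_le_iff, of k' x' y' a', folded 1(3)]]
    then have "k' = k \<and> x' = x \<and> y' = y \<and> real a' = a"
      using less_4_cases[OF 1(1)] less_4_cases[OF assms(3)] 1(2) assms(2)
      by (elim disjE; simp; (elim conjE)?; (intro conjI)?; linarith)
    then show ?thesis using 1 by simp
  next
    case (2 k' x' y' a' j)
    note tight_unique[OF A tight_triform[OF of_nat_0_le_iff, of k' x' y' a', folded 2(3)]]
    then have False
      using less_4_cases[OF 2(1)] less_4_cases[OF assms(3)] 2(2) assms(2)
      by (elim disjE; simp; (elim conjE)?; (intro conjI)?; linarith)
    then show ?thesis ..
  qed
qed

lemma dashed_triform:
  assumes "dashed_side (triform k x y a) s" "0 < a" "k < 4"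
  shows "s = closed_segment (x, y) (tripoint k x y a) \<or> s = closed_segment (x, y) (tripoint ((k + 1) mod 4) x y a)"
proof -
  note A = tight_triform[OF less_imp_le[OF assms(2)], of k x y]
  show ?thesis
    using assms(1)
  proof (cases rule: dashed_side_cases)
    case (1 k' x' y' a')
    note tight_unique[OF A tight_trapform[OF of_nat_0_le_iff, of k' x' y' a', folded 1(3)]]
    then have False
      using less_4_cases[OF 1(1)] less_4_cases[OF assms(3)] 1(2) assms(2)
      by (elim disjE; simp; (elim conjE)?; (intro conjI)?; linarith)
    then show ?thesis ..
  next
    case (2 k' x' y' a' j)
    note tight_unique[OF A tight_triform[OF of_nat_0_le_iff, of k' x' y' a', folded 2(3)]]
    then have "k' = k \<and> x' = x \<and> y' = y \<and> real a' = a"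
      using less_4_cases[OF 2(1)] less_4_cases[OF assms(3)] 2(2) assms(2)
      by (elim disjE; simp; (elim conjE)?; (intro conjI)?; linarith)
    then show ?thesis using 2 by auto
  qed
qed

section \<open>Auxiliary facts on integers\<close>

lemma maximal_run:
  fixes P :: "int \<Rightarrow> bool"
  assumes "\<not> P z" "\<exists>p>z. P p" "\<exists>p<z. P p"
  obtains p1 p2 where "p1 \<le> z" "z \<le> p2" "\<And>p. p1 \<le> p \<Longrightarrow> p \<le> p2 \<Longrightarrow> \<not> P p" "P (p1 - 1)" "P (p2 + 1)"
proof -
  obtain a where a: "z < a" "P a" using assms by blast
  define k where "k = (LEAST k. P (z + int k))"
  have "P (z + int (nat (a - z)))" using a by simp
  then have k: "P (z + int k)" "\<And>j. j < k \<Longrightarrow> \<not> P (z + int j)"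
    unfolding k_def by (rule LeastI, use not_less_Least in blast)
  obtain b where b: "b < z" "P b" using assms by blast
  define l where "l = (LEAST l. P (z - int l))"
  have "P (z - int (nat (z - b)))" using b by simp
  then have l: "P (z - int l)" "\<And>j. j < l \<Longrightarrow> \<not> P (z - int j)"
    unfolding l_def by (rule LeastI, use not_less_Least in blast)
  have kl: "0 < k" "0 < l" using k(1) l(1) assms(1) by (auto intro: Nat.gr0I)
  show thesis
  proof (rule that)
    show "z - int l + 1 \<le> z" "z \<le> z + int k - 1" using kl by auto
    show "P (z - int l + 1 - 1)" "P (z + int k - 1 + 1)" using k l by auto
    fix p assume p: "z - int l + 1 \<le> p" "p \<le> z + int k - 1"
    show "\<not> P p"
    proof (cases "z \<le> p")
      case True
      then show ?thesis using k(2)[of "nat (p - z)"] p by auto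
    next
      case False
      then show ?thesis using l(2)[of "nat (z - p)"] p by auto
    qed
  qed
qed

lemma int_translation_invariant:
  fixes f :: "int \<Rightarrow> 'a"
  assumes "\<And>p. f (p + L) = f p"
  shows "f (p + k * L) = f p"
proof (induction k rule: int_induct[of _ 0])
  case base
  show ?case by simp
next
  case (step1 k)
  then show ?case using assms[of "p + k * L"] by (simp add: algebra_simps)
next
  case (step2 k)
  then show ?case using assms[of "p + (k - 1) * L"] by (simp add: algebra_simps)
qed

lemma int_translation_witness:
  fixes P :: "int \<Rightarrow> bool"
  assumes "\<And>p. P (p + L) = P p" "0 < L" "P a"
  shows "\<exists>p>z. P p" "\<exists>p<z. P p"
proof -
  have P: "P (a + k * L)" for k
    using int_translation_invariant[of P, OF assms(1)] assms(3) by simp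
  \<comment> \<open>Since \<open>L\<close> is at least 1, \<open>K\<close> periods exceed the
    distance between \<open>a\<close> and \<open>z\<close>, in either direction.\<close>
  define K where "K = \<bar>z - a\<bar> + 1"
  have "K \<le> K * L" "z - a < K" "a - z < K"
    using assms(2) mult_left_mono[of 1 L K] unfolding K_def by auto
  then have "z < a + K * L" "a + (- K) * L < z"
    unfolding mult_minus_left by linarith+
  then show "\<exists>p>z. P p" "\<exists>p<z. P p" using P by blast+
qed

text \<open>Folds the line onto \<open>{- 1..M}\<close> by the reflections in \<open>- 1\<close> and \<open>M\<close>.\<close>
definition fold_coord :: "int \<Rightarrow> int \<Rightarrow> int" where
  "fold_coord M x = (let r = (x + 1) mod (2 * (M + 1)) in if r \<le> M + 1 then r - 1 else 2 * M + 1 - r)"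

lemma fold_eq:
  assumes "0 < M" "x = 2 * (M + 1) * k + y" "- 1 \<le> y" "y \<le> 2 * M"
  shows "fold_coord M x = (if y \<le> M then y else 2 * M - y)"
proof -
  have "(x + 1) mod (2 * (M + 1)) = (y + 1 + 2 * (M + 1) * k) mod (2 * (M + 1))"
    using assms(2) by (simp add: ac_simps)
  also have "\<dots> = y + 1"
    unfolding mod_mult_self2 using assms by simp
  finally show ?thesis
    unfolding fold_coord_def by auto
qed

lemma fold_cases:
  fixes M x :: int
  assumes "0 < M"
  obtains k y where "x = 2 * (M + 1) * k + y" "- 1 \<le> y" "y \<le> 2 * M"
proof -
  define L where "L = 2 * (M + 1)"
  have L: "0 < L" using assms unfolding L_def by simp
  have "x = L * ((x + 1) div L) + ((x + 1) mod L - 1)"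
    using mult_div_mod_eq[of L "x + 1"] by linarith
  moreover have "- 1 \<le> (x + 1) mod L - 1" "(x + 1) mod L - 1 \<le> 2 * M"
    using pos_mod_bound[OF L, of "x + 1"] pos_mod_sign[OF L, of "x + 1"] unfolding L_def by simp_all
  ultimately show thesis by (rule that[folded L_def])
qed

lemma fold_id: "0 < M \<Longrightarrow> - 1 \<le> x \<Longrightarrow> x \<le> M \<Longrightarrow> fold_coord M x = x"
  using fold_eq[of M x 0 x] by simp

lemma fold_periodic: "fold_coord M (x + 2 * (M + 1) * k) = fold_coord M x"
proof -
  have "(x + 2 * (M + 1) * k + 1) mod (2 * (M + 1)) = (x + 1 + 2 * (M + 1) * k) mod (2 * (M + 1))"
    by (simp add: ac_simps)
  also have "\<dots> = (x + 1) mod (2 * (M + 1))"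
    by (rule mod_mult_self2)
  finally show ?thesis unfolding fold_coord_def by simp
qed

lemma fold_reflect_low:
  assumes "0 < M"
  shows "fold_coord M (- 2 - x) = fold_coord M x"
proof -
  obtain k y where xy: "x = 2 * (M + 1) * k + y" "- 1 \<le> y" "y \<le> 2 * M" by (rule fold_cases[OF assms])
  show ?thesis
  proof (cases "y = - 1")
    case True
    have "- 2 - x = 2 * (M + 1) * (- k) + - 1" using xy True by simp
    from fold_eq[OF assms this] fold_eq[OF assms xy] True assms show ?thesis by simp
  next
    case False
    have "- 2 - x = 2 * (M + 1) * (- k - 1) + (2 * M - y)" using xy by (simp add: algebra_simps)
    from fold_eq[OF assms this] fold_eq[OF assms xy] False xy assms show ?thesis by auto
  qed
qed

lemma fold_reflect_high:
  assumes "0 < M"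
  shows "fold_coord M (2 * M - x) = fold_coord M x"
proof -
  have "fold_coord M (2 * M - x) = fold_coord M (- 2 - x + 2 * (M + 1) * 1)"
    by (simp add: algebra_simps)
  also have "\<dots> = fold_coord M x"
    by (simp only: fold_periodic fold_reflect_low[OF assms])
  finally show ?thesis .
qed

text \<open>Off the mirrors, folding maps neighbours to neighbours, possibly in reversed order; on a
  mirror, the two neighbours fold to the same point. This case distinction extends the kernel
  equation to the whole plane.\<close>

lemma fold_step:
  assumes "0 < M"
  shows "0 \<le> fold_coord M x \<and> fold_coord M x \<le> M - 1 \<and>
       (fold_coord M (x + 1) = fold_coord M x + 1 \<and> fold_coord M (x - 1) = fold_coord M x - 1 \<or>
        fold_coord M (x + 1) = fold_coord M x - 1 \<and> fold_coord M (x - 1) = fold_coord M x + 1) \<or>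
     (fold_coord M x = - 1 \<or> fold_coord M x = M) \<and> fold_coord M (x + 1) = fold_coord M (x - 1)"
proof -
  obtain k y where xy: "x = 2 * (M + 1) * k + y" "- 1 \<le> y" "y \<le> 2 * M" by (rule fold_cases[OF assms])
  have F: "fold_coord M (2 * (M + 1) * k + z) = fold_coord M z" for z
    using fold_periodic[of M z k] by (simp add: ac_simps)
  have x: "fold_coord M x = fold_coord M y" "fold_coord M (x + 1) = fold_coord M (y + 1)" "fold_coord M (x - 1) = fold_coord M (y - 1)"
    using F[of y] F[of "y + 1"] F[of "y - 1"] unfolding xy(1) by (simp_all add: algebra_simps)
  have low: "fold_coord M z = z" if "- 1 \<le> z" "z \<le> M" for z
    using fold_id[OF assms that] .
  have high: "fold_coord M z = 2 * M - z" if "M \<le> z" "z \<le> 2 * M + 1" for z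
    using fold_reflect_high[OF assms, of z] fold_id[OF assms, of "2 * M - z"] that by simp
  have m2: "fold_coord M (- 2) = 0"
    using fold_reflect_low[OF assms, of 0] low[of 0] assms by simp
  consider "y = - 1" | "0 \<le> y" "y \<le> M - 1" | "y = M" | "M + 1 \<le> y" "y \<le> 2 * M"
    using xy by linarith
  then show ?thesis
  proof cases
    case 1
    then show ?thesis unfolding x using low[of "- 1"] low[of 0] m2 assms by simp
  next
    case 2
    then show ?thesis unfolding x using low[of y] low[of "y + 1"] low[of "y - 1"] by simp
  next
    case 3
    then show ?thesis unfolding x using low[of M] low[of "M - 1"] high[of "M + 1"] assms by simp
  next
    case 4
    then show ?thesis unfolding x using high[of y] high[of "y + 1"] high[of "y - 1"] by simp
  qed
qed

text \<open>Both reflections, \<open>- 2 - x\<close> and \<open>2 * M - x\<close>, preserve parity;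
  therefore folding respects the coloring.\<close>

lemma even_fold:
  assumes "0 < M"
  shows "even (fold_coord M x) = even x"
proof -
  obtain k y where xy: "x = 2 * (M + 1) * k + y" "- 1 \<le> y" "y \<le> 2 * M" by (rule fold_cases[OF assms])
  show ?thesis unfolding fold_eq[OF assms xy] using xy(1) by auto
qed

lemma bit_sum_zero_iff:
  fixes a b c d :: bit
  shows "a + b + c + d = 0 \<longleftrightarrow> ((a = 1) \<noteq> (b = 1)) = ((c = 1) \<noteq> (d = 1))"
  by (cases a; cases b; cases c; cases d) auto

section \<open>Tiles that can occur in a tiling\<close>

locale board =
  fixes c m n :: int
  assumes m2: "2 \<le> m" and n2: "2 \<le> n"
begin

abbreviation R :: "point set" where "R \<equiv> rect m n"

text \<open>The octagon whose colored inner points are those with coordinates in \<open>{p1..p2} \<times> {q1..q2}\<close>.\<close>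
definition region :: "int \<Rightarrow> int \<Rightarrow> int \<Rightarrow> int \<Rightarrow> point set" where
  "region p1 p2 q1 q2 = octform (of_int (p1 + q1 + c - 1)) (of_int (p1 - q2 - 1)) (of_int (p2 - p1)) (of_int (q2 - q1))"

definition dia :: "int \<Rightarrow> int \<Rightarrow> point set" where
  "dia p q = diaform (of_int (p + q + c + 1)) (of_int (p - q))"

text \<open>In each direction, the octagon lies on the right side of the boundary line of \<open>R\<close> or is symmetric in the mirror line one unit outside.\<close>
definition adm :: "int \<Rightarrow> int \<Rightarrow> int \<Rightarrow> int \<Rightarrow> bool" where
  "adm p1 p2 q1 q2 \<longleftrightarrow> p1 \<le> p2 \<and> q1 \<le> q2 \<and>
     (0 \<le> p1 + q1 + c - 1 \<or> p1 = - 1 - c - q2 \<and> p2 = - 1 - c - q1) \<and>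
     (p2 + q2 + c + 1 \<le> m - 1 \<or> p1 = m - c - q2 \<and> p2 = m - c - q1) \<and>
     (0 \<le> p1 - q2 - 1 \<or> p1 = q1 - 1 \<and> p2 = q2 - 1) \<and>
     (p2 - q1 + 1 \<le> n - 1 \<or> p1 = q1 + n \<and> p2 = q2 + n)"

text \<open>
  A diamond is cut into four triangles by its diagonals; \<open>g\<close> and \<open>h\<close> tell whether the triangle is in
  the eastern and in the northern half.
\<close>
definition test :: "int \<Rightarrow> int \<Rightarrow> bool \<Rightarrow> bool \<Rightarrow> point" where
  "test p q g h = (of_int (p + q + 1 + c) + (if g then 1 / 4 else - (1 / 4)),
                   of_int (p - q) + (if h then 1 / 4 else - (1 / 4)))"

text \<open>The test point discards octagons that meet \<open>R\<close> in a set without interior: a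
  square centred on a mirror, for instance, touches \<open>R\<close> along a segment only and would
  be a trapezoid with \<open>a = 0\<close>.\<close>

definition good :: "point set \<Rightarrow> bool" where
  "good T \<longleftrightarrow> (\<exists>p q. T = dia p q \<and> T \<subseteq> R) \<or>
     (\<exists>p1 p2 q1 q2. adm p1 p2 q1 q2 \<and> T = region p1 p2 q1 q2 \<inter> R \<and> (\<exists>p q g h. test p q g h \<in> T))"

lemma mem_rect: "(x, y) \<in> R \<longleftrightarrow> 0 \<le> x \<and> x \<le> of_int m - 1 \<and> 0 \<le> y \<and> y \<le> of_int n - 1"
  by (auto simp: rect_def)

lemma convex_rect: "convex R"
  unfolding rect_def by (intro convex_Times) auto

lemma interior_rect: "(x, y) \<in> interior R \<longleftrightarrow> 0 < x \<and> x < of_int m - 1 \<and> 0 < y \<and> y < of_int n - 1"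
  by (auto simp: rect_def interior_Times interior_atLeastAtMost_real)

lemma closed_rect: "closed R"
  unfolding rect_def by (intro closed_Times) auto

lemma mem_frontier_rect:
  "(x, y) \<in> frontier R \<longleftrightarrow> (x, y) \<in> R \<and> (x = 0 \<or> x = of_int m - 1 \<or> y = 0 \<or> y = of_int n - 1)"
proof -
  have "(x, y) \<in> frontier R \<longleftrightarrow> (x, y) \<in> R \<and> (x, y) \<notin> interior R"
    by (simp add: frontier_def closure_closed closed_rect)
  then show ?thesis
    unfolding interior_rect mem_rect by linarith
qed

lemma mem_colored: "(x, y) \<in> colored c \<longleftrightarrow> (\<exists>p q. x = of_int (p + q + c) \<and> y = of_int (p - q))"
proof
  assume "(x, y) \<in> colored c"
  then obtain i j where ij: "x = of_int i" "y = of_int j" "even (i + j + c)"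
    by (auto simp: colored_def)
  then have "even (i + j - c)" by simp
  then obtain p where p: "i + j - c = 2 * p" by (elim evenE)
  have "i = p + (p - j) + c" "j = p - (p - j)" using p by auto
  then show "\<exists>p q. x = of_int (p + q + c) \<and> y = of_int (p - q)"
    using ij by metis
next
  assume "\<exists>p q. x = of_int (p + q + c) \<and> y = of_int (p - q)"
  then obtain p q where pq: "x = of_int (p + q + c)" "y = of_int (p - q)" by blast
  have "even ((p + q + c) + (p - q) + c)" by simp
  then show "(x, y) \<in> colored c"
    using pq unfolding colored_def by blast
qed

lemma mem_region:
  "(x, y) \<in> region p1 p2 q1 q2 \<longleftrightarrow>
     of_int (p1 + q1 + c - 1) \<le> x \<and> x \<le> of_int (p2 + q2 + c + 1) \<and>
     of_int (p1 - q2 - 1) \<le> y \<and> y \<le> of_int (p2 - q1 + 1) \<and>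
     of_int (2 * p1 + c - 2) \<le> x + y \<and> x + y \<le> of_int (2 * p2 + c + 2) \<and>
     of_int (2 * q1 + c - 2) \<le> x - y \<and> x - y \<le> of_int (2 * q2 + c + 2)"
  unfolding region_def octform_def mem_oct by (simp add: algebra_simps)

lemma mem_dia:
  "(x, y) \<in> dia p q \<longleftrightarrow>
     of_int (2 * p + c) \<le> x + y \<and> x + y \<le> of_int (2 * p + c + 2) \<and>
     of_int (2 * q + c) \<le> x - y \<and> x - y \<le> of_int (2 * q + c + 2)"
  unfolding dia_def diaform_def mem_oct by auto

section \<open>Octagons cut by the boundary of \<open>R\<close>\<close>

lemmas of_int_rel = of_int_le_iff of_int_0_le_iff of_int_eq_iff

text \<open>Symmetry in \<open>y = - 1\<close> makes all slanted sides equally long, and the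
  vertical sides run from \<open>y = - 2\<close> to \<open>y = 0\<close>. Above \<open>y = 0\<close>
  there remain two slanted sides and the top side of length 2. The other three directions are
  analogous.\<close>

lemma region_trap_bottom:
  assumes "p1 \<le> p2" "p1 = q1 - 1" "p2 = q2 - 1" "0 \<le> 2 * p1 + c" "2 * p2 + c + 2 \<le> m - 1" "p2 - p1 \<le> n - 1"
  shows "region p1 p2 q1 q2 \<inter> R = trapform 0 (of_int (2 * p1 + c)) 0 (of_int (p2 - p1))"
proof -
  have "real_of_int p1 \<le> of_int p2" "(0::real) \<le> of_int (2 * p1 + c)" "of_int (2 * p2 + c + 2) \<le> real_of_int (m - 1)"
    "of_int (p2 - p1) \<le> real_of_int (n - 1)"
    using assms unfolding of_int_rel by auto
  then show ?thesis
    using assms(2,3)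
    by (intro set_eqI; clarsimp simp: mem_region trapform_def mem_oct mem_rect; intro iffI conjI; linarith)
qed

lemma region_trap_right:
  assumes "p1 \<le> p2" "p1 = m - c - q2" "p2 = m - c - q1" "0 \<le> p1 - q2 - 1" "p2 - q1 + 1 \<le> n - 1" "p2 - p1 \<le> m - 1"
  shows "region p1 p2 q1 q2 \<inter> R = trapform 1 (of_int (m - 1)) (of_int (p1 - q2 - 1)) (of_int (p2 - p1))"
proof -
  have "real_of_int p1 \<le> of_int p2" "(0::real) \<le> of_int (p1 - q2 - 1)" "of_int (p2 - q1 + 1) \<le> real_of_int (n - 1)"
    "of_int (p2 - p1) \<le> real_of_int (m - 1)" "of_int q2 = real_of_int (m - c - p1)" "of_int q1 = real_of_int (m - c - p2)"
    using assms unfolding of_int_rel by auto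
  then show ?thesis
    by (intro set_eqI; clarsimp simp: mem_region trapform_def mem_oct mem_rect; intro iffI conjI; linarith)
qed

lemma region_trap_top:
  assumes "p1 \<le> p2" "p1 = q1 + n" "p2 = q2 + n" "0 \<le> p1 + q1 + c - 1" "p2 + q2 + c + 1 \<le> m - 1" "p2 - p1 \<le> n - 1"
  shows "region p1 p2 q1 q2 \<inter> R = trapform 2 (of_int (p2 + q2 + c + 1)) (of_int (n - 1)) (of_int (p2 - p1))"
proof -
  have "real_of_int p1 \<le> of_int p2" "(0::real) \<le> of_int (p1 + q1 + c - 1)" "of_int (p2 + q2 + c + 1) \<le> real_of_int (m - 1)"
    "of_int (p2 - p1) \<le> real_of_int (n - 1)" "of_int q2 = real_of_int (p2 - n)" "of_int q1 = real_of_int (p1 - n)"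
    using assms unfolding of_int_rel by auto
  then show ?thesis
    by (intro set_eqI; clarsimp simp: mem_region trapform_def mem_oct mem_rect; intro iffI conjI; linarith)
qed

lemma region_trap_left:
  assumes "p1 \<le> p2" "p1 = - 1 - c - q2" "p2 = - 1 - c - q1" "0 \<le> p1 - q2 - 1" "p2 - q1 + 1 \<le> n - 1" "p2 - p1 \<le> m - 1"
  shows "region p1 p2 q1 q2 \<inter> R = trapform 3 0 (of_int (p2 - q1 + 1)) (of_int (p2 - p1))"
proof -
  have "real_of_int p1 \<le> of_int p2" "(0::real) \<le> of_int (p1 - q2 - 1)" "of_int (p2 - q1 + 1) \<le> real_of_int (n - 1)"
    "of_int (p2 - p1) \<le> real_of_int (m - 1)" "of_int q2 = real_of_int (- 1 - c - p1)" "of_int q1 = real_of_int (- 1 - c - p2)"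
    using assms unfolding of_int_rel by auto
  then show ?thesis
    by (intro set_eqI; clarsimp simp: mem_region trapform_def mem_oct mem_rect; intro iffI conjI; linarith)
qed

text \<open>Symmetry in two mirrors centres the octagon at their crossing, here
  \<open>(- 1, - 1)\<close>, and a single slanted side passes through the quadrant that contains
  \<open>R\<close>.\<close>

lemma region_tri_bottom_left:
  assumes "q1 = p1 + 1" "q2 = p2 + 1" "p1 = - 1 - c - q2" "p2 + q2 + c + 1 \<le> m - 1" "p2 - q1 + 1 \<le> n - 1"
  shows "region p1 p2 q1 q2 \<inter> R = triform 0 0 0 (of_int (2 * q2 + c))"
proof -
  have "of_int (2 * q2 + c) \<le> real_of_int (m - 1)" "of_int (2 * q2 + c) \<le> real_of_int (n - 1)"
    "of_int q1 = real_of_int (- c - q2)" "of_int p1 = real_of_int (- 1 - c - q2)" "of_int p2 = real_of_int (q2 - 1)"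
    using assms unfolding of_int_rel by auto
  then show ?thesis
    by (intro set_eqI; clarsimp simp: mem_region triform_def mem_oct mem_rect; intro iffI conjI; linarith)
qed

lemma region_tri_bottom_right:
  assumes "q1 = p1 + 1" "q2 = p2 + 1" "p1 = m - c - q2" "0 \<le> p1 + q1 + c - 1" "p2 - q1 + 1 \<le> n - 1"
  shows "region p1 p2 q1 q2 \<inter> R = triform 1 (of_int (m - 1)) 0 (of_int (m - 1 - (2 * p1 + c)))"
proof -
  have "0 \<le> real_of_int (2 * p1 + c)" "of_int (m - 1 - (2 * p1 + c)) \<le> real_of_int (n - 1)"
    "of_int q1 = real_of_int (p1 + 1)" "of_int q2 = real_of_int (m - c - p1)" "of_int p2 = real_of_int (m - c - p1 - 1)"
    using assms unfolding of_int_rel by auto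
  then show ?thesis
    by (intro set_eqI; clarsimp simp: mem_region triform_def mem_oct mem_rect; intro iffI conjI; linarith)
qed

lemma region_tri_top_right:
  assumes "p1 = q1 + n" "p2 = q2 + n" "p1 = m - c - q2" "0 \<le> p1 + q1 + c - 1" "0 \<le> p1 - q2 - 1"
  shows "region p1 p2 q1 q2 \<inter> R = triform 2 (of_int (m - 1)) (of_int (n - 1)) (of_int (m + n - (2 * p1 + c)))"
proof -
  have "real_of_int (m + n - (2 * p1 + c)) \<le> real_of_int (m - 1)" "of_int (m + n - (2 * p1 + c)) \<le> real_of_int (n - 1)"
    "of_int q1 = real_of_int (p1 - n)" "of_int q2 = real_of_int (m - c - p1)" "of_int p2 = real_of_int (m - c - p1 + n)"
    using assms unfolding of_int_rel by auto
  then show ?thesis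
    by (intro set_eqI; clarsimp simp: mem_region triform_def mem_oct mem_rect; intro iffI conjI; linarith)
qed

lemma region_tri_top_left:
  assumes "p1 = q1 + n" "p2 = q2 + n" "p1 = - 1 - c - q2" "p2 + q2 + c + 1 \<le> m - 1" "0 \<le> p1 - q2 - 1"
  shows "region p1 p2 q1 q2 \<inter> R = triform 3 0 (of_int (n - 1)) (of_int (2 * q2 + c + n + 1))"
proof -
  have "real_of_int (2 * q2 + c + n + 1) \<le> real_of_int (m - 1)" "of_int (2 * q2 + c + n + 1) \<le> real_of_int (n - 1)"
    "of_int q1 = real_of_int (- 1 - c - q2 - n)" "of_int p1 = real_of_int (- 1 - c - q2)" "of_int p2 = real_of_int (q2 + n)"
    using assms unfolding of_int_rel by auto
  then show ?thesis
    by (intro set_eqI; clarsimp simp: mem_region triform_def mem_oct mem_rect; intro iffI conjI; linarith)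
qed

text \<open>The abscissa of the midpoint is strictly between those of two points of
  \<open>R\<close>, so the midpoint can be on the frontier only because of its ordinate.\<close>

lemma horizontal_frontier:
  assumes "closed_segment (x, y) (x', y) \<subseteq> frontier R" "x \<noteq> x'"
  shows "y = 0 \<or> y = of_int n - 1"
proof -
  have "midpoint (x, y) (x', y) \<in> frontier R" "(x, y) \<in> R" "(x', y) \<in> R"
    using assms(1) midpoint_in_closed_segment ends_in_segment mem_frontier_rect by blast+
  then show ?thesis
    using assms(2) by (auto simp: midpoint_def mem_frontier_rect mem_rect)
qed

lemma vertical_frontier:
  assumes "closed_segment (x, y) (x, y') \<subseteq> frontier R" "y \<noteq> y'"
  shows "x = 0 \<or> x = of_int m - 1"
proof -
  have "midpoint (x, y) (x, y') \<in> frontier R" "(x, y) \<in> R" "(x, y') \<in> R"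
    using assms(1) midpoint_in_closed_segment ends_in_segment mem_frontier_rect by blast+
  then show ?thesis
    using assms(2) by (auto simp: midpoint_def mem_frontier_rect mem_rect)
qed

lemma segment_subset_frontier:
  assumes "(x, y) \<in> R" "(x', y') \<in> R"
    "x = x' \<and> (x = 0 \<or> x = of_int m - 1) \<or> y = y' \<and> (y = 0 \<or> y = of_int n - 1)"
  shows "closed_segment (x, y) (x', y') \<subseteq> frontier R"
proof
  fix z assume z: "z \<in> closed_segment (x, y) (x', y')"
  have "z \<in> R"
    using z assms(1,2) convex_rect by (meson closed_segment_subset subsetD)
  moreover obtain u where "z = (1 - u) *\<^sub>R (x, y) + u *\<^sub>R (x', y')"
    using z by (auto simp: in_segment)
  then have "x = x' \<Longrightarrow> fst z = x" "y = y' \<Longrightarrow> snd z = y"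
    by (auto simp: algebra_simps)
  ultimately show "z \<in> frontier R"
    using assms(3) mem_frontier_rect[of "fst z" "snd z"] by auto
qed

lemma tight_subset_rect:
  assumes "tight T t" "T \<subseteq> R"
  shows "(\<lambda>(x1, x2, y1, y2, _). 0 \<le> x1 \<and> x2 \<le> of_int m - 1 \<and> 0 \<le> y1 \<and> y2 \<le> of_int n - 1) t"
proof -
  obtain x1 x2 y1 y2 r where t: "t = (x1, x2, y1, y2, r)"
    by (metis surj_pair)
  have R: "0 \<le> fst z \<and> fst z \<le> of_int m - 1 \<and> 0 \<le> snd z \<and> snd z \<le> of_int n - 1" if "z \<in> T" for z
    using assms(2) that by (auto simp: rect_def)
  have "\<exists>z\<in>T. fst z = x1" "\<exists>z\<in>T. fst z = x2" "\<exists>z\<in>T. snd z = y1" "\<exists>z\<in>T. snd z = y2"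
    using assms(1) unfolding t by (cases r; simp add: tight_def)+
  then have "0 \<le> x1" "x2 \<le> of_int m - 1" "0 \<le> y1" "y2 \<le> of_int n - 1"
    using R by metis+
  then show ?thesis by (simp add: t)
qed

section \<open>From tiles to blocks\<close>

lemma good_regionI:
  assumes "adm p1 p2 q1 q2" "T = region p1 p2 q1 q2 \<inter> R" "test p q g h \<in> T"
  shows "good T"
  using assms unfolding good_def by blast

lemma good_if_octform:
  assumes "(x + real b, y) \<in> colored c" "octform x y (real a) (real b) \<subseteq> R"
  shows "good (octform x y (real a) (real b))"
proof -
  obtain p q where pq: "x + real b = of_int (p + q + c)" "y = of_int (p - q)"
    using assms(1) mem_colored by blast
  \<comment> \<open>The left end of the bottom side is the frame point \<open>(p1 - 1, q2)\<close>
    of the block, which yields the four bounds.\<close>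
  have T: "octform x y (real a) (real b) = region (p + 1) (p + 1 + int a) (q - int b) q"
  proof -
    have x: "x = of_int (p + q + c) - real b" using pq by simp
    show ?thesis unfolding region_def x pq(2) by (simp add: algebra_simps)
  qed
  have tight: "0 \<le> x" "x + real a + real b + 2 \<le> of_int m - 1" "0 \<le> y" "y + real a + real b + 2 \<le> of_int n - 1"
    using tight_subset_rect[OF tight_octform[OF of_nat_0_le_iff of_nat_0_le_iff] assms(2)] by simp_all
  have "adm (p + 1) (p + 1 + int a) (q - int b) q"
    unfolding adm_def using tight pq by (intro conjI disjI1; linarith)
  moreover have "test p q True True \<in> region (p + 1) (p + 1 + int a) (q - int b) q"
    by (simp add: mem_region test_def)
  ultimately show ?thesis
    using assms(2) unfolding T by (intro good_regionI) auto
qed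

lemma good_if_diaform:
  assumes "(x, y - 1) \<in> colored c" "diaform x y \<subseteq> R"
  shows "good (diaform x y)"
proof -
  obtain p q where pq: "x = of_int (p + q + c)" "y - 1 = of_int (p - q)"
    using assms(1) mem_colored by blast
  \<comment> \<open>The bottom corner of \<open>dia p q\<close> has the lattice coordinates
    \<open>(p, q + 1)\<close>, hence the shift.\<close>
  have "diaform x y = dia p (q - 1)"
    unfolding dia_def using pq by (intro arg_cong2[of _ _ _ _ diaform]) auto
  then show ?thesis
    using assms(2) unfolding good_def by blast
qed

lemma good_if_trapform:
  assumes k: "k < 4" and a: "0 < a" and col: "(x, y) \<in> colored c" and sub: "trapform k x y (real a) \<subseteq> R"
    and dash: "trapside k x y (real a) \<subseteq> frontier R"
  shows "good (trapform k x y (real a))"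
proof -
  obtain p q where pq: "x = of_int (p + q + c)" "y = of_int (p - q)"
    using col mem_colored by blast
  note tight = tight_trapform[of "real a" k x y, OF of_nat_0_le_iff]
  show ?thesis
    using less_4_cases[OF k]
  proof (elim disjE)
    assume k: "k = 0"
    have b: "0 \<le> x" "x + 2 * real a + 2 \<le> of_int m - 1" "0 \<le> y" "y + real a \<le> of_int n - 1"
      using tight_subset_rect[OF tight sub] k by simp_all
    have "y = 0 \<or> y = of_int n - 1"
      using horizontal_frontier[of x y "x + 2 * real a + 2"] dash k by (auto simp: trapside_def)
    \<comment> \<open>On the upper side of \<open>R\<close> a trapezoid of positive height pointing
      upwards would leave \<open>R\<close>.\<close>
    then have y: "y = 0" using b a by auto
    then have q: "q = p" using pq by simp
    have bi: "0 \<le> 2 * p + c" "2 * p + c + 2 * int a + 2 \<le> m - 1" "int a \<le> n - 1"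
      using b pq unfolding q by linarith+
    have T: "trapform k x y (real a) = region p (p + int a) (p + 1) (p + int a + 1) \<inter> R"
    proof -
      have "region p (p + int a) (p + 1) (p + int a + 1) \<inter> R = trapform 0 (of_int (2 * p + c)) (0) (of_int (p + int a - p))"
        by (rule region_trap_bottom) (use bi in auto)
      moreover have "of_int (2 * p + c) = x" "0 = y" "of_int (p + int a - p) = real a"
        using pq y q by simp_all
      ultimately show ?thesis
        unfolding k by simp
    qed
    have "adm p (p + int a) (p + 1) (p + int a + 1)"
      unfolding adm_def using bi n2 by auto
    moreover have "test p p True True \<in> trapform k x y (real a)"
      using a unfolding k y pq q by (simp add: trapform_def mem_oct test_def)
    ultimately show ?thesis
      using T by (intro good_regionI)
  next
    assume k: "k = 1"
    have b: "0 \<le> x - real a" "x \<le> of_int m - 1" "0 \<le> y" "y + 2 * real a + 2 \<le> of_int n - 1"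
      using tight_subset_rect[OF tight sub] k by simp_all
    have "x = 0 \<or> x = of_int m - 1"
      using vertical_frontier[of x y "y + 2 * real a + 2"] dash k by (auto simp: trapside_def)
    then have x: "x = of_int (m - 1)" using b a by auto
    then have q: "m = p + q + c + 1" using pq by simp
    have bi: "0 \<le> p - q" "p - q + 2 * int a + 2 \<le> n - 1" "int a \<le> m - 1"
      using b pq unfolding q by linarith+
    have T: "trapform k x y (real a) = region (p + 1) (p + 1 + int a) (q - int a) q \<inter> R"
    proof -
      have "region (p + 1) (p + 1 + int a) (q - int a) q \<inter> R = trapform 1 (of_int (m - 1)) (of_int (p + 1 - q - 1)) (of_int (p + 1 + int a - (p + 1)))"
        by (rule region_trap_right) (use bi q a in linarith)+
      moreover have "of_int (m - 1) = x" "of_int (p + 1 - q - 1) = y" "of_int (p + 1 + int a - (p + 1)) = real a"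
        using pq x q by simp_all
      ultimately show ?thesis
        unfolding k by simp
    qed
    have "adm (p + 1) (p + 1 + int a) (q - int a) q"
      unfolding adm_def using bi m2 q by auto
    moreover have "test p (q - 1) False True \<in> trapform k x y (real a)"
      using a unfolding k pq by (simp add: trapform_def mem_oct test_def)
    ultimately show ?thesis
      using T by (intro good_regionI)
  next
    assume k: "k = 2"
    have b: "0 \<le> x - 2 * real a - 2" "x \<le> of_int m - 1" "0 \<le> y - real a" "y \<le> of_int n - 1"
      using tight_subset_rect[OF tight sub] k by simp_all
    have "y = 0 \<or> y = of_int n - 1"
      using horizontal_frontier[of x y "x - 2 * real a - 2"] dash k by (auto simp: trapside_def)
    then have y: "y = of_int (n - 1)" using b a by auto
    then have q: "n = p - q + 1" using pq by simp
    have bi: "0 \<le> p + q + c - 2 * int a - 2" "p + q + c \<le> m - 1" "int a \<le> n - 1"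
      using b pq unfolding q by linarith+
    have T: "trapform k x y (real a) = region (p - int a) p (q - 1 - int a) (q - 1) \<inter> R"
    proof -
      have "region (p - int a) p (q - 1 - int a) (q - 1) \<inter> R = trapform 2 (of_int (p + (q - 1) + c + 1)) (of_int (n - 1)) (of_int (p - (p - int a)))"
        by (rule region_trap_top) (use bi q a in linarith)+
      moreover have "of_int (p + (q - 1) + c + 1) = x" "of_int (n - 1) = y" "of_int (p - (p - int a)) = real a"
        using pq y q by simp_all
      ultimately show ?thesis
        unfolding k by simp
    qed
    have "adm (p - int a) p (q - 1 - int a) (q - 1)"
      unfolding adm_def using bi n2 q by auto
    moreover have "test (p - 1) (q - 1) False False \<in> trapform k x y (real a)"
      using a unfolding k pq by (simp add: trapform_def mem_oct test_def)
    ultimately show ?thesis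
      using T by (intro good_regionI)
  next
    assume k: "k = 3"
    have b: "0 \<le> x" "x + real a \<le> of_int m - 1" "0 \<le> y - 2 * real a - 2" "y \<le> of_int n - 1"
      using tight_subset_rect[OF tight sub] k by simp_all
    have "x = 0 \<or> x = of_int m - 1"
      using vertical_frontier[of x y "y - 2 * real a - 2"] dash k by (auto simp: trapside_def)
    then have x: "x = 0" using b a by auto
    then have q: "p = - q - c" using pq by linarith
    have bi: "0 \<le> p - q - 2 * int a - 2" "p - q \<le> n - 1" "int a \<le> m - 1"
      using b pq by linarith+
    have T: "trapform k x y (real a) = region (p - 1 - int a) (p - 1) q (q + int a) \<inter> R"
    proof -
      have "region (p - 1 - int a) (p - 1) q (q + int a) \<inter> R = trapform 3 (0) (of_int (p - 1 - q + 1)) (of_int (p - 1 - (p - 1 - int a)))"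
        by (rule region_trap_left) (use bi q a in linarith)+
      moreover have "0 = x" "of_int (p - 1 - q + 1) = y" "of_int (p - 1 - (p - 1 - int a)) = real a"
        using pq x q by simp_all
      ultimately show ?thesis
        unfolding k by simp
    qed
    have "adm (p - 1 - int a) (p - 1) q (q + int a)"
      unfolding adm_def using bi m2 q by auto
    moreover have "test (p - 1) q True False \<in> trapform k x y (real a)"
      using a unfolding k pq by (simp add: trapform_def mem_oct test_def)
    ultimately show ?thesis
      using T by (intro good_regionI)
  qed
qed

lemma good_if_triform:
  assumes k: "k < 4" and a: "0 < a" and sub: "triform k x y (real a) \<subseteq> R"
    and col: "tripoint k x y (real a) \<in> colored c"
    and dash: "closed_segment (x, y) (tripoint k x y (real a)) \<subseteq> frontier R"
      "closed_segment (x, y) (tripoint ((k + 1) mod 4) x y (real a)) \<subseteq> frontier R"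
  shows "good (triform k x y (real a))"
proof -
  note tight = tight_triform[of "real a" k x y, OF of_nat_0_le_iff]
  have col': "tripoint ((k + 1) mod 4) x y (real a) \<in> colored c"
    using col tripoint_colored[OF k] by blast
  show ?thesis
    using less_4_cases[OF k]
  proof (elim disjE)
    assume k: "k = 0"
    have b: "0 \<le> x" "x + real a \<le> of_int m - 1" "0 \<le> y" "y + real a \<le> of_int n - 1"
      using tight_subset_rect[OF tight sub] k by simp_all
    have "y = 0 \<or> y = of_int n - 1" "x = 0 \<or> x = of_int m - 1"
      using horizontal_frontier[of x y "x + real a"] vertical_frontier[of x y "y + real a"] dash k a
      by (auto simp: tripoint_def)
    then have xy: "x = 0" "y = 0" using b a by auto
    obtain p q where pq: "x + real a = of_int (p + q + c)" "y = of_int (p - q)"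
      using col mem_colored k by (auto simp: tripoint_def)
    have q: "q = p" and a2: "real a = of_int (2 * p + c)" using pq xy by auto
    have bi: "0 < 2 * p + c" "2 * p + c \<le> m - 1" "2 * p + c \<le> n - 1"
      using b a2 xy a by linarith+
    \<comment> \<open>The acute vertex \<open>(p, p)\<close> is the frame point
      \<open>(p2 + 1, q2)\<close>; the two reflections then determine \<open>p1\<close> and
      \<open>q1\<close>.\<close>
    have T: "triform k x y (real a) = region (- 1 - c - p) (p - 1) (- c - p) p \<inter> R"
    proof -
      have "region (- 1 - c - p) (p - 1) (- c - p) p \<inter> R = triform 0 (0) (0) (of_int (2 * p + c))"
        by (rule region_tri_bottom_left) (use bi q a in linarith)+
      moreover have "0 = x" "0 = y" "of_int (2 * p + c) = real a"
        using pq xy a2 q by simp_all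
      ultimately show ?thesis
        unfolding k by simp
    qed
    have "adm (- 1 - c - p) (p - 1) (- c - p) p"
      unfolding adm_def using bi by auto
    moreover have "test (p - 1) (q - 1) True True \<in> triform k x y (real a)"
      using a2 a unfolding k xy q by (simp add: triform_def mem_oct test_def)
    ultimately show ?thesis
      using T by (intro good_regionI)
  next
    assume k: "k = 1"
    have b: "0 \<le> x - real a" "x \<le> of_int m - 1" "0 \<le> y" "y + real a \<le> of_int n - 1"
      using tight_subset_rect[OF tight sub] k by simp_all
    have "y = 0 \<or> y = of_int n - 1" "x = 0 \<or> x = of_int m - 1"
      using horizontal_frontier[of x y "x - real a"] vertical_frontier[of x y "y + real a"] dash k a
      by (auto simp: tripoint_def)
    then have xy: "x = of_int (m - 1)" "y = 0" using b a by auto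
    obtain p q where pq: "x - real a = of_int (p + q + c)" "y = of_int (p - q)"
      using col' mem_colored k by (auto simp: tripoint_def)
    have q: "q = p" and a2: "real a = of_int (m - 1 - (2 * p + c))" using pq xy by auto
    have bi: "0 < m - 1 - (2 * p + c)" "m - 1 - (2 * p + c) \<le> m - 1" "m - 1 - (2 * p + c) \<le> n - 1"
      using b a2 xy a by linarith+
    have T: "triform k x y (real a) = region p (m - c - p - 1) (p + 1) (m - c - p) \<inter> R"
    proof -
      have "region p (m - c - p - 1) (p + 1) (m - c - p) \<inter> R = triform 1 (of_int (m - 1)) (0) (of_int (m - 1 - (2 * p + c)))"
        by (rule region_tri_bottom_right) (use bi q a in linarith)+
      moreover have "of_int (m - 1) = x" "0 = y" "of_int (m - 1 - (2 * p + c)) = real a"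
        using pq xy a2 q by simp_all
      ultimately show ?thesis
        unfolding k by simp
    qed
    have "adm p (m - c - p - 1) (p + 1) (m - c - p)"
      unfolding adm_def using bi by auto
    moreover have "test p q False True \<in> triform k x y (real a)"
      using a2 a unfolding k xy q by (simp add: triform_def mem_oct test_def)
    ultimately show ?thesis
      using T by (intro good_regionI)
  next
    assume k: "k = 2"
    have b: "0 \<le> x - real a" "x \<le> of_int m - 1" "0 \<le> y - real a" "y \<le> of_int n - 1"
      using tight_subset_rect[OF tight sub] k by simp_all
    have "y = 0 \<or> y = of_int n - 1" "x = 0 \<or> x = of_int m - 1"
      using horizontal_frontier[of x y "x - real a"] vertical_frontier[of x y "y - real a"] dash k a
      by (auto simp: tripoint_def)
    then have xy: "x = of_int (m - 1)" "y = of_int (n - 1)" using b a by auto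
    obtain p q where pq: "x - real a = of_int (p + q + c)" "y = of_int (p - q)"
      using col mem_colored k by (auto simp: tripoint_def)
    have q: "n = p - q + 1" and a2: "real a = of_int (m - 1 - (p + q + c))" using pq xy by auto
    have bi: "0 < m - 1 - (p + q + c)" "m - 1 - (p + q + c) \<le> m - 1" "m - 1 - (p + q + c) \<le> n - 1"
      using b a2 xy a by linarith+
    have T: "triform k x y (real a) = region (p + 1) (m - c - p - 1 + n) (p + 1 - n) (m - c - p - 1) \<inter> R"
    proof -
      have "region (p + 1) (m - c - p - 1 + n) (p + 1 - n) (m - c - p - 1) \<inter> R = triform 2 (of_int (m - 1)) (of_int (n - 1)) (of_int (m + n - (2 * (p + 1) + c)))"
        by (rule region_tri_top_right) (use bi q a in linarith)+
      moreover have "of_int (m - 1) = x" "of_int (n - 1) = y" "of_int (m + n - (2 * (p + 1) + c)) = real a"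
        using pq xy a2 q by simp_all
      ultimately show ?thesis
        unfolding k by simp
    qed
    have "adm (p + 1) (m - c - p - 1 + n) (p + 1 - n) (m - c - p - 1)"
      unfolding adm_def using bi q by auto
    moreover have "test p q False False \<in> triform k x y (real a)"
      using a2 a unfolding k xy q by (simp add: triform_def mem_oct test_def)
    ultimately show ?thesis
      using T by (intro good_regionI)
  next
    assume k: "k = 3"
    have b: "0 \<le> x" "x + real a \<le> of_int m - 1" "0 \<le> y - real a" "y \<le> of_int n - 1"
      using tight_subset_rect[OF tight sub] k by simp_all
    have "y = 0 \<or> y = of_int n - 1" "x = 0 \<or> x = of_int m - 1"
      using horizontal_frontier[of x y "x + real a"] vertical_frontier[of x y "y - real a"] dash k a
      by (auto simp: tripoint_def)
    then have xy: "x = 0" "y = of_int (n - 1)" using b a by auto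
    obtain p q where pq: "x = of_int (p + q + c)" "y - real a = of_int (p - q)"
      using col mem_colored k by (auto simp: tripoint_def)
    have q: "p = - q - c" and a2: "real a = of_int (n - 1 - (p - q))" using pq xy by linarith+
    have bi: "0 < n - 1 - (p - q)" "n - 1 - (p - q) \<le> m - 1" "n - 1 - (p - q) \<le> n - 1"
      using b a2 xy a by linarith+
    have T: "triform k x y (real a) = region (- c - q) (q - 1 + n) (- c - q - n) (q - 1) \<inter> R"
    proof -
      have "region (- c - q) (q - 1 + n) (- c - q - n) (q - 1) \<inter> R = triform 3 (0) (of_int (n - 1)) (of_int (2 * (q - 1) + c + n + 1))"
        by (rule region_tri_top_left) (use bi q a in linarith)+
      moreover have "0 = x" "of_int (n - 1) = y" "of_int (2 * (q - 1) + c + n + 1) = real a"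
        using pq xy a2 q by simp_all
      ultimately show ?thesis
        unfolding k by simp
    qed
    have "adm (- c - q) (q - 1 + n) (- c - q - n) (q - 1)"
      unfolding adm_def using bi q by auto
    moreover have "test p (q - 1) True False \<in> triform k x y (real a)"
      using a2 a unfolding k xy q by (simp add: triform_def mem_oct test_def)
    ultimately show ?thesis
      using T by (intro good_regionI)
  qed
qed

lemma goodI:
  assumes "ctile c T" "T \<subseteq> R" "\<And>s. dashed_side T s \<Longrightarrow> s \<subseteq> frontier R"
  shows "good T"
proof -
  obtain V D C where p: "presents T V D C" and C: "C \<subseteq> colored c"
    using assms(1) unfolding ctile_def by blast
  have D: "s \<subseteq> frontier R" if "s \<in> D" for s
    using assms(3) p that unfolding dashed_side_def by blast
  from presents_forms[OF p] show ?thesis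
  proof (elim disjE exE conjE)
    fix x y and a b :: nat
    assume "T = octform x y (real a) (real b)" "C = V" "(x + real b, y) \<in> V"
    then show ?thesis using good_if_octform C assms(2) by blast
  next
    fix x y assume "T = diaform x y" "C = V" "(x, y - 1) \<in> V"
    then show ?thesis using good_if_diaform C assms(2) by blast
  next
    fix k x y and a :: nat
    assume "k < 4" "0 < a" "T = trapform k x y (real a)" "D = {trapside k x y (real a)}" "C = V" "(x, y) \<in> V"
    then show ?thesis using good_if_trapform[of k a x y] C assms(2) D by auto
  next
    fix k x y and a :: nat
    assume "k < 4" "0 < a" "T = triform k x y (real a)"
      "D = {closed_segment (x, y) (tripoint k x y (real a)), closed_segment (x, y) (tripoint ((k + 1) mod 4) x y (real a))}"
      "C = {tripoint k x y (real a), tripoint ((k + 1) mod 4) x y (real a)}"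
    then show ?thesis using good_if_triform[of k a x y] C assms(2) D by auto
  qed
qed

subsection \<open>Cells\<close>

text \<open>A cell reaches one unit from the centre of its diamond, in the directions given by
  \<open>g\<close> and \<open>h\<close>; the inequality is strict on the side to which the cell
  extends.\<close>

lemma test_in_rect:
  "test p q g h \<in> R \<longleftrightarrow>
     (if g then 0 \<le> p + q + 1 + c \<and> p + q + 1 + c < m - 1 else 0 < p + q + 1 + c \<and> p + q + 1 + c \<le> m - 1) \<and>
     (if h then 0 \<le> p - q \<and> p - q < n - 1 else 0 < p - q \<and> p - q \<le> n - 1)"
  unfolding test_def mem_rect
  by (cases g; cases h; simp only: if_True if_False; intro iffI conjI; (elim conjE)?; linarith)

lemma test_in_region:
  assumes "p1 \<le> p2" "q1 \<le> q2"
  shows "test p q g h \<in> region p1 p2 q1 q2 \<longleftrightarrow>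
     p1 - 1 \<le> p \<and> p \<le> p2 \<and> q1 - 1 \<le> q \<and> q \<le> q2 \<and>
     (if g then p + q + 1 \<le> p2 + q2 else p1 + q1 \<le> p + q + 1) \<and>
     (if h then p - q \<le> p2 - q1 else p1 - q2 \<le> p - q)"
  unfolding test_def mem_region using assms
  by (cases g; cases h; simp only: if_True if_False; intro iffI conjI; (elim conjE)?; linarith)

definition incell :: "int \<Rightarrow> int \<Rightarrow> bool \<Rightarrow> bool \<Rightarrow> point \<Rightarrow> bool" where
  "incell p q g h z \<longleftrightarrow>
     (if g then of_int (p + q + 1 + c) \<le> fst z else fst z \<le> of_int (p + q + 1 + c)) \<and>
     (if h then of_int (p - q) \<le> snd z else snd z \<le> of_int (p - q)) \<and>
     \<bar>fst z - of_int (p + q + 1 + c)\<bar> + \<bar>snd z - of_int (p - q)\<bar> \<le> 1"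

definition opencell :: "int \<Rightarrow> int \<Rightarrow> bool \<Rightarrow> bool \<Rightarrow> point set" where
  "opencell p q g h = {z.
     (if g then of_int (p + q + 1 + c) < fst z else fst z < of_int (p + q + 1 + c)) \<and>
     (if h then of_int (p - q) < snd z else snd z < of_int (p - q)) \<and>
     \<bar>fst z - of_int (p + q + 1 + c)\<bar> + \<bar>snd z - of_int (p - q)\<bar> < 1}"

lemma open_opencell: "open (opencell p q g h)"
  unfolding opencell_def
  by (cases g; cases h) (simp_all, (intro open_Collect_conj open_Collect_less continuous_intros)+)

lemma test_in_opencell: "test p q g h \<in> opencell p q g h"
  by (simp add: opencell_def test_def)

lemma incell_opencell: "z \<in> opencell p q g h \<Longrightarrow> incell p q g h z"
  by (auto simp: opencell_def incell_def)

lemma opencell_shrink: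
  assumes "incell p q g h z" "0 < e" "e \<le> 1"
  shows "z + e *\<^sub>R (test p q g h - z) \<in> opencell p q g h"
proof -
  define X Y where "X = real_of_int (p + q + 1 + c)" and "Y = real_of_int (p - q)"
  obtain x y where z: "z = (x, y)" by fastforce
  \<comment> \<open>Measuring away from the centre treats all four cells as one, with the test point
    at \<open>(1 / 4, 1 / 4)\<close>.\<close>
  define u v where "u = (if g then x - X else X - x)" and "v = (if h then y - Y else Y - y)"
  have uv: "0 \<le> u" "0 \<le> v" "u + v \<le> 1"
    using assms(1) unfolding incell_def z X_def[symmetric] Y_def[symmetric] u_def v_def by (auto split: if_splits)
  have *: "0 < (1 - e) * u + e / 4" "0 < (1 - e) * v + e / 4" "(1 - e) * u + e / 4 + ((1 - e) * v + e / 4) < 1"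
  proof -
    have "(1 - e) * (u + v) \<le> 1 - e" "0 \<le> (1 - e) * u" "0 \<le> (1 - e) * v"
      using uv assms(2,3) mult_left_mono[of "u + v" 1 "1 - e"] by auto
    then show "0 < (1 - e) * u + e / 4" "0 < (1 - e) * v + e / 4" "(1 - e) * u + e / 4 + ((1 - e) * v + e / 4) < 1"
      using assms(2) by (auto simp: distrib_left)
  qed
  have "z + e *\<^sub>R (test p q g h - z) =
      (if g then X + ((1 - e) * u + e / 4) else X - ((1 - e) * u + e / 4),
       if h then Y + ((1 - e) * v + e / 4) else Y - ((1 - e) * v + e / 4))"
    unfolding test_def z X_def[symmetric] Y_def[symmetric] u_def v_def by (simp add: algebra_simps)
  then show ?thesis
    using * unfolding opencell_def X_def[symmetric] Y_def[symmetric] by auto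
qed

lemma rect_incell:
  assumes "test p q g h \<in> R" "incell p q g h z"
  shows "z \<in> R"
  using assms unfolding test_in_rect incell_def
  by (cases z; cases g; cases h) (auto simp: mem_rect abs_le_iff)

lemma rect_opencell:
  assumes "z \<in> R" "z \<in> opencell p q g h"
  shows "test p q g h \<in> R"
  using assms unfolding test_in_rect opencell_def
  by (cases z; cases g; cases h) (auto simp: mem_rect)

text \<open>No bounding line of a region enters the interior of a cell: the bounds on
  \<open>x\<close> and \<open>y\<close> are integers, and those on \<open>x + y\<close> and
  \<open>x - y\<close> have the parity of \<open>c\<close>, like the sides of the diamonds.\<close>

lemma region_incell:
  assumes "p1 \<le> p2" "q1 \<le> q2" "test p q g h \<in> region p1 p2 q1 q2" "incell p q g h z"
  shows "z \<in> region p1 p2 q1 q2"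
proof -
  obtain x y where z: "z = (x, y)" by fastforce
  show ?thesis
    using assms(3,4) unfolding test_in_region[OF assms(1,2)] incell_def z mem_region fst_conv snd_conv
    by (cases g; cases h; simp only: if_True if_False; intro conjI; linarith)
qed

lemma region_opencell:
  assumes "p1 \<le> p2" "q1 \<le> q2" "z \<in> region p1 p2 q1 q2" "z \<in> opencell p q g h"
  shows "test p q g h \<in> region p1 p2 q1 q2"
proof -
  obtain x y where z: "z = (x, y)" by fastforce
  show ?thesis
    using assms(3,4) unfolding test_in_region[OF assms(1,2)] opencell_def z mem_region fst_conv snd_conv mem_Collect_eq
    by (cases g; cases h; simp only: if_True if_False; intro conjI; linarith)
qed

lemma dia_incell:
  assumes "incell p q g h z"
  shows "z \<in> dia p q"
proof -
  obtain x y where z: "z = (x, y)" by fastforce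
  show ?thesis
    using assms unfolding incell_def z mem_dia fst_conv snd_conv
    by (cases g; cases h; simp only: if_True if_False; intro conjI; linarith)
qed

lemma dia_opencell:
  assumes "z \<in> dia p' q'" "z \<in> opencell p q g h"
  shows "p = p' \<and> q = q'"
proof -
  obtain x y where z: "z = (x, y)" by fastforce
  have "p < p' + 1" "p' < p + 1" "q < q' + 1" "q' < q + 1"
    using assms unfolding opencell_def z mem_dia fst_conv snd_conv mem_Collect_eq
    by linarith+
  then show ?thesis by simp
qed

lemma test_in_dia: "test p q g h \<in> dia p' q' \<longleftrightarrow> p = p' \<and> q = q'"
  using dia_opencell[OF _ test_in_opencell] dia_incell[OF incell_opencell[OF test_in_opencell]] by blast

lemma adm_le: "adm p1 p2 q1 q2 \<Longrightarrow> p1 \<le> p2" "adm p1 p2 q1 q2 \<Longrightarrow> q1 \<le> q2"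
  by (auto simp: adm_def)

lemma good_incell:
  assumes "good T" "test p q g h \<in> T" "incell p q g h z"
  shows "z \<in> T"
  using assms(1) unfolding good_def
proof (elim disjE exE conjE)
  fix p' q' assume "T = dia p' q'"
  then show ?thesis using assms(2) dia_incell[OF assms(3)] test_in_dia[of p q g h p' q'] by simp
next
  fix p1 p2 q1 q2 assume a: "adm p1 p2 q1 q2" and T: "T = region p1 p2 q1 q2 \<inter> R"
  show ?thesis
    using assms(2) region_incell[OF adm_le[OF a] _ assms(3)] rect_incell[OF _ assms(3)] unfolding T by simp
qed

lemma good_opencell:
  assumes "good T" "z \<in> T" "z \<in> opencell p q g h"
  shows "test p q g h \<in> T"
  using assms(1) unfolding good_def
proof (elim disjE exE conjE)
  fix p' q' assume "T = dia p' q'"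
  then show ?thesis using assms(2) dia_opencell[OF _ assms(3), of p' q'] test_in_dia[of p q g h p' q'] by simp
next
  fix p1 p2 q1 q2 assume a: "adm p1 p2 q1 q2" and T: "T = region p1 p2 q1 q2 \<inter> R"
  show ?thesis
    using assms(2) region_opencell[OF adm_le[OF a] _ assms(3)] rect_opencell[OF _ assms(3)] unfolding T by simp
qed

lemma good_subset_rect: "good T \<Longrightarrow> T \<subseteq> R"
  by (auto simp: good_def)

lemma good_interior:
  assumes "good T" "test p q g h \<in> T"
  shows "test p q g h \<in> interior T"
proof -
  have "opencell p q g h \<subseteq> T"
    using good_incell[OF assms] incell_opencell by blast
  then show ?thesis
    using open_opencell test_in_opencell interior_maximal by blast
qed

lemma convex_region: "convex (region p1 p2 q1 q2)"
  by (simp add: region_def octform_def convex_oct)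

lemma convex_good: "good T \<Longrightarrow> convex T"
  by (auto simp: good_def dia_def diaform_def convex_oct intro: convex_Int convex_region convex_rect)

text \<open>A unit square is the union of two cells, separated by the diagonal between its colored
  corners. Its other two corners are the centres of the two diamonds involved.\<close>

lemma rect_cell:
  assumes "z \<in> R"
  obtains p q g h where "test p q g h \<in> R" "incell p q g h z"
proof -
  note cell = that
  obtain x y where z: "z = (x, y)" by fastforce
  have xy: "0 \<le> x" "x \<le> of_int m - 1" "0 \<le> y" "y \<le> of_int n - 1"
    using assms unfolding z mem_rect by auto
  \<comment> \<open>The minimum keeps the unit square inside \<open>R\<close> when the point is on
    the right or upper side.\<close>
  define i j where "i = min \<lfloor>x\<rfloor> (m - 2)" and "j = min \<lfloor>y\<rfloor> (n - 2)"
  have i: "0 \<le> i" "i \<le> m - 2" "of_int i \<le> x" "x \<le> of_int i + 1"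
    using xy m2 unfolding i_def by (auto simp: min_def; linarith)+
  have j: "0 \<le> j" "j \<le> n - 2" "of_int j \<le> y" "y \<le> of_int j + 1"
    using xy n2 unfolding j_def by (auto simp: min_def; linarith)+
  have *: thesis if "X + Y = 2 * p + 1 + c" "X = i + (if g then 0 else 1)" "Y = j + (if h then 0 else 1)"
    "\<bar>x - of_int X\<bar> + \<bar>y - of_int Y\<bar> \<le> 1" for X Y p g h
  proof -
    define q where "q = X - 1 - c - p"
    have X: "X = p + q + 1 + c" and Y: "Y = p - q" using that(1) unfolding q_def by auto
    show thesis
    proof (rule cell)
      show "test p q g h \<in> R"
        unfolding test_in_rect X[symmetric] Y[symmetric] using i j that(2,3) by auto
      show "incell p q g h z"
        unfolding incell_def X[symmetric] Y[symmetric] z using i j that(2-4) by auto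
    qed
  qed
  show thesis
  proof (cases "even (i + j - c)")
    case True
    then obtain k where k: "i + j - c = 2 * k" by (elim evenE)
    show thesis
    proof (cases "y - of_int j \<le> x - of_int i")
      case True
      show thesis
        by (rule *[of "i + 1" j k False True]) (use k True i j in auto)
    next
      case False
      show thesis
        by (rule *[of i "j + 1" k True False]) (use k False i j in auto)
    qed
  next
    case False
    then obtain k where k: "i + j - c = 2 * k + 1" by (elim oddE)
    show thesis
    proof (cases "(x - of_int i) + (y - of_int j) \<le> 1")
      case True
      show thesis
        by (rule *[of i j k True True]) (use k True i j in auto)
    next
      case False
      show thesis
        by (rule *[of "i + 1" "j + 1" "k + 1" False False]) (use k False i j in auto)
    qed
  qed
qed

text \<open>A common interior point may lie on the border of its cell. A small move towards the test
  point of this cell enters the open cell without leaving the two interiors.\<close>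

lemma good_interiors_meet:
  assumes "good S" "good T" "interior S \<inter> interior T \<noteq> {}"
  obtains p q g h where "test p q g h \<in> S" "test p q g h \<in> T"
proof -
  obtain z where z: "z \<in> interior S \<inter> interior T" using assms(3) by blast
  then have "z \<in> R" using good_subset_rect[OF assms(1)] interior_subset by blast
  then obtain p q g h where c: "test p q g h \<in> R" "incell p q g h z"
    by (rule rect_cell)
  have "open (interior S \<inter> interior T)" by auto
  then obtain d where d: "0 < d" "ball z d \<subseteq> interior S \<inter> interior T"
    using z openE by blast
  define e where "e = min 1 (d / (2 * (norm (test p q g h - z) + 1)))"
  have e: "0 < e" "e \<le> 1" using d(1) unfolding e_def by (auto simp: add_nonneg_pos)
  have "e * norm (test p q g h - z) \<le> d / (2 * (norm (test p q g h - z) + 1)) * norm (test p q g h - z)"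
    unfolding e_def by (intro mult_right_mono) auto
  also have "\<dots> < d"
  proof -
    have "d / (2 * (N + 1)) * N < d" if "0 \<le> N" for N
    proof -
      have "d * N < d * (2 * (N + 1))"
        using d(1) that by (intro mult_strict_left_mono) auto
      then show ?thesis
        using that by (simp add: pos_divide_less_eq)
    qed
    then show ?thesis by simp
  qed
  finally have "z + e *\<^sub>R (test p q g h - z) \<in> ball z d"
    using e(1) by (simp add: dist_norm)
  then have "z + e *\<^sub>R (test p q g h - z) \<in> S" "z + e *\<^sub>R (test p q g h - z) \<in> T"
    using d(2) interior_subset by blast+
  then show thesis
    using that good_opencell[OF assms(1)] good_opencell[OF assms(2)] opencell_shrink[OF c(2) e] by blast
qed

section \<open>From blocks to tiles\<close>

definition ptile :: "point set \<Rightarrow> bool" where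
  "ptile T \<longleftrightarrow> ctile c T \<and> (\<forall>s. dashed_side T s \<longrightarrow> s \<subseteq> frontier R)"

lemma ptile_trapform:
  assumes k: "k < 4" and A: "0 < A" and T: "T = trapform k x y (of_int A)" and sub: "T \<subseteq> R"
    and pq: "x = of_int (p + q + c)" "y = of_int (p - q)"
    and bd: "if k = 0 \<or> k = 2 then y = 0 \<or> y = of_int (n - 1) else x = 0 \<or> x = of_int (m - 1)"
  shows "ptile T"
proof -
  have a: "0 < nat A" "of_int A = real (nat A)" using A by auto
  have "(x, y) \<in> colored c"
    unfolding mem_colored using pq by blast
  then have "ctile c T"
    unfolding T a(2) by (rule ctile_trapform[OF k a(1)])
  moreover have "s \<subseteq> frontier R" if "dashed_side T s" for s
  proof -
    have s: "s = trapside k x y (of_int A)"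
      by (rule dashed_trapform[OF that[unfolded T] _ k]) (use A in simp)
    define x' y' where "x' = (if k = 0 then x + 2 * of_int A + 2 else if k = 2 then x - 2 * of_int A - 2 else x)"
      and "y' = (if k = 1 then y + 2 * of_int A + 2 else if k = 3 then y - 2 * of_int A - 2 else y)"
    have s': "s = closed_segment (x, y) (x', y')"
      unfolding s trapside_def x'_def y'_def using less_4_cases[OF k] by auto
    have "(x, y) \<in> T" "(x', y') \<in> T"
      unfolding T trapform_def x'_def y'_def using less_4_cases[OF k] A by (auto simp: mem_oct)
    then show ?thesis
      unfolding s' using sub bd less_4_cases[OF k]
      by (intro segment_subset_frontier) (auto simp: x'_def y'_def)
  qed
  ultimately show ?thesis unfolding ptile_def by blast
qed

lemma ptile_triform:
  assumes k: "k < 4" and A: "0 < A" and T: "T = triform k (of_int i) (of_int j) (of_int A)" and sub: "T \<subseteq> R"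
    and pq: "tripoint k (of_int i) (of_int j) (of_int A) = (of_int (p + q + c), of_int (p - q))"
    and bd: "i = 0 \<or> i = m - 1" "j = 0 \<or> j = n - 1"
  shows "ptile T"
proof -
  have a: "0 < nat A" "of_int A = real (nat A)" using A by auto
  have "tripoint k (of_int i) (of_int j) (of_int A) \<in> colored c"
    unfolding pq mem_colored by blast
  then have "ctile c T"
    unfolding T a(2) by (intro ctile_triform[OF k a(1)]) auto
  moreover have "s \<subseteq> frontier R" if "dashed_side T s" for s
  proof -
    have "s = closed_segment (of_int i, of_int j) (tripoint k (of_int i) (of_int j) (of_int A)) \<or>
        s = closed_segment (of_int i, of_int j) (tripoint ((k + 1) mod 4) (of_int i) (of_int j) (of_int A))"
      by (rule dashed_triform[OF that[unfolded T] _ k]) (use A in simp)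
    moreover have "(of_int i, of_int j) \<in> T" "tripoint k (of_int i) (of_int j) (of_int A) \<in> T"
      "tripoint ((k + 1) mod 4) (of_int i) (of_int j) (of_int A) \<in> T"
      unfolding T triform_def tripoint_def using less_4_cases[OF k] A by (auto simp: mem_oct)
    moreover have "closed_segment (of_int i, of_int j) (tripoint l (of_int i) (of_int j) (of_int A)) \<subseteq> frontier R"
      if "(of_int i, of_int j) \<in> R" "tripoint l (of_int i) (of_int j) (of_int A) \<in> R" for l
    proof -
      obtain x' y' where e: "tripoint l (of_int i) (of_int j) (of_int A) = (x', y')" by fastforce
      then have "x' = of_int i \<or> y' = of_int j"
        by (auto simp: tripoint_def split: if_splits)
      then show ?thesis
        unfolding e by (intro segment_subset_frontier) (use that e bd in auto)
    qed
    ultimately show ?thesis using sub by blast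
  qed
  ultimately show ?thesis unfolding ptile_def by blast
qed

text \<open>In each direction the octagon stays within \<open>R\<close> or is symmetric in exactly
  one of the two mirrors; it cannot be symmetric in both. The nine combinations are one octagon,
  four trapezoids and four triangles. The test point makes the size of the trapezoid or triangle
  positive.\<close>

lemma ptile_region:
  assumes adm: "adm p1 p2 q1 q2" and T: "T = region p1 p2 q1 q2 \<inter> R" and test: "test p q g h \<in> T"
  shows "ptile T"
proof -
  have le: "p1 \<le> p2" "q1 \<le> q2" using adm adm_le by auto
  have sub: "T \<subseteq> R" using T by auto
  have t: "p1 - 1 \<le> p" "p \<le> p2" "q1 - 1 \<le> q" "q \<le> q2"
     "if g then p + q + 1 \<le> p2 + q2 else p1 + q1 \<le> p + q + 1"
     "if h then p - q \<le> p2 - q1 else p1 - q2 \<le> p - q"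
     "if g then 0 \<le> p + q + 1 + c \<and> p + q + 1 + c < m - 1 else 0 < p + q + 1 + c \<and> p + q + 1 + c \<le> m - 1"
     "if h then 0 \<le> p - q \<and> p - q < n - 1 else 0 < p - q \<and> p - q \<le> n - 1"
    using test unfolding T Int_iff test_in_region[OF le] test_in_rect by auto
  have x: "0 \<le> p1 + q1 + c - 1 \<and> p2 + q2 + c + 1 \<le> m - 1 \<or>
    p1 = - 1 - c - q2 \<and> p2 = - 1 - c - q1 \<and> p2 + q2 + c + 1 \<le> m - 1 \<or>
    p1 = m - c - q2 \<and> p2 = m - c - q1 \<and> 0 \<le> p1 + q1 + c - 1"
    using adm m2 unfolding adm_def by linarith
  have y: "0 \<le> p1 - q2 - 1 \<and> p2 - q1 + 1 \<le> n - 1 \<or>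
    p1 = q1 - 1 \<and> p2 = q2 - 1 \<and> p2 - q1 + 1 \<le> n - 1 \<or>
    p1 = q1 + n \<and> p2 = q2 + n \<and> 0 \<le> p1 - q2 - 1"
    using adm n2 unfolding adm_def by linarith
  from x y show ?thesis
  proof (elim disjE conjE)
    assume b: "0 \<le> p1 + q1 + c - 1" "p2 + q2 + c + 1 \<le> m - 1" "0 \<le> p1 - q2 - 1" "p2 - q1 + 1 \<le> n - 1"
    have "region p1 p2 q1 q2 \<subseteq> R"
      using b by (auto simp: mem_region mem_rect)
    then have T': "T = octform (of_int (p1 + q1 + c - 1)) (of_int (p1 - q2 - 1)) (real (nat (p2 - p1))) (real (nat (q2 - q1)))"
      using le unfolding T region_def by auto
    have "(of_int (p1 + q1 + c - 1) + real (nat (q2 - q1)), of_int (p1 - q2 - 1)) \<in> colored c"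
      unfolding mem_colored using le by (intro exI[of _ "p1 - 1"] exI[of _ q2]) auto
    then show ?thesis
      unfolding ptile_def T' using ctile_octform not_dashed_octform by auto
  next
    assume b: "0 \<le> p1 + q1 + c - 1" "p2 + q2 + c + 1 \<le> m - 1" "p1 = q1 - 1" "p2 = q2 - 1" "p2 - q1 + 1 \<le> n - 1"
    have "T = trapform 0 (of_int (2 * p1 + c)) 0 (of_int (p2 - p1))"
      unfolding T by (rule region_trap_bottom) (use b le in linarith)+
    then show ?thesis
      by (rule ptile_trapform[where p=p1 and q=p1, rotated 2]) (use b t sub in \<open>auto split: if_splits\<close>)
  next
    assume b: "0 \<le> p1 + q1 + c - 1" "p2 + q2 + c + 1 \<le> m - 1" "p1 = q1 + n" "p2 = q2 + n" "0 \<le> p1 - q2 - 1"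
    have "T = trapform 2 (of_int (p2 + q2 + c + 1)) (of_int (n - 1)) (of_int (p2 - p1))"
      unfolding T by (rule region_trap_top) (use b le in linarith)+
    then show ?thesis
      by (rule ptile_trapform[where p=p2 and q="q2 + 1", rotated 2]) (use b t sub in \<open>auto split: if_splits\<close>)
  next
    assume b: "p1 = - 1 - c - q2" "p2 = - 1 - c - q1" "p2 + q2 + c + 1 \<le> m - 1" "0 \<le> p1 - q2 - 1" "p2 - q1 + 1 \<le> n - 1"
    have "T = trapform 3 0 (of_int (p2 - q1 + 1)) (of_int (p2 - p1))"
      unfolding T by (rule region_trap_left) (use b le in linarith)+
    then show ?thesis
      by (rule ptile_trapform[where p="p2 + 1" and q=q1, rotated 2]) (use b t sub in \<open>auto split: if_splits\<close>)
  next
    assume b: "p1 = m - c - q2" "p2 = m - c - q1" "0 \<le> p1 + q1 + c - 1" "0 \<le> p1 - q2 - 1" "p2 - q1 + 1 \<le> n - 1"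
    have "T = trapform 1 (of_int (m - 1)) (of_int (p1 - q2 - 1)) (of_int (p2 - p1))"
      unfolding T by (rule region_trap_right) (use b le in linarith)+
    then show ?thesis
      by (rule ptile_trapform[where p="p1 - 1" and q=q2, rotated 2]) (use b t sub in \<open>auto split: if_splits\<close>)
  next
    assume b: "p1 = - 1 - c - q2" "p2 = - 1 - c - q1" "p2 + q2 + c + 1 \<le> m - 1" "p1 = q1 - 1" "p2 = q2 - 1" "p2 - q1 + 1 \<le> n - 1"
    have "T = triform 0 (of_int 0) (of_int 0) (of_int (2 * q2 + c))"
      unfolding T of_int_0 by (rule region_tri_bottom_left) (use b in linarith)+
    then show ?thesis
      by (rule ptile_triform[where p=q2 and q=q2, rotated 2]) (use b t sub in \<open>auto simp: tripoint_def split: if_splits\<close>)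
  next
    assume b: "p1 = - 1 - c - q2" "p2 = - 1 - c - q1" "p2 + q2 + c + 1 \<le> m - 1" "p1 = q1 + n" "p2 = q2 + n" "0 \<le> p1 - q2 - 1"
    have "T = triform 3 (of_int 0) (of_int (n - 1)) (of_int (2 * q2 + c + n + 1))"
      unfolding T of_int_0 by (rule region_tri_top_left) (use b in linarith)+
    then show ?thesis
      by (rule ptile_triform[where p="- q2 - c - 1" and q="q2 + 1", rotated 2]) (use b t sub in \<open>auto simp: tripoint_def split: if_splits\<close>)
  next
    assume b: "p1 = m - c - q2" "p2 = m - c - q1" "0 \<le> p1 + q1 + c - 1" "p1 = q1 - 1" "p2 = q2 - 1" "p2 - q1 + 1 \<le> n - 1"
    have "T = triform 1 (of_int (m - 1)) (of_int 0) (of_int (m - 1 - (2 * p1 + c)))"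
      unfolding T of_int_0 by (rule region_tri_bottom_right) (use b in linarith)+
    then show ?thesis
      by (rule ptile_triform[where p="m - 1 - c - p1" and q=p1, rotated 2]) (use b t sub in \<open>auto simp: tripoint_def split: if_splits\<close>)
  next
    assume b: "p1 = m - c - q2" "p2 = m - c - q1" "0 \<le> p1 + q1 + c - 1" "p1 = q1 + n" "p2 = q2 + n" "0 \<le> p1 - q2 - 1"
    have "T = triform 2 (of_int (m - 1)) (of_int (n - 1)) (of_int (m + n - (2 * p1 + c)))"
      unfolding T by (rule region_tri_top_right) (use b in linarith)+
    then show ?thesis
      by (rule ptile_triform[where p="p1 - 1" and q="p1 - n", rotated 2]) (use b t sub in \<open>auto simp: tripoint_def split: if_splits\<close>)
  qed
qed

lemma good_iff: "good T \<longleftrightarrow> ptile T \<and> T \<subseteq> R"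
proof
  assume "good T"
  then show "ptile T \<and> T \<subseteq> R"
    unfolding good_def
  proof (elim disjE exE conjE)
    fix p q assume T: "T = dia p q" "T \<subseteq> R"
    have "(of_int (p + q + c + 1), of_int (p - q) - 1) \<in> colored c"
      unfolding mem_colored by (intro exI[of _ p] exI[of _ "q + 1"]) auto
    then have "ctile c T"
      unfolding T dia_def by (rule ctile_diaform)
    then show ?thesis
      using T not_dashed_diaform unfolding ptile_def dia_def by auto
  next
    fix p1 p2 q1 q2 p q g h
    assume "adm p1 p2 q1 q2" "T = region p1 p2 q1 q2 \<inter> R" "test p q g h \<in> T"
    then show ?thesis using ptile_region by auto
  qed
next
  assume "ptile T \<and> T \<subseteq> R"
  then show "good T"
    using goodI unfolding ptile_def by blast
qed

section \<open>Tilings as exact covers by cells\<close>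

lemma good_has_test:
  assumes "good T"
  shows "\<exists>p q g h. test p q g h \<in> T"
  using assms unfolding good_def
proof (elim disjE exE conjE)
  fix p q assume "T = dia p q"
  then have "test p q True True \<in> T" using test_in_dia by simp
  then show ?thesis by blast
qed blast

definition tilings :: "point set set set" where
  "tilings = {\<T>. is_tiling R \<T> \<and> (\<forall>T\<in>\<T>. ctile c T)}"

text \<open>This removes topology from the problem: covering \<open>R\<close> means that each of its
  cells is in some tile, and disjoint interiors mean that no cell is in two tiles. Finiteness
  follows because each tile owns a cell and \<open>R\<close> has finitely many.\<close>

lemma tilings_iff:
  "\<T> \<in> tilings \<longleftrightarrow> (\<forall>T\<in>\<T>. good T) \<and> (\<forall>p q g h. test p q g h \<in> R \<longrightarrow> (\<exists>!T. T \<in> \<T> \<and> test p q g h \<in> T))"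
    (is "_ \<longleftrightarrow> ?good \<and> ?cells")
proof
  assume t: "\<T> \<in> tilings"
  then have un: "\<Union>\<T> = R" and dis: "\<And>S T. S \<in> \<T> \<Longrightarrow> T \<in> \<T> \<Longrightarrow> S \<noteq> T \<Longrightarrow> interior S \<inter> interior T = {}"
    unfolding tilings_def is_tiling_def by auto
  have good: ?good
  proof
    fix T assume T: "T \<in> \<T>"
    then have "ptile T"
      using t unfolding tilings_def is_tiling_def ptile_def by auto
    then show "good T"
      using good_iff un T by auto
  qed
  moreover have ?cells
  proof (intro allI impI)
    fix p q g h assume "test p q g h \<in> R"
    then obtain T where T: "T \<in> \<T>" "test p q g h \<in> T"
      using un by blast
    moreover have "S = T" if S: "S \<in> \<T>" "test p q g h \<in> S" for S
    proof (rule ccontr)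
      assume "S \<noteq> T"
      then have "interior S \<inter> interior T = {}" using dis S T by blast
      moreover have "test p q g h \<in> interior S" "test p q g h \<in> interior T"
        using good_interior good S T by auto
      ultimately show False by blast
    qed
    ultimately show "\<exists>!T. T \<in> \<T> \<and> test p q g h \<in> T" by blast
  qed
  ultimately show "?good \<and> ?cells" by blast
next
  assume a: "?good \<and> ?cells"
  then have pt: "\<And>T. T \<in> \<T> \<Longrightarrow> ptile T \<and> T \<subseteq> R" and good: ?good and cells: ?cells
    using good_iff by auto
  have ctile: "\<forall>T\<in>\<T>. ctile c T"
    using pt unfolding ptile_def by blast
  then have tile: "\<forall>T\<in>\<T>. is_tile T"
    unfolding ctile_def is_tile_def by blast
  have un: "\<Union>\<T> = R"
  proof
    show "\<Union>\<T> \<subseteq> R" using pt by blast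
    show "R \<subseteq> \<Union>\<T>"
    proof
      fix z assume "z \<in> R"
      then obtain p q g h where "test p q g h \<in> R" "incell p q g h z" by (rule rect_cell)
      then show "z \<in> \<Union>\<T>" using cells good good_incell by blast
    qed
  qed
  have dis: "\<forall>S\<in>\<T>. \<forall>T\<in>\<T>. S \<noteq> T \<longrightarrow> interior S \<inter> interior T = {}"
  proof (intro ballI impI)
    fix S T assume ST: "S \<in> \<T>" "T \<in> \<T>" "S \<noteq> T"
    show "interior S \<inter> interior T = {}"
    proof (rule ccontr)
      assume "interior S \<inter> interior T \<noteq> {}"
      then obtain p q g h where t: "test p q g h \<in> S" "test p q g h \<in> T"
        using good_interiors_meet good ST by metis
      then have "test p q g h \<in> R" using pt ST by blast
      then show False using cells t ST by blast
    qed
  qed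
  have "finite \<T>"
  proof -
    let ?I = "{(p, q, g, h). test p q g h \<in> R}"
    \<comment> \<open>The sum and the difference of the coordinates of the centre are
      \<open>2 * p + 1 + c\<close> and \<open>2 * q + 1 + c\<close>, so this crude box contains all
      indices.\<close>
    have "?I \<subseteq> {- (m + n + \<bar>c\<bar> + 2)..m + n + \<bar>c\<bar> + 2} \<times> {- (m + n + \<bar>c\<bar> + 2)..m + n + \<bar>c\<bar> + 2} \<times> UNIV \<times> UNIV"
      unfolding test_in_rect using m2 n2 by (auto split: if_splits; linarith)
    then have "finite ?I"
      by (rule finite_subset) auto
    moreover have "\<T> \<subseteq> (\<lambda>(p, q, g, h). THE T. T \<in> \<T> \<and> test p q g h \<in> T) ` ?I"
    proof
      fix T assume T: "T \<in> \<T>"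
      have "\<exists>p q g h. test p q g h \<in> T"
        using good_has_test good T by blast
      then obtain p q g h where t: "test p q g h \<in> T" by blast
      then have tR: "test p q g h \<in> R" using pt T by blast
      then have "(THE T. T \<in> \<T> \<and> test p q g h \<in> T) = T"
        using cells t T by (intro the1_equality) auto
      then show "T \<in> (\<lambda>(p, q, g, h). THE T. T \<in> \<T> \<and> test p q g h \<in> T) ` ?I"
        using tR by (intro image_eqI[of _ _ "(p, q, g, h)"]) auto
    qed
    ultimately show ?thesis by (meson finite_imageI finite_subset)
  qed
  moreover have "\<forall>T\<in>\<T>. \<forall>s. dashed_side T s \<longrightarrow> s \<subseteq> frontier R"
    using pt unfolding ptile_def by blast
  ultimately show "\<T> \<in> tilings"
    unfolding tilings_def is_tiling_def using tile un dis ctile by simp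
qed

section \<open>From kernel elements to tilings\<close>

text \<open>A unit square of the lattice consists of the neighbours of one off-color point, so the
  first clause is the kernel equation. The reflections are those in \<open>x = - 1\<close>,
  \<open>x = m\<close>, \<open>y = - 1\<close> and \<open>y = n\<close>; each swaps the two diagonal
  directions and hence the roles of \<open>p\<close> and \<open>q\<close>. The period bounds the
  runs of zeros.\<close>

definition harmonic :: "(int \<Rightarrow> int \<Rightarrow> bool) \<Rightarrow> bool" where
  "harmonic u \<longleftrightarrow>
     (\<forall>p q. (u p q \<noteq> u (p + 1) q) = (u p (q + 1) \<noteq> u (p + 1) (q + 1))) \<and>
     (\<forall>p q. u (- 1 - c - q) (- 1 - c - p) = u p q \<and> u (m - c - q) (m - c - p) = u p q \<and>
            u (q - 1) (p + 1) = u p q \<and> u (q + n) (p - n) = u p q) \<and>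
     (\<forall>p q. p + q = - 1 - c \<or> p + q = m - c \<or> p - q = - 1 \<or> p - q = n \<longrightarrow> \<not> u p q) \<and>
     (\<exists>L>0. \<forall>p q. u (p + L) q = u p q \<and> u p (q + L) = u p q)"

text \<open>The unit squares add up over a rectangle. In this form the splitting into a function of
  \<open>p\<close> plus a function of \<open>q\<close> is used, without choosing the two
  summands.\<close>

lemma harmonic_rectangle:
  assumes "harmonic u"
  shows "(u p q \<noteq> u p' q) = (u p q' \<noteq> u p' q')"
proof -
  have unit: "(u p q \<noteq> u (p + 1) q) = (u p (q + 1) \<noteq> u (p + 1) (q + 1))" for p q
    using assms unfolding harmonic_def by blast
  have row: "(u p q \<noteq> u (p + 1) q) = (u p (q + k) \<noteq> u (p + 1) (q + k))" for p q k
  proof (induction k rule: int_induct[of _ 0])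
    case base
    show ?case by simp
  next
    case (step1 k)
    then show ?case using unit[of p "q + k"] by (simp add: add.assoc)
  next
    case (step2 k)
    then show ?case using unit[of p "q + k - 1"] by (simp add: algebra_simps)
  qed
  have "(u p q \<noteq> u (p + k) q) = (u p q' \<noteq> u (p + k) q')" for k
  proof (induction k rule: int_induct[of _ 0])
    case base
    show ?case by simp
  next
    case (step1 k)
    then show ?case using row[of "p + k" q "q' - q"] by (simp add: add.assoc) blast
  next
    case (step2 k)
    then show ?case using row[of "p + k - 1" q "q' - q"] by (simp add: algebra_simps) blast
  qed
  from this[of "p' - p"] show ?thesis by simp
qed

text \<open>If the row \<open>q0\<close> vanished, no row would depend on \<open>p\<close>; but
  every row meets the mirror \<open>x = - 1\<close>, where \<open>u\<close> is 0, so
  \<open>u\<close> would vanish. Columns are treated alike.\<close>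

lemma harmonic_exists:
  assumes u: "harmonic u" and ne: "\<exists>p q. u p q"
  shows "\<exists>p. u p q0" "\<exists>q. u p0 q"
proof -
  have z: "\<not> u p q" if "p + q = - 1 - c" for p q
    using u that unfolding harmonic_def by blast
  show "\<exists>p. u p q0"
  proof (rule ccontr)
    assume "\<not> (\<exists>p. u p q0)"
    then have "u p q = u (- 1 - c - q) q" for p q
      using harmonic_rectangle[OF u, of p q0 "- 1 - c - q" q] by auto
    then show False using ne z by auto
  qed
  show "\<exists>q. u p0 q"
  proof (rule ccontr)
    assume "\<not> (\<exists>q. u p0 q)"
    then have "u p q = u p (- 1 - c - p)" for p q
      using harmonic_rectangle[OF u, of p0 q p "- 1 - c - p"] by auto
    then show False using ne z by auto
  qed
qed

text \<open>The inequality of truth values describes block, frame and corners at once. The four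
  corners of the enlarged rectangle are zeros: each completes a rectangle with two ones of the frame
  and a zero of the block.\<close>

definition isblock :: "(int \<Rightarrow> int \<Rightarrow> bool) \<Rightarrow> int \<Rightarrow> int \<Rightarrow> int \<Rightarrow> int \<Rightarrow> bool" where
  "isblock u p1 p2 q1 q2 \<longleftrightarrow> p1 \<le> p2 \<and> q1 \<le> q2 \<and>
     (\<forall>p q. p1 - 1 \<le> p \<and> p \<le> p2 + 1 \<and> q1 - 1 \<le> q \<and> q \<le> q2 + 1 \<longrightarrow>
        u p q = ((p1 \<le> p \<and> p \<le> p2) \<noteq> (q1 \<le> q \<and> q \<le> q2)))"

lemma isblockD:
  assumes "isblock u p1 p2 q1 q2" "p1 - 1 \<le> p" "p \<le> p2 + 1" "q1 - 1 \<le> q" "q \<le> q2 + 1"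
  shows "u p q = ((p1 \<le> p \<and> p \<le> p2) \<noteq> (q1 \<le> q \<and> q \<le> q2))"
  using assms unfolding isblock_def by blast

lemma isblock_le: "isblock u p1 p2 q1 q2 \<Longrightarrow> p1 \<le> p2" "isblock u p1 p2 q1 q2 \<Longrightarrow> q1 \<le> q2"
  by (simp_all add: isblock_def)

text \<open>The block is spanned by the maximal runs of zeros through the point in its row and its
  column. By the rectangle rule these two runs determine all values of the enlarged
  rectangle.\<close>

lemma block_exists:
  assumes u: "harmonic u" and ne: "\<exists>p q. u p q" and z: "\<not> u p0 q0"
  obtains p1 p2 q1 q2 where "isblock u p1 p2 q1 q2" "p1 \<le> p0" "p0 \<le> p2" "q1 \<le> q0" "q0 \<le> q2"
proof -
  obtain L where L: "0 < L" "\<And>p q. u (p + L) q = u p q" "\<And>p q. u p (q + L) = u p q"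
    using u unfolding harmonic_def by blast
  obtain a b where ab: "u a q0" "u p0 b" using harmonic_exists[OF u ne] by blast
  obtain p1 p2 where p: "p1 \<le> p0" "p0 \<le> p2" "\<And>p. p1 \<le> p \<Longrightarrow> p \<le> p2 \<Longrightarrow> \<not> u p q0" "u (p1 - 1) q0" "u (p2 + 1) q0"
    using maximal_run[of "\<lambda>p. u p q0", OF z int_translation_witness[of "\<lambda>p. u p q0", OF L(2,1) ab(1)]] by blast
  obtain q1 q2 where q: "q1 \<le> q0" "q0 \<le> q2" "\<And>q. q1 \<le> q \<Longrightarrow> q \<le> q2 \<Longrightarrow> \<not> u p0 q" "u p0 (q1 - 1)" "u p0 (q2 + 1)"
    using maximal_run[of "\<lambda>q. u p0 q", OF z int_translation_witness[of "\<lambda>q. u p0 q", OF L(3,1) ab(2)]] by blast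
  have "isblock u p1 p2 q1 q2"
    unfolding isblock_def
  proof (intro conjI allI impI; (elim conjE)?)
    show "p1 \<le> p2" "q1 \<le> q2" using p q by auto
    fix x y assume xy: "p1 - 1 \<le> x" "x \<le> p2 + 1" "q1 - 1 \<le> y" "y \<le> q2 + 1"
    have "u x q0 = (\<not> (p1 \<le> x \<and> x \<le> p2))"
    proof (cases "p1 \<le> x \<and> x \<le> p2")
      case False
      then have "x = p1 - 1 \<or> x = p2 + 1" using xy by linarith
      then show ?thesis using p False by auto
    qed (use p in auto)
    moreover have "u p0 y = (\<not> (q1 \<le> y \<and> y \<le> q2))"
    proof (cases "q1 \<le> y \<and> y \<le> q2")
      case False
      then have "y = q1 - 1 \<or> y = q2 + 1" using xy by linarith
      then show ?thesis using q False by auto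
    qed (use q in auto)
    ultimately show "u x y = ((p1 \<le> x \<and> x \<le> p2) \<noteq> (q1 \<le> y \<and> y \<le> q2))"
      using harmonic_rectangle[OF u, of x q0 p0 y] z by auto
  qed
  then show thesis using that p q by blast
qed

text \<open>If one block ended earlier, its frame would put a one in the row or column of the common
  point where the other block still has a zero.\<close>

lemma block_unique:
  assumes B: "isblock u p1 p2 q1 q2" "p1 \<le> p" "p \<le> p2" "q1 \<le> q" "q \<le> q2"
    and B': "isblock u p1' p2' q1' q2'" "p1' \<le> p" "p \<le> p2'" "q1' \<le> q" "q \<le> q2'"
  shows "p1 = p1' \<and> p2 = p2' \<and> q1 = q1' \<and> q2 = q2'"
proof -
  have *: "p1' \<le> p1 \<and> p2 \<le> p2' \<and> q1' \<le> q1 \<and> q2 \<le> q2'"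
    if B: "isblock u p1 p2 q1 q2" "p1 \<le> p" "p \<le> p2" "q1 \<le> q" "q \<le> q2"
    and B': "isblock u p1' p2' q1' q2'" "p1' \<le> p" "p \<le> p2'" "q1' \<le> q" "q \<le> q2'"
    for p1 p2 q1 q2 p1' p2' q1' q2'
  proof (intro conjI; rule ccontr)
    assume "\<not> p1' \<le> p1"
    then show False
      using isblockD[OF B(1), of "p1' - 1" q] isblockD[OF B'(1), of "p1' - 1" q] B B' by auto
  next
    assume "\<not> p2 \<le> p2'"
    then show False
      using isblockD[OF B(1), of "p2' + 1" q] isblockD[OF B'(1), of "p2' + 1" q] B B' by auto
  next
    assume "\<not> q1' \<le> q1"
    then show False
      using isblockD[OF B(1), of p "q1' - 1"] isblockD[OF B'(1), of p "q1' - 1"] B B' by auto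
  next
    assume "\<not> q2 \<le> q2'"
    then show False
      using isblockD[OF B(1), of p "q2' + 1"] isblockD[OF B'(1), of p "q2' + 1"] B B' by auto
  qed
  from *[OF B B'] *[OF B' B] show ?thesis by auto
qed

lemma isblock_reflect_sum:
  assumes "isblock u p1 p2 q1 q2" "\<And>p q. u (k - q) (k - p) = u p q"
  shows "isblock u (k - q2) (k - q1) (k - p2) (k - p1)"
  unfolding isblock_def
proof (intro conjI allI impI; (elim conjE)?)
  show "k - q2 \<le> k - q1" "k - p2 \<le> k - p1" using assms(1) unfolding isblock_def by auto
  fix p q assume pq: "k - q2 - 1 \<le> p" "p \<le> k - q1 + 1" "k - p2 - 1 \<le> q" "q \<le> k - p1 + 1"
  have "u (k - q) (k - p) = ((p1 \<le> k - q \<and> k - q \<le> p2) \<noteq> (q1 \<le> k - p \<and> k - p \<le> q2))"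
    by (rule isblockD[OF assms(1)]) (use pq in linarith)+
  moreover have "(p1 \<le> k - q \<and> k - q \<le> p2) = (k - p2 \<le> q \<and> q \<le> k - p1)"
    "(q1 \<le> k - p \<and> k - p \<le> q2) = (k - q2 \<le> p \<and> p \<le> k - q1)"
    by auto
  ultimately show "u p q = ((k - q2 \<le> p \<and> p \<le> k - q1) \<noteq> (k - p2 \<le> q \<and> q \<le> k - p1))"
    unfolding assms(2) by blast
qed

lemma isblock_reflect_diff:
  assumes "isblock u p1 p2 q1 q2" "\<And>p q. u (q + k) (p - k) = u p q"
  shows "isblock u (q1 + k) (q2 + k) (p1 - k) (p2 - k)"
  unfolding isblock_def
proof (intro conjI allI impI; (elim conjE)?)
  show "q1 + k \<le> q2 + k" "p1 - k \<le> p2 - k" using assms(1) unfolding isblock_def by auto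
  fix p q assume pq: "q1 + k - 1 \<le> p" "p \<le> q2 + k + 1" "p1 - k - 1 \<le> q" "q \<le> p2 - k + 1"
  have "u (q + k) (p - k) = ((p1 \<le> q + k \<and> q + k \<le> p2) \<noteq> (q1 \<le> p - k \<and> p - k \<le> q2))"
    by (rule isblockD[OF assms(1)]) (use pq in linarith)+
  moreover have "(p1 \<le> q + k \<and> q + k \<le> p2) = (p1 - k \<le> q \<and> q \<le> p2 - k)"
    "(q1 \<le> p - k \<and> p - k \<le> q2) = (q1 + k \<le> p \<and> p \<le> q2 + k)"
    by auto
  ultimately show "u p q = ((q1 + k \<le> p \<and> p \<le> q2 + k) \<noteq> (p1 - k \<le> q \<and> q \<le> p2 - k))"
    unfolding assms(2) by blast
qed

text \<open>A block that reaches the mirror contains a point of it. This point is fixed by the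
  reflection, so the block shares a zero with its mirror image and equals it.\<close>

lemma isblock_symmetric_sum:
  assumes B: "isblock u p1 p2 q1 q2" and r: "\<And>p q. u (k - q) (k - p) = u p q"
    and k: "p1 + q1 \<le> k" "k \<le> p2 + q2"
  shows "p1 = k - q2 \<and> p2 = k - q1"
proof -
  \<comment> \<open>The point \<open>(p, k - p)\<close> of the mirror lies in the block.\<close>
  define p where "p = max p1 (k - q2)"
  have le: "p1 \<le> p2" "q1 \<le> q2" using B unfolding isblock_def by auto
  have p: "p1 \<le> p" "p \<le> p2" "q1 \<le> k - p" "k - p \<le> q2" using k le unfolding p_def by auto
  have "p1 = k - q2 \<and> p2 = k - q1 \<and> q1 = k - p2 \<and> q2 = k - p1"
    by (rule block_unique[OF B p isblock_reflect_sum[OF B r]]) (use p in auto)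
  then show ?thesis by blast
qed

lemma isblock_symmetric_diff:
  assumes B: "isblock u p1 p2 q1 q2" and r: "\<And>p q. u (q + k) (p - k) = u p q"
    and k: "p1 - q2 \<le> k" "k \<le> p2 - q1"
  shows "p1 = q1 + k \<and> p2 = q2 + k"
proof -
  define p where "p = max p1 (q1 + k)"
  have le: "p1 \<le> p2" "q1 \<le> q2" using B unfolding isblock_def by auto
  have p: "p1 \<le> p" "p \<le> p2" "q1 \<le> p - k" "p - k \<le> q2" using k le unfolding p_def by auto
  have "p1 = q1 + k \<and> p2 = q2 + k \<and> q1 = p1 - k \<and> q2 = p2 - k"
    by (rule block_unique[OF B p isblock_reflect_diff[OF B r]]) (use p in auto)
  then show ?thesis by blast
qed

text \<open>A block with a zero between or on the mirrors either reaches a mirror and is symmetric,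
  or stops before it. In the latter case its frame cannot touch the mirror either, because the frame
  carries ones; this gains the last unit in \<open>adm\<close>.\<close>

lemma block_adm:
  assumes u: "harmonic u" and B: "isblock u p1 p2 q1 q2"
    and z: "p1 \<le> p" "p \<le> p2" "q1 \<le> q" "q \<le> q2"
    and in_range: "- 1 \<le> p + q + c" "p + q + c \<le> m" "- 1 \<le> p - q" "p - q \<le> n"
  shows "adm p1 p2 q1 q2"
proof -
  have le: "p1 \<le> p2" "q1 \<le> q2" using B unfolding isblock_def by auto
  have refl: "u (- 1 - c - q) (- 1 - c - p) = u p q" "u (m - c - q) (m - c - p) = u p q"
     "u (q + (- 1)) (p - (- 1)) = u p q" "u (q + n) (p - n) = u p q" for p q
    using u unfolding harmonic_def by auto
  have zero: "\<not> u p q" if "p + q = - 1 - c \<or> p + q = m - c \<or> p - q = - 1 \<or> p - q = n" for p q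
    using u that unfolding harmonic_def by blast
  have "0 \<le> p1 + q1 + c - 1 \<or> p1 = - 1 - c - q2 \<and> p2 = - 1 - c - q1"
  proof (cases "p1 + q1 \<le> - 1 - c")
    case True
    then show ?thesis using isblock_symmetric_sum[OF B refl(1)] z in_range by auto
  next
    case False
    have "p1 - 1 + q1 \<noteq> - 1 - c"
      using isblockD[OF B, of "p1 - 1" q1] zero[of "p1 - 1" q1] le by auto
    then show ?thesis using False by auto
  qed
  moreover have "p2 + q2 + c + 1 \<le> m - 1 \<or> p1 = m - c - q2 \<and> p2 = m - c - q1"
  proof (cases "m - c \<le> p2 + q2")
    case True
    then show ?thesis using isblock_symmetric_sum[OF B refl(2)] z in_range by auto
  next
    case False
    have "p2 + 1 + q2 \<noteq> m - c"
      using isblockD[OF B, of "p2 + 1" q2] zero[of "p2 + 1" q2] le by auto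
    then show ?thesis using False by auto
  qed
  moreover have "0 \<le> p1 - q2 - 1 \<or> p1 = q1 - 1 \<and> p2 = q2 - 1"
  proof (cases "p1 - q2 \<le> - 1")
    case True
    then show ?thesis using isblock_symmetric_diff[OF B refl(3)] z in_range by auto
  next
    case False
    have "p1 - 1 - q2 \<noteq> - 1"
      using isblockD[OF B, of "p1 - 1" q2] zero[of "p1 - 1" q2] le by auto
    then show ?thesis using False by auto
  qed
  moreover have "p2 - q1 + 1 \<le> n - 1 \<or> p1 = q1 + n \<and> p2 = q2 + n"
  proof (cases "n \<le> p2 - q1")
    case True
    then show ?thesis using isblock_symmetric_diff[OF B refl(4)] z in_range by auto
  next
    case False
    have "p2 + 1 - q1 \<noteq> n"
      using isblockD[OF B, of "p2 + 1" q1] zero[of "p2 + 1" q1] le by auto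
    then show ?thesis using False by auto
  qed
  ultimately show ?thesis using le unfolding adm_def by blast
qed

text \<open>Here the bounds become membership in the two intervals of the block: some corner of the
  diamond is in the block, and the two colored vertices of the cell are in the block or on its
  frame. Later arguments are thereby propositional.\<close>

lemma test_in_region':
  assumes "p1 \<le> p2" "q1 \<le> q2"
  shows "test p q g h \<in> region p1 p2 q1 q2 \<longleftrightarrow>
     (p1 \<le> p \<and> p \<le> p2 \<or> p1 \<le> p + 1 \<and> p + 1 \<le> p2) \<and> (q1 \<le> q \<and> q \<le> q2 \<or> q1 \<le> q + 1 \<and> q + 1 \<le> q2) \<and>
     (if g then p1 \<le> p + 1 \<and> p + 1 \<le> p2 \<or> q1 \<le> q + 1 \<and> q + 1 \<le> q2 else p1 \<le> p \<and> p \<le> p2 \<or> q1 \<le> q \<and> q \<le> q2) \<and>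
     (if h then p1 \<le> p + 1 \<and> p + 1 \<le> p2 \<or> q1 \<le> q \<and> q \<le> q2 else p1 \<le> p \<and> p \<le> p2 \<or> q1 \<le> q + 1 \<and> q + 1 \<le> q2)"
  unfolding test_in_region[OF assms] using assms
  by (cases g; cases h; simp only: if_True if_False simp_thms; smt (verit))

section \<open>The tiling of a harmonic function\<close>

definition tilesof :: "(int \<Rightarrow> int \<Rightarrow> bool) \<Rightarrow> point set set" where
  "tilesof u = {T.
     (\<exists>p q. T = dia p q \<and> T \<subseteq> R \<and> u p q \<and> u (p + 1) q \<and> u p (q + 1) \<and> u (p + 1) (q + 1)) \<or>
     (\<exists>p1 p2 q1 q2. adm p1 p2 q1 q2 \<and> isblock u p1 p2 q1 q2 \<and> T = region p1 p2 q1 q2 \<inter> R \<and> (\<exists>p q g h. test p q g h \<in> T))}"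

lemma tilesof_good: "T \<in> tilesof u \<Longrightarrow> good T"
  unfolding tilesof_def good_def by blast

text \<open>Unless the corners of the cell's diamond are all ones, the block of one of its zeros has a region that contains the cell.\<close>
lemma tilesof_covers:
  assumes u: "harmonic u" and ne: "\<exists>p q. u p q" and t: "test p q g h \<in> R"
  shows "\<exists>T\<in>tilesof u. test p q g h \<in> T"
proof (cases "u p q \<and> u (p + 1) q \<and> u p (q + 1) \<and> u (p + 1) (q + 1)")
  case True
  have zero: "\<not> u p q" if "p + q = - 1 - c \<or> p + q = m - c \<or> p - q = - 1 \<or> p - q = n" for p q
    using u that unfolding harmonic_def by blast
  \<comment> \<open>Ones do not lie on mirrors, so a diamond of ones with a cell in \<open>R\<close>
    stays in \<open>R\<close>.\<close>
  have "p + q \<noteq> - 1 - c" "(p + 1) + (q + 1) \<noteq> m - c" "p - (q + 1) \<noteq> - 1" "p + 1 - q \<noteq> n"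
    using True zero by blast+
  then have b: "0 \<le> p + q + c" "p + q + c + 2 \<le> m - 1" "0 \<le> p - q - 1" "p - q + 1 \<le> n - 1"
    using t unfolding test_in_rect by (auto split: if_splits)
  have "real_of_int (p + q + c) \<ge> 0" "real_of_int (p + q + c + 2) \<le> of_int (m - 1)"
    "real_of_int (p - q - 1) \<ge> 0" "real_of_int (p - q + 1) \<le> of_int (n - 1)"
    using b unfolding of_int_le_iff of_int_0_le_iff by auto
  then have "dia p q \<subseteq> R"
    by (auto simp: mem_dia mem_rect)
  then show ?thesis
    using True test_in_dia unfolding tilesof_def by (intro bexI[of _ "dia p q"]) auto
next
  case False
  have par: "(u p q \<noteq> u (p + 1) q) = (u p (q + 1) \<noteq> u (p + 1) (q + 1))"
    using u unfolding harmonic_def by blast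
  have cover: ?thesis
    if B: "isblock u p1 p2 q1 q2" "p1 \<le> x" "x \<le> p2" "q1 \<le> y" "y \<le> q2"
      "x = p \<or> x = p + 1" "y = q \<or> y = q + 1" and tr: "test p q g h \<in> region p1 p2 q1 q2" for p1 p2 q1 q2 x y
  proof -
    have "- 1 \<le> x + y + c" "x + y + c \<le> m" "- 1 \<le> x - y" "x - y \<le> n"
      using t B(6,7) unfolding test_in_rect by (auto split: if_splits)
    then have "adm p1 p2 q1 q2"
      by (rule block_adm[OF u B(1-5)])
    then show ?thesis
      using B(1) tr t unfolding tilesof_def by (intro bexI[of _ "region p1 p2 q1 q2 \<inter> R"]) blast+
  qed
  \<comment> \<open>\<open>(x, y)\<close> and \<open>(x', y')\<close> are the two colored vertices
    of the cell.\<close>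
  define x y where "x = (if g then p + 1 else p)" and "y = (if g then q + 1 else q)"
  define x' y' where "x' = (if h then p + 1 else p)" and "y' = (if h then q else q + 1)"
  show ?thesis
  proof (cases "u x y")
    case xy: False
    obtain p1 p2 q1 q2 where B: "isblock u p1 p2 q1 q2" "p1 \<le> x" "x \<le> p2" "q1 \<le> y" "y \<le> q2"
      using block_exists[OF u ne xy] by blast
    have le: "p1 \<le> p2" "q1 \<le> q2" using B by auto
    have tr: "test p q g h \<in> region p1 p2 q1 q2"
      unfolding test_in_region'[OF le] using B(2-) unfolding x_def y_def by (auto split: if_splits)
    show ?thesis
      by (rule cover[OF B _ _ tr]) (auto simp: x_def y_def)
  next
    case xy: True
    show ?thesis
    proof (cases "u x' y'")
      case xy': False
      obtain p1 p2 q1 q2 where B: "isblock u p1 p2 q1 q2" "p1 \<le> x'" "x' \<le> p2" "q1 \<le> y'" "y' \<le> q2"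
        using block_exists[OF u ne xy'] by blast
      have le: "p1 \<le> p2" "q1 \<le> q2" using B by auto
      have tr: "test p q g h \<in> region p1 p2 q1 q2"
        unfolding test_in_region'[OF le] using B(2-) unfolding x'_def y'_def by (auto split: if_splits)
      show ?thesis
        by (rule cover[OF B _ _ tr]) (auto simp: x'_def y'_def)
    next
      case xy': True
      define x2 y2 where "x2 = (if g then p else p + 1)" and "y2 = (if g then q else q + 1)"
      define x3 y3 where "x3 = (if h then p else p + 1)" and "y3 = (if h then q + 1 else q)"
      \<comment> \<open>The corners have even sum and are not all ones, so two ones leave two
        zeros.\<close>
      have z: "\<not> u x2 y2" "\<not> u x3 y3"
        using False par xy xy' unfolding x_def y_def x'_def y'_def x2_def y2_def x3_def y3_def
        by (auto split: if_splits)
      obtain p1 p2 q1 q2 where B: "isblock u p1 p2 q1 q2" "p1 \<le> x2" "x2 \<le> p2" "q1 \<le> y2" "y2 \<le> q2"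
        using block_exists[OF u ne z(1)] by blast
      have le: "p1 \<le> p2" "q1 \<le> q2" using B by auto
      \<comment> \<open>The two zeros are neighbours in the lattice. A frame point next to a point
        of the block is a one, so both belong to the same block.\<close>
      have "p1 \<le> x3 \<and> x3 \<le> p2 \<and> q1 \<le> y3 \<and> y3 \<le> q2"
        using isblockD[OF B(1), of x3 y3] z(2) B(2-) unfolding x2_def y2_def x3_def y3_def by (auto split: if_splits)
      then have tr: "test p q g h \<in> region p1 p2 q1 q2"
        unfolding test_in_region'[OF le] using B(2-) unfolding x2_def y2_def x3_def y3_def by (auto split: if_splits)
      show ?thesis
        by (rule cover[OF B _ _ tr]) (auto simp: x2_def y2_def)
    qed
  qed
qed

lemma region_test_zero:
  assumes B: "isblock u p1 p2 q1 q2" and t: "test p q g h \<in> region p1 p2 q1 q2"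
  shows "u p q = ((p1 \<le> p \<and> p \<le> p2) \<noteq> (q1 \<le> q \<and> q \<le> q2))"
    "u (p + 1) q = ((p1 \<le> p + 1 \<and> p + 1 \<le> p2) \<noteq> (q1 \<le> q \<and> q \<le> q2))"
    "u p (q + 1) = ((p1 \<le> p \<and> p \<le> p2) \<noteq> (q1 \<le> q + 1 \<and> q + 1 \<le> q2))"
    "u (p + 1) (q + 1) = ((p1 \<le> p + 1 \<and> p + 1 \<le> p2) \<noteq> (q1 \<le> q + 1 \<and> q + 1 \<le> q2))"
  using t unfolding test_in_region[OF isblock_le[OF B]] by (intro isblockD[OF B]; linarith)+

text \<open>The values at the corners of the diamond fix the four interval memberships up to
  complementing all of them. Were the second block complementary to the first, both colored vertices
  of the cell would be ones; sharing a coordinate, they would agree in the other one, although each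
  block must meet that pair of coordinates. So the memberships agree and yield a common
  zero.\<close>

lemma blocks_sharing_test:
  assumes B: "isblock u p1 p2 q1 q2" and t: "test p q g h \<in> region p1 p2 q1 q2"
    and B': "isblock u p1' p2' q1' q2'" and t': "test p q g h \<in> region p1' p2' q1' q2'"
  shows "p1 = p1' \<and> p2 = p2' \<and> q1 = q1' \<and> q2 = q2'"
proof -
  have le: "p1 \<le> p2" "q1 \<le> q2" "p1' \<le> p2'" "q1' \<le> q2'" using B B' unfolding isblock_def by auto
  define a0 a1 b0 b1 where ab: "a0 = (p1 \<le> p \<and> p \<le> p2)" "a1 = (p1 \<le> p + 1 \<and> p + 1 \<le> p2)"
    "b0 = (q1 \<le> q \<and> q \<le> q2)" "b1 = (q1 \<le> q + 1 \<and> q + 1 \<le> q2)"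
  define a0' a1' b0' b1' where ab': "a0' = (p1' \<le> p \<and> p \<le> p2')" "a1' = (p1' \<le> p + 1 \<and> p + 1 \<le> p2')"
    "b0' = (q1' \<le> q \<and> q \<le> q2')" "b1' = (q1' \<le> q + 1 \<and> q + 1 \<le> q2')"
  note eqs = region_test_zero[OF B t, folded ab] region_test_zero[OF B' t', folded ab']
  have "a0 \<and> a0' \<and> b0 \<and> b0' \<or> a1 \<and> a1' \<and> b0 \<and> b0' \<or> a0 \<and> a0' \<and> b1 \<and> b1' \<or> a1 \<and> a1' \<and> b1 \<and> b1'"
    using eqs t[unfolded test_in_region'[OF le(1,2)], folded ab] t'[unfolded test_in_region'[OF le(3,4)], folded ab']
    by (cases g; cases h; simp; argo)
  then show ?thesis
  proof (elim disjE conjE)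
    assume "a0" "a0'" "b0" "b0'"
    then show ?thesis unfolding ab ab' using block_unique[OF B _ _ _ _ B', of p q] by blast
  next
    assume "a1" "a1'" "b0" "b0'"
    then show ?thesis unfolding ab ab' using block_unique[OF B _ _ _ _ B', of "p + 1" q] by blast
  next
    assume "a0" "a0'" "b1" "b1'"
    then show ?thesis unfolding ab ab' using block_unique[OF B _ _ _ _ B', of p "q + 1"] by blast
  next
    assume "a1" "a1'" "b1" "b1'"
    then show ?thesis unfolding ab ab' using block_unique[OF B _ _ _ _ B', of "p + 1" "q + 1"] by blast
  qed
qed

lemma tilesof_disjoint:
  assumes S: "S \<in> tilesof u" "test p q g h \<in> S" and T: "T \<in> tilesof u" "test p q g h \<in> T"
  shows "S = T"
proof -
  \<comment> \<open>A region containing the cell has a corner of the diamond in its block, and that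
    corner is a zero.\<close>
  have mixed: False if B: "isblock u p1 p2 q1 q2" "test p q g h \<in> region p1 p2 q1 q2"
    and ones: "u p q" "u (p + 1) q" "u p (q + 1)" "u (p + 1) (q + 1)" for p1 p2 q1 q2
  proof -
    have le: "p1 \<le> p2" "q1 \<le> q2" using B unfolding isblock_def by auto
    show False
      using region_test_zero[OF B] ones B(2) unfolding test_in_region'[OF le] by (auto split: if_splits)
  qed
  show ?thesis
    using S(1) T(1) unfolding tilesof_def mem_Collect_eq
  proof (elim disjE exE conjE)
    fix p' q' p'' q'' assume "S = dia p' q'" "T = dia p'' q''"
    then show ?thesis
      using S(2) T(2) test_in_dia[of p q g h p' q'] test_in_dia[of p q g h p'' q''] by simp
  next
    fix p' q' p1 p2 q1 q2
    assume "S = dia p' q'" "u p' q'" "u (p' + 1) q'" "u p' (q' + 1)" "u (p' + 1) (q' + 1)"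
      "isblock u p1 p2 q1 q2" "T = region p1 p2 q1 q2 \<inter> R"
    then show ?thesis
      using S(2) T(2) test_in_dia[of p q g h p' q'] mixed[of p1 p2 q1 q2] by simp
  next
    fix p' q' p1 p2 q1 q2
    assume "T = dia p' q'" "u p' q'" "u (p' + 1) q'" "u p' (q' + 1)" "u (p' + 1) (q' + 1)"
      "isblock u p1 p2 q1 q2" "S = region p1 p2 q1 q2 \<inter> R"
    then show ?thesis
      using S(2) T(2) test_in_dia[of p q g h p' q'] mixed[of p1 p2 q1 q2] by simp
  next
    fix p1 p2 q1 q2 p1' p2' q1' q2'
    assume "isblock u p1 p2 q1 q2" "S = region p1 p2 q1 q2 \<inter> R"
      "isblock u p1' p2' q1' q2'" "T = region p1' p2' q1' q2' \<inter> R"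
    then show ?thesis
      using S(2) T(2) blocks_sharing_test[of u p1 p2 q1 q2 p q g h p1' p2' q1' q2'] by simp
  qed
qed

lemma tilesof_tiling:
  assumes "harmonic u" "\<exists>p q. u p q"
  shows "tilesof u \<in> tilings"
  unfolding tilings_iff using tilesof_good tilesof_covers[OF assms] tilesof_disjoint by blast

section \<open>Recovering the function from its tiles\<close>

definition inside :: "int \<Rightarrow> int \<Rightarrow> bool" where
  "inside p q \<longleftrightarrow> 0 \<le> p + q + c \<and> p + q + c \<le> m - 1 \<and> 0 \<le> p - q \<and> p - q \<le> n - 1"

definition lpt :: "int \<Rightarrow> int \<Rightarrow> point" where
  "lpt p q = (of_int (p + q + c), of_int (p - q))"

lemma lpt_in_rect: "lpt p q \<in> R \<longleftrightarrow> inside p q"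
proof -
  have "lpt p q \<in> R \<longleftrightarrow> real_of_int 0 \<le> of_int (p + q + c) \<and> real_of_int (p + q + c) \<le> of_int (m - 1) \<and>
     real_of_int 0 \<le> of_int (p - q) \<and> real_of_int (p - q) \<le> of_int (n - 1)"
    by (simp add: lpt_def mem_rect)
  then show ?thesis
    unfolding of_int_le_iff inside_def .
qed

lemma int_in_region:
  "(of_int i, of_int j) \<in> region p1 p2 q1 q2 \<longleftrightarrow>
     p1 + q1 + c - 1 \<le> i \<and> i \<le> p2 + q2 + c + 1 \<and> p1 - q2 - 1 \<le> j \<and> j \<le> p2 - q1 + 1 \<and>
     2 * p1 + c - 2 \<le> i + j \<and> i + j \<le> 2 * p2 + c + 2 \<and> 2 * q1 + c - 2 \<le> i - j \<and> i - j \<le> 2 * q2 + c + 2"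
  by (simp only: mem_region of_int_add[symmetric] of_int_diff[symmetric] of_int_le_iff)

lemma int_in_dia:
  "(of_int i, of_int j) \<in> dia p q \<longleftrightarrow>
     2 * p + c \<le> i + j \<and> i + j \<le> 2 * p + c + 2 \<and> 2 * q + c \<le> i - j \<and> i - j \<le> 2 * q + c + 2"
  by (simp only: mem_dia of_int_add[symmetric] of_int_diff[symmetric] of_int_le_iff)

lemma int_in_rect: "(of_int i, of_int j) \<in> R \<longleftrightarrow> 0 \<le> i \<and> i \<le> m - 1 \<and> 0 \<le> j \<and> j \<le> n - 1"
  by (auto simp: mem_rect)

lemma lpt_in_region:
  assumes "p1 \<le> p2" "q1 \<le> q2"
  shows "lpt p q \<in> region p1 p2 q1 q2 \<longleftrightarrow>
     p1 - 1 \<le> p \<and> p \<le> p2 + 1 \<and> q1 - 1 \<le> q \<and> q \<le> q2 + 1 \<and> (p1 \<le> p \<and> p \<le> p2 \<or> q1 \<le> q \<and> q \<le> q2)"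
  unfolding lpt_def int_in_region using assms by (intro iffI conjI; (elim conjE disjE)?; (linarith)?; auto)

lemma lpt_in_dia: "lpt x y \<in> dia p q \<longleftrightarrow> (x = p \<or> x = p + 1) \<and> (y = q \<or> y = q + 1)"
  unfolding lpt_def int_in_dia by auto

lemma region_neighbourhood:
  assumes "p1 \<le> p" "p \<le> p2" "q1 \<le> q" "q \<le> q2"
    "\<bar>fst z - fst (lpt p q)\<bar> \<le> 1" "\<bar>snd z - snd (lpt p q)\<bar> \<le> 1"
  shows "z \<in> region p1 p2 q1 q2"
proof -
  have "real_of_int p1 \<le> p" "real_of_int p \<le> p2" "real_of_int q1 \<le> q" "real_of_int q \<le> q2"
    using assms by auto
  then show ?thesis
    using assms(5,6) by (cases z) (simp add: lpt_def mem_region; linarith)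
qed

text \<open>All of \<open>R\<close> within distance 1 of a block point belongs to the region. A tile
  through this point is convex with nonempty interior, so it has interior points that close, and the
  two interiors meet.\<close>

lemma same_tile:
  assumes "\<T> \<in> tilings" and T': "region p1 p2 q1 q2 \<inter> R \<in> \<T>" and b: "p1 \<le> p" "p \<le> p2" "q1 \<le> q" "q \<le> q2"
    and T: "T \<in> \<T>" "lpt p q \<in> T"
  shows "T = region p1 p2 q1 q2 \<inter> R"
proof -
  have good: "good T" "good (region p1 p2 q1 q2 \<inter> R)"
    and ex1: "\<And>p q g h. test p q g h \<in> R \<Longrightarrow> \<exists>!T. T \<in> \<T> \<and> test p q g h \<in> T"
    using assms(1) T' T(1) unfolding tilings_iff by simp_all
  obtain x y g h where t: "test x y g h \<in> T" using good_has_test[OF good(1)] by blast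
  define N where "N = norm (lpt p q - test x y g h)"
  have N: "0 \<le> N" unfolding N_def by simp
  define e where "e = 1 / (N + 1)"
  have e: "0 < e" "e \<le> 1" "e * N < 1" unfolding e_def using N by (auto simp: field_simps)
  define z where "z = lpt p q - e *\<^sub>R (lpt p q - test x y g h)"
  have z: "z \<in> interior T"
    unfolding z_def by (rule mem_interior_convex_shrink[OF convex_good[OF good(1)] good_interior[OF good(1) t] T(2) e(1,2)])
  have "dist (lpt p q) z < 1"
    unfolding z_def dist_norm using e(1,3) by (simp flip: N_def)
  moreover have "interior T \<inter> ball (lpt p q) 1 \<subseteq> region p1 p2 q1 q2 \<inter> R"
  proof
    fix w assume w: "w \<in> interior T \<inter> ball (lpt p q) 1"
    then have "dist (fst w) (fst (lpt p q)) \<le> 1" "dist (snd w) (snd (lpt p q)) \<le> 1"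
      using dist_fst_le[of w "lpt p q"] dist_snd_le[of w "lpt p q"] by (auto simp: dist_commute)
    then have "w \<in> region p1 p2 q1 q2"
      by (intro region_neighbourhood[OF b]) (auto simp: dist_real_def)
    moreover have "w \<in> R"
      using w interior_subset good_subset_rect[OF good(1)] by blast
    ultimately show "w \<in> region p1 p2 q1 q2 \<inter> R" by blast
  qed
  then have "interior T \<inter> ball (lpt p q) 1 \<subseteq> interior (region p1 p2 q1 q2 \<inter> R)"
    by (intro interior_maximal) auto
  moreover have "z \<in> ball (lpt p q) 1" using calculation(1) by simp
  ultimately have "interior T \<inter> interior (region p1 p2 q1 q2 \<inter> R) \<noteq> {}"
    using z by blast
  then obtain x' y' g' h' where t': "test x' y' g' h' \<in> T" "test x' y' g' h' \<in> region p1 p2 q1 q2 \<inter> R"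
    by (rule good_interiors_meet[OF good])
  then show ?thesis
    using ex1[of x' y' g' h'] T T' by blast
qed

text \<open>Since \<open>m\<close> and \<open>n\<close> are at least 2, a zero in \<open>R\<close>
  has a horizontal and a vertical neighbour in \<open>R\<close>, both in the region. The only
  off-color lattice point of a diamond is its centre, so the zero would be an east or west corner
  and also a north or south corner.\<close>

lemma block_not_dia:
  assumes "dia p' q' = region p1 p2 q1 q2 \<inter> R" "inside p q" "p1 \<le> p" "p \<le> p2" "q1 \<le> q" "q \<le> q2"
  shows False
proof -
  have *: "0 \<le> i \<and> i \<le> m - 1 \<and> 0 \<le> j \<and> j \<le> n - 1 \<Longrightarrow> \<bar>i - (p + q + c)\<bar> \<le> 1 \<Longrightarrow> \<bar>j - (p - q)\<bar> \<le> 1 \<Longrightarrow>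
      2 * p' + c \<le> i + j \<and> i + j \<le> 2 * p' + c + 2 \<and> 2 * q' + c \<le> i - j \<and> i - j \<le> 2 * q' + c + 2" for i j
  proof -
    assume ij: "0 \<le> i \<and> i \<le> m - 1 \<and> 0 \<le> j \<and> j \<le> n - 1" "\<bar>i - (p + q + c)\<bar> \<le> 1" "\<bar>j - (p - q)\<bar> \<le> 1"
    have "(of_int i, of_int j) \<in> region p1 p2 q1 q2"
      unfolding int_in_region using ij assms(3-6) by linarith
    then have "(of_int i, of_int j) \<in> dia p' q'"
      unfolding assms(1) using ij(1) int_in_rect by blast
    then show ?thesis unfolding int_in_dia .
  qed
  have x: "(0 \<le> p + q + c + 1 \<and> p + q + c + 1 \<le> m - 1) \<or> (0 \<le> p + q + c - 1 \<and> p + q + c - 1 \<le> m - 1)"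
    and y: "(0 \<le> p - q + 1 \<and> p - q + 1 \<le> n - 1) \<or> (0 \<le> p - q - 1 \<and> p - q - 1 \<le> n - 1)"
    using assms(2) m2 n2 unfolding inside_def by linarith+
  have ins: "0 \<le> p + q + c" "p + q + c \<le> m - 1" "0 \<le> p - q" "p - q \<le> n - 1"
    using assms(2) unfolding inside_def by auto
  have pq: "p' \<le> p" "p \<le> p' + 1" "q' \<le> q" "q \<le> q' + 1"
    using *[of "p + q + c" "p - q"] ins by auto
  have "p = p' \<and> q = q' \<or> p = p' + 1 \<and> q = q' + 1"
    using x
  proof
    assume "0 \<le> p + q + c + 1 \<and> p + q + c + 1 \<le> m - 1"
    then show ?thesis using *[of "p + q + c + 1" "p - q"] ins pq by auto
  next
    assume "0 \<le> p + q + c - 1 \<and> p + q + c - 1 \<le> m - 1"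
    then show ?thesis using *[of "p + q + c - 1" "p - q"] ins pq by auto
  qed
  moreover have "p = p' \<and> q = q' + 1 \<or> p = p' + 1 \<and> q = q'"
    using y
  proof
    assume "0 \<le> p - q + 1 \<and> p - q + 1 \<le> n - 1"
    then show ?thesis using *[of "p + q + c" "p - q + 1"] ins pq by auto
  next
    assume "0 \<le> p - q - 1 \<and> p - q - 1 \<le> n - 1"
    then show ?thesis using *[of "p + q + c" "p - q - 1"] ins pq by auto
  qed
  ultimately show False by auto
qed

text \<open>A zero of one block that is not a zero of the other would be a corner of \<open>R\<close>, where one tile is a triangle and the other is not.\<close>
lemma block_zeros_unique:
  assumes eq: "region p1 p2 q1 q2 \<inter> R = region p1' p2' q1' q2' \<inter> R"
    and adm: "adm p1 p2 q1 q2" and adm': "adm p1' p2' q1' q2'"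
    and ins: "inside p q" and b: "p1 \<le> p" "p \<le> p2" "q1 \<le> q" "q \<le> q2"
  shows "p1' \<le> p \<and> p \<le> p2' \<and> q1' \<le> q \<and> q \<le> q2'"
proof (rule ccontr)
  assume contra: "\<not> ?thesis"
  have le: "p1 \<le> p2" "q1 \<le> q2" "p1' \<le> p2'" "q1' \<le> q2'" using adm adm' adm_le by auto
  define I where "I = (\<lambda>i j. p1 + q1 + c - 1 \<le> i \<and> i \<le> p2 + q2 + c + 1 \<and> p1 - q2 - 1 \<le> j \<and> j \<le> p2 - q1 + 1 \<and>
     2 * p1 + c - 2 \<le> i + j \<and> i + j \<le> 2 * p2 + c + 2 \<and> 2 * q1 + c - 2 \<le> i - j \<and> i - j \<le> 2 * q2 + c + 2)"
  define I' where "I' = (\<lambda>i j. p1' + q1' + c - 1 \<le> i \<and> i \<le> p2' + q2' + c + 1 \<and> p1' - q2' - 1 \<le> j \<and> j \<le> p2' - q1' + 1 \<and>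
     2 * p1' + c - 2 \<le> i + j \<and> i + j \<le> 2 * p2' + c + 2 \<and> 2 * q1' + c - 2 \<le> i - j \<and> i - j \<le> 2 * q2' + c + 2)"
  have II: "I i j = I' i j" if "0 \<le> i" "i \<le> m - 1" "0 \<le> j" "j \<le> n - 1" for i j
  proof -
    have "((of_int i, of_int j) \<in> region p1 p2 q1 q2 \<inter> R) = ((of_int i, of_int j) \<in> region p1' p2' q1' q2' \<inter> R)"
      using eq by simp
    then show ?thesis
      using that unfolding Int_iff int_in_region int_in_rect I_def I'_def by blast
  qed
  have near: "I' i j" if "0 \<le> i" "i \<le> m - 1" "0 \<le> j" "j \<le> n - 1" "\<bar>i - (p + q + c)\<bar> \<le> 1" "\<bar>j - (p - q)\<bar> \<le> 1" for i j
  proof -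
    have "I i j" unfolding I_def using that(5,6) b by linarith
    then show ?thesis using II that by blast
  qed
  have "lpt p q \<in> region p1' p2' q1' q2'"
    using near[of "p + q + c" "p - q"] ins unfolding lpt_def int_in_region I'_def inside_def by simp
  \<comment> \<open>The point is in the second region but not in the second block, so it is on one
    side of the second frame.\<close>
  then have ring: "p = p2' + 1 \<and> q1' \<le> q \<and> q \<le> q2' \<or> p = p1' - 1 \<and> q1' \<le> q \<and> q \<le> q2' \<or>
     q = q2' + 1 \<and> p1' \<le> p \<and> p \<le> p2' \<or> q = q1' - 1 \<and> p1' \<le> p \<and> p \<le> p2'"
    using contra unfolding lpt_in_region[OF le(3,4)] by linarith
  define x y where "x = p + q + c" and "y = p - q"
  have xy: "0 \<le> x" "x \<le> m - 1" "0 \<le> y" "y \<le> n - 1"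
    using ins unfolding inside_def x_def y_def by auto
  have near_xy: "x < m - 1 \<Longrightarrow> I' (x + 1) y" "0 < x \<Longrightarrow> I' (x - 1) y" "y < n - 1 \<Longrightarrow> I' x (y + 1)" "0 < y \<Longrightarrow> I' x (y - 1)"
    using near[of "x + 1" y] near[of "x - 1" y] near[of x "y + 1"] near[of x "y - 1"] xy
    unfolding x_def y_def by auto
  from ring show False
  proof (elim disjE conjE)
    assume r: "p = p2' + 1" "q1' \<le> q" "q \<le> q2'"
    \<comment> \<open>Beyond \<open>p2'\<close> the eastern and northern neighbours are outside the
      second region. They would be in the first region, so they are not in \<open>R\<close>: the
      point is its upper right corner.\<close>
    have far: "\<not> I' (x + 1) y" "\<not> I' x (y + 1)"
      using r unfolding I'_def x_def y_def by linarith+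
    have "x = m - 1" "y = n - 1"
      using near_xy(1) near_xy(3) far xy by linarith+
    note corner = this[unfolded x_def y_def]
    \<comment> \<open>With a zero in this corner the first octagon must be symmetric in both
      adjacent mirrors.\<close>
    have B: "p1 = m - c - q2" "p2 = m - c - q1" "p1 = q1 + n" "p2 = q2 + n"
      using adm b corner m2 n2 unfolding adm_def by linarith+
    have B': "q2' = q" "q1' = q"
      using adm' r corner m2 n2 unfolding adm_def by linarith+
    have big: "2 \<le> m - 1" "2 \<le> n - 1"
      using adm' r corner B' m2 n2 unfolding adm_def by linarith+
    \<comment> \<open>The first tile is a triangle whose leg is 2 if \<open>p1 = p\<close> and at
      least 4 otherwise. A leg of 4 contains \<open>(x - 3, y)\<close>, which is just beyond the
      second region, since \<open>q1' = q\<close>. A leg of 2 misses \<open>(x - 2, y - 2)\<close>,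
      which the second region contains.\<close>
    have "p1 = p"
    proof (rule ccontr)
      assume "\<not> ?thesis"
      then have I: "I (x - 3) y" and range: "0 \<le> x - 3" "x - 3 \<le> m - 1"
        using adm b corner B m2 n2 unfolding I_def adm_def x_def y_def by linarith+
      have "\<not> I' (x - 3) y"
        using r B' unfolding I'_def x_def y_def by linarith
      then show False using II[of "x - 3" y] I range xy by blast
    qed
    then have "\<not> I (x - 2) (y - 2)"
      unfolding I_def x_def y_def by linarith
    moreover have "I' (x - 2) (y - 2)"
      using r B' le unfolding I'_def x_def y_def by linarith
    ultimately show False
      using II[of "x - 2" "y - 2"] corner big unfolding x_def y_def by auto
  next
    assume r: "p = p1' - 1" "q1' \<le> q" "q \<le> q2'"
    have far: "\<not> I' (x - 1) y" "\<not> I' x (y - 1)"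
      using r unfolding I'_def x_def y_def by linarith+
    have "x = 0" "y = 0"
      using near_xy(2) near_xy(4) far xy by linarith+
    note corner = this[unfolded x_def y_def]
    have B: "p1 = - 1 - c - q2" "p2 = - 1 - c - q1" "p1 = q1 - 1" "p2 = q2 - 1"
      using adm b corner m2 n2 unfolding adm_def by linarith+
    have B': "q2' = q" "q1' = q"
      using adm' r corner m2 n2 unfolding adm_def by linarith+
    have big: "2 \<le> m - 1" "2 \<le> n - 1"
      using adm' r corner B' m2 n2 unfolding adm_def by linarith+
    have "p2 = p"
    proof (rule ccontr)
      assume "\<not> ?thesis"
      then have I: "I (x + 3) y" and range: "0 \<le> x + 3" "x + 3 \<le> m - 1"
        using adm b corner B m2 n2 unfolding I_def adm_def x_def y_def by linarith+
      have "\<not> I' (x + 3) y"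
        using r B' unfolding I'_def x_def y_def by linarith
      then show False using II[of "x + 3" y] I range xy by blast
    qed
    then have "\<not> I (x + 2) (y + 2)"
      unfolding I_def x_def y_def by linarith
    moreover have "I' (x + 2) (y + 2)"
      using r B' le unfolding I'_def x_def y_def by linarith
    ultimately show False
      using II[of "x + 2" "y + 2"] corner big unfolding x_def y_def by auto
  next
    assume r: "q = q2' + 1" "p1' \<le> p" "p \<le> p2'"
    have far: "\<not> I' (x + 1) y" "\<not> I' x (y - 1)"
      using r unfolding I'_def x_def y_def by linarith+
    have "x = m - 1" "y = 0"
      using near_xy(1) near_xy(4) far xy by linarith+
    note corner = this[unfolded x_def y_def]
    have B: "p1 = m - c - q2" "p2 = m - c - q1" "p1 = q1 - 1" "p2 = q2 - 1"
      using adm b corner m2 n2 unfolding adm_def by linarith+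
    have B': "p2' = p" "p1' = p"
      using adm' r corner m2 n2 unfolding adm_def by linarith+
    have big: "2 \<le> m - 1" "2 \<le> n - 1"
      using adm' r corner B' m2 n2 unfolding adm_def by linarith+
    have "q1 = q"
    proof (rule ccontr)
      assume "\<not> ?thesis"
      then have I: "I (x - 3) y" and range: "0 \<le> x - 3" "x - 3 \<le> m - 1"
        using adm b corner B m2 n2 unfolding I_def adm_def x_def y_def by linarith+
      have "\<not> I' (x - 3) y"
        using r B' unfolding I'_def x_def y_def by linarith
      then show False using II[of "x - 3" y] I range xy by blast
    qed
    then have "\<not> I (x - 2) (y + 2)"
      unfolding I_def x_def y_def by linarith
    moreover have "I' (x - 2) (y + 2)"
      using r B' le unfolding I'_def x_def y_def by linarith
    ultimately show False
      using II[of "x - 2" "y + 2"] corner big unfolding x_def y_def by auto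
  next
    assume r: "q = q1' - 1" "p1' \<le> p" "p \<le> p2'"
    have far: "\<not> I' (x - 1) y" "\<not> I' x (y + 1)"
      using r unfolding I'_def x_def y_def by linarith+
    have "x = 0" "y = n - 1"
      using near_xy(2) near_xy(3) far xy by linarith+
    note corner = this[unfolded x_def y_def]
    have B: "p1 = - 1 - c - q2" "p2 = - 1 - c - q1" "p1 = q1 + n" "p2 = q2 + n"
      using adm b corner m2 n2 unfolding adm_def by linarith+
    have B': "p2' = p" "p1' = p"
      using adm' r corner m2 n2 unfolding adm_def by linarith+
    have big: "2 \<le> m - 1" "2 \<le> n - 1"
      using adm' r corner B' m2 n2 unfolding adm_def by linarith+
    have "q2 = q"
    proof (rule ccontr)
      assume "\<not> ?thesis"
      then have I: "I (x + 3) y" and range: "0 \<le> x + 3" "x + 3 \<le> m - 1"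
        using adm b corner B m2 n2 unfolding I_def adm_def x_def y_def by linarith+
      have "\<not> I' (x + 3) y"
        using r B' unfolding I'_def x_def y_def by linarith
      then show False using II[of "x + 3" y] I range xy by blast
    qed
    then have "\<not> I (x + 2) (y - 2)"
      unfolding I_def x_def y_def by linarith
    moreover have "I' (x + 2) (y - 2)"
      using r B' le unfolding I'_def x_def y_def by linarith
    ultimately show False
      using II[of "x + 2" "y - 2"] corner big unfolding x_def y_def by auto
  qed
qed

text \<open>Every colored point of \<open>R\<close> lies in some tile, and the tile as a set shows
  its value: by \<open>block_not_dia\<close> and \<open>block_zeros_unique\<close>, all its
  presentations agree on the zeros in \<open>R\<close>.\<close>

lemma tilesof_determines:
  assumes u: "harmonic u" "\<exists>p q. u p q" and u': "harmonic u'" "\<exists>p q. u' p q"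
    and eq: "tilesof u = tilesof u'" and ins: "inside p q"
  shows "u p q = u' p q"
proof -
  have "lpt p q \<in> R" using ins lpt_in_rect by blast
  then obtain x y g h where t: "test x y g h \<in> R" "incell x y g h (lpt p q)" by (rule rect_cell)
  obtain T where T: "T \<in> tilesof u" "test x y g h \<in> T" using tilesof_covers[OF u t(1)] by blast
  have pT: "lpt p q \<in> T" using good_incell[OF tilesof_good[OF T(1)] T(2) t(2)] .
  have cases: "(\<exists>p' q'. T = dia p' q') \<and> u p q \<or>
      (\<exists>p1 p2 q1 q2. adm p1 p2 q1 q2 \<and> T = region p1 p2 q1 q2 \<inter> R \<and> u p q = (\<not> (p1 \<le> p \<and> p \<le> p2 \<and> q1 \<le> q \<and> q \<le> q2)))"
    if "T \<in> tilesof u" for u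
    using that unfolding tilesof_def mem_Collect_eq
  proof (elim disjE exE conjE)
    fix p' q' assume "T = dia p' q'" "u p' q'" "u (p' + 1) q'" "u p' (q' + 1)" "u (p' + 1) (q' + 1)"
    then show ?thesis using pT lpt_in_dia[of p q p' q'] by auto
  next
    fix p1 p2 q1 q2 assume a: "adm p1 p2 q1 q2" and B: "isblock u p1 p2 q1 q2" and T: "T = region p1 p2 q1 q2 \<inter> R"
    have "u p q = (\<not> (p1 \<le> p \<and> p \<le> p2 \<and> q1 \<le> q \<and> q \<le> q2))"
      using pT lpt_in_region[OF adm_le[OF a], of p q] isblockD[OF B, of p q] unfolding T by auto
    then show ?thesis using a T by blast
  qed
  from cases[OF T(1)] cases[OF T(1)[unfolded eq]] show ?thesis
  proof (elim disjE exE conjE)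
    fix p' q' p1 p2 q1 q2
    assume "T = dia p' q'" "T = region p1 p2 q1 q2 \<inter> R" "u' p q = (\<not> (p1 \<le> p \<and> p \<le> p2 \<and> q1 \<le> q \<and> q \<le> q2))" "u p q"
    then show ?thesis using block_not_dia[of p' q' p1 p2 q1 q2, OF _ ins] by auto
  next
    fix p' q' p1 p2 q1 q2
    assume "T = dia p' q'" "T = region p1 p2 q1 q2 \<inter> R" "u p q = (\<not> (p1 \<le> p \<and> p \<le> p2 \<and> q1 \<le> q \<and> q \<le> q2))" "u' p q"
    then show ?thesis using block_not_dia[of p' q' p1 p2 q1 q2, OF _ ins] by auto
  next
    fix p1 p2 q1 q2 p1' p2' q1' q2'
    assume a: "adm p1 p2 q1 q2" "adm p1' p2' q1' q2'"
      and T: "T = region p1 p2 q1 q2 \<inter> R" "T = region p1' p2' q1' q2' \<inter> R"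
      and u: "u p q = (\<not> (p1 \<le> p \<and> p \<le> p2 \<and> q1 \<le> q \<and> q \<le> q2))"
        "u' p q = (\<not> (p1' \<le> p \<and> p \<le> p2' \<and> q1' \<le> q \<and> q \<le> q2'))"
    show ?thesis
      using block_zeros_unique[OF _ a ins] block_zeros_unique[OF _ a(2,1) ins] T u by auto
  qed simp_all
qed

section \<open>From tilings to kernel elements\<close>

lemma tiling_good: "\<T> \<in> tilings \<Longrightarrow> T \<in> \<T> \<Longrightarrow> good T"
  by (simp add: tilings_iff)

lemma tiling_cover: "\<T> \<in> tilings \<Longrightarrow> test p q g h \<in> R \<Longrightarrow> \<exists>T\<in>\<T>. test p q g h \<in> T"
  unfolding tilings_iff by metis

lemma tiling_unique:
  assumes "\<T> \<in> tilings" "S \<in> \<T>" "T \<in> \<T>" "test p q g h \<in> S" "test p q g h \<in> T"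
  shows "S = T"
proof -
  have "test p q g h \<in> R" using tiling_good[OF assms(1,2)] good_subset_rect assms(4) by blast
  then have "\<exists>!T. T \<in> \<T> \<and> test p q g h \<in> T" using assms(1) unfolding tilings_iff by simp
  then show ?thesis using assms by blast
qed

text \<open>A tile does not come with a block, so all admissible presentations are considered. By
  \<open>block_zeros_unique\<close> they have the same zeros inside \<open>R\<close>.\<close>

definition ones :: "point set set \<Rightarrow> int \<Rightarrow> int \<Rightarrow> bool" where
  "ones \<T> p q \<longleftrightarrow> inside p q \<and>
     \<not> (\<exists>p1 p2 q1 q2. adm p1 p2 q1 q2 \<and> region p1 p2 q1 q2 \<inter> R \<in> \<T> \<and> p1 \<le> p \<and> p \<le> p2 \<and> q1 \<le> q \<and> q \<le> q2)"

text \<open>A tile that made a frame point of this region a zero would equal the present tile by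
  \<open>same_tile\<close>, and then the two blocks agree on zeros in \<open>R\<close>.\<close>

lemma ones_region:
  assumes t: "\<T> \<in> tilings" and T: "region p1 p2 q1 q2 \<inter> R \<in> \<T>" and adm: "adm p1 p2 q1 q2"
    and ins: "inside p q" and pt: "lpt p q \<in> region p1 p2 q1 q2"
  shows "ones \<T> p q = ((p1 \<le> p \<and> p \<le> p2) \<noteq> (q1 \<le> q \<and> q \<le> q2))"
proof (cases "(p1 \<le> p \<and> p \<le> p2) \<and> (q1 \<le> q \<and> q \<le> q2)")
  case True
  then have "\<not> ones \<T> p q"
    unfolding ones_def using T adm by blast
  then show ?thesis using True by auto
next
  case False
  have "\<not> (adm p1' p2' q1' q2' \<and> region p1' p2' q1' q2' \<inter> R \<in> \<T> \<and> p1' \<le> p \<and> p \<le> p2' \<and> q1' \<le> q \<and> q \<le> q2')"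
    for p1' p2' q1' q2'
  proof
    assume a: "adm p1' p2' q1' q2' \<and> region p1' p2' q1' q2' \<inter> R \<in> \<T> \<and> p1' \<le> p \<and> p \<le> p2' \<and> q1' \<le> q \<and> q \<le> q2'"
    have "region p1 p2 q1 q2 \<inter> R = region p1' p2' q1' q2' \<inter> R"
      by (rule same_tile[OF t, of _ _ _ _ p q]) (use a T pt ins lpt_in_rect in auto)
    then have "p1 \<le> p \<and> p \<le> p2 \<and> q1 \<le> q \<and> q \<le> q2"
      using block_zeros_unique[of p1' p2' q1' q2' p1 p2 q1 q2 p q] a adm ins by auto
    then show False using False by blast
  qed
  then have "ones \<T> p q" unfolding ones_def using ins by blast
  then show ?thesis
    using False pt unfolding lpt_in_region[OF adm_le[OF adm]] by blast
qed

lemma ones_dia: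
  assumes t: "\<T> \<in> tilings" and T: "dia p' q' \<in> \<T>" and pt: "lpt p q \<in> dia p' q'"
  shows "ones \<T> p q"
proof -
  have "dia p' q' \<subseteq> R" by (rule good_subset_rect[OF tiling_good[OF t T]])
  then have ins: "inside p q" using pt lpt_in_rect by blast
  have "\<not> (adm p1 p2 q1 q2 \<and> region p1 p2 q1 q2 \<inter> R \<in> \<T> \<and> p1 \<le> p \<and> p \<le> p2 \<and> q1 \<le> q \<and> q \<le> q2)"
    for p1 p2 q1 q2
  proof
    assume a: "adm p1 p2 q1 q2 \<and> region p1 p2 q1 q2 \<inter> R \<in> \<T> \<and> p1 \<le> p \<and> p \<le> p2 \<and> q1 \<le> q \<and> q \<le> q2"
    have "dia p' q' = region p1 p2 q1 q2 \<inter> R"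
      by (rule same_tile[OF t, of _ _ _ _ p q]) (use a T pt in auto)
    then show False
      using block_not_dia[of p' q' p1 p2 q1 q2 p q] a ins by auto
  qed
  then show ?thesis unfolding ones_def using ins by blast
qed

lemma tiling_cases:
  assumes "\<T> \<in> tilings" "T \<in> \<T>"
  obtains p q where "T = dia p q"
  | p1 p2 q1 q2 where "adm p1 p2 q1 q2" "T = region p1 p2 q1 q2 \<inter> R"
proof -
  have "good T" by (rule tiling_good[OF assms])
  then show thesis using that unfolding good_def by blast
qed

lemma incell_lpt:
  "incell p q g h (if g then lpt (p + 1) (q + 1) else lpt p q)"
  "incell p q g h (if h then lpt (p + 1) q else lpt p (q + 1))"
  by (auto simp: incell_def lpt_def)

text \<open>A region reaches a mirror only if it is symmetric in it. The reflection fixes the point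
  and exchanges the conditions on \<open>p\<close> and \<open>q\<close>.\<close>

lemma adm_lpt_outside:
  assumes "adm p1 p2 q1 q2" "lpt p q \<in> region p1 p2 q1 q2"
    "p + q = - 1 - c \<or> p + q = m - c \<or> p - q = - 1 \<or> p - q = n"
  shows "(p1 \<le> p \<and> p \<le> p2) = (q1 \<le> q \<and> q \<le> q2)"
  using assms unfolding adm_def lpt_def int_in_region by linarith

text \<open>If a region covers a cell whose two colored vertices are ones, these share a coordinate
  that is outside its interval of the block. Then the other coordinate of both and the remaining
  shared-direction coordinate are inside, so the region contains the whole diamond, including the
  cell in \<open>T\<close>.\<close>

lemma tile_contains_ones_cell:
  assumes t: "\<T> \<in> tilings" and T: "T \<in> \<T>" "test p q g h \<in> T" and R: "test p q g' h' \<in> R"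
    and ones: "ones \<T> (if g' then p + 1 else p) (if g' then q + 1 else q)"
      "ones \<T> (if h' then p + 1 else p) (if h' then q else q + 1)"
  shows "test p q g' h' \<in> T"
proof -
  let ?x = "if g' then p + 1 else p" and ?y = "if g' then q + 1 else q"
  let ?x' = "if h' then p + 1 else p" and ?y' = "if h' then q else q + 1"
  note gd = tiling_good[OF t]
  obtain T' where T': "T' \<in> \<T>" "test p q g' h' \<in> T'" using tiling_cover[OF t R] by blast
  have tR: "test p q g h \<in> R" using T gd good_subset_rect by blast
  from t T'(1) have "test p q g h \<in> T'"
  proof (cases rule: tiling_cases)
    case (1 x y)
    then show ?thesis using T'(2) test_in_dia by simp
  next
    case (2 p1 p2 q1 q2)
    have le: "p1 \<le> p2" "q1 \<le> q2" using 2 adm_le by blast+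
    have tr: "test p q g' h' \<in> region p1 p2 q1 q2" using T'(2) 2 by auto
    have l: "lpt ?x ?y \<in> T'" "lpt ?x' ?y' \<in> T'"
      using good_incell[OF gd[OF T'(1)] T'(2)] incell_lpt[of p q g' h'] by (auto split: if_splits)
    then have ins: "inside ?x ?y" "inside ?x' ?y'"
      using 2 lpt_in_rect by (auto split: if_splits)
    note e = ones_region[OF t _ 2(1) ins(1)] ones_region[OF t _ 2(1) ins(2)]
    have e1: "(p1 \<le> ?x \<and> ?x \<le> p2) \<noteq> (q1 \<le> ?y \<and> ?y \<le> q2)"
      using e(1) ones(1) l(1) T'(1) 2 by auto
    have e2: "(p1 \<le> ?x' \<and> ?x' \<le> p2) \<noteq> (q1 \<le> ?y' \<and> ?y' \<le> q2)"
      using e(2) ones(2) l(2) T'(1) 2 by auto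
    define a0 a1 b0 b1 where ab: "a0 = (p1 \<le> p \<and> p \<le> p2)" "a1 = (p1 \<le> p + 1 \<and> p + 1 \<le> p2)"
      "b0 = (q1 \<le> q \<and> q \<le> q2)" "b1 = (q1 \<le> q + 1 \<and> q + 1 \<le> q2)"
    have "(if g' then a1 else a0) \<noteq> (if g' then b1 else b0)" "(if h' then a1 else a0) \<noteq> (if h' then b0 else b1)"
      using e1 e2 unfolding ab by (simp_all split: if_splits)
    moreover have "(a0 \<or> a1) \<and> (b0 \<or> b1)"
      using tr unfolding test_in_region'[OF le] ab by blast
    ultimately have "test p q g h \<in> region p1 p2 q1 q2"
      unfolding test_in_region'[OF le] ab[symmetric] by (auto split: if_splits)
    then show ?thesis using 2 tR by blast
  qed
  then have "T' = T" using tiling_unique[OF t T'(1) T(1)] T(2) by blast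
  then show ?thesis using T'(2) by simp
qed

text \<open>If the tile at hand is a diamond, all four neighbours are ones. If it is a region, they
  follow the rule of its block, which has even sum. Only a corner outside the region needs an
  argument: were it a one, the cell between it and a neighbouring corner would have to belong to the
  tile.\<close>

lemma ones_parity:
  assumes t: "\<T> \<in> tilings" and R: "test p q g h \<in> R"
  shows "(ones \<T> p q \<noteq> ones \<T> (p + 1) q) = (ones \<T> p (q + 1) \<noteq> ones \<T> (p + 1) (q + 1))"
proof -
  obtain T where T: "T \<in> \<T>" "test p q g h \<in> T"
    using tiling_cover[OF t R] by blast
  from t T(1) show ?thesis
  proof (cases rule: tiling_cases)
    case (1 x y)
    then have T': "dia p q \<in> \<T>" using T test_in_dia by auto
    show ?thesis
      using ones_dia[OF t T'] by (simp add: lpt_in_dia)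
  next
    case (2 p1 p2 q1 q2)
    have le: "p1 \<le> p2" "q1 \<le> q2" using 2 adm_le by blast+
    have tr: "test p q g h \<in> region p1 p2 q1 q2" using T 2 by auto
    define a where "a = (\<lambda>p. p1 \<le> p \<and> p \<le> p2)"
    define b where "b = (\<lambda>q. q1 \<le> q \<and> q \<le> q2)"
    have ab: "a p \<or> a (p + 1)" "b q \<or> b (q + 1)"
      using tr unfolding test_in_region'[OF le] a_def b_def by blast+
    have w: "0 \<le> p + q + 1 + c" "p + q + 1 + c \<le> m - 1" "0 \<le> p - q" "p - q \<le> n - 1"
      using R unfolding test_in_rect by (auto split: if_splits)
    have lr: "lpt x y \<in> region p1 p2 q1 q2 \<longleftrightarrow> a x \<or> b y" if "x = p \<or> x = p + 1" "y = q \<or> y = q + 1" for x y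
      unfolding lpt_in_region[OF le] a_def b_def using that ab[unfolded a_def b_def] by auto
    have val: "ones \<T> x y = (a x \<noteq> b y)" if xy: "x = p \<or> x = p + 1" "y = q \<or> y = q + 1" and "a x \<or> b y" for x y
    proof (cases "inside x y")
      case True
      then show ?thesis
        using ones_region[OF t _ 2(1) True] T 2 lr[OF xy] that unfolding a_def b_def by auto
    next
      case False
      \<comment> \<open>A corner of the diamond is one unit away from its centre in
        \<open>R\<close>, so outside \<open>R\<close> it is on a mirror.\<close>
      have "x + y = - 1 - c \<or> x + y = m - c \<or> x - y = - 1 \<or> x - y = n"
        using False w xy unfolding inside_def by linarith
      then have "a x = b y"
        using adm_lpt_outside[OF 2(1)] lr[OF xy] that unfolding a_def b_def by blast
      then show ?thesis using False unfolding ones_def by blast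
    qed
    have contra: False if "test p q g' h' \<in> R" "ones \<T> (if g' then p + 1 else p) (if g' then q + 1 else q)"
      "ones \<T> (if h' then p + 1 else p) (if h' then q else q + 1)"
      "\<not> (a (if g' then p + 1 else p) \<or> b (if g' then q + 1 else q)) \<or> \<not> (a (if h' then p + 1 else p) \<or> b (if h' then q else q + 1))" for g' h'
    proof -
      have "test p q g' h' \<in> T"
        by (rule tile_contains_ones_cell[OF t T that(1-3)])
      then have "test p q g' h' \<in> region p1 p2 q1 q2" using 2 by blast
      then show False
        using that(4) unfolding test_in_region'[OF le] a_def b_def by (auto split: if_splits)
    qed
    have ins: "ones \<T> x y \<Longrightarrow> inside x y" for x y unfolding ones_def by blast
    have all: "ones \<T> x y = (a x \<noteq> b y)" if xy: "x = p \<or> x = p + 1" "y = q \<or> y = q + 1" for x y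
    proof (cases "a x \<or> b y")
      case False
      define x' where "x' = 2 * p + 1 - x"
      have x': "x' = p \<or> x' = p + 1" "a x'" using xy ab False unfolding x'_def by auto
      then have n: "ones \<T> x' y" using val[of x' y] xy False by blast
      have "\<not> ones \<T> x y"
      proof
        assume o: "ones \<T> x y"
        \<comment> \<open>This is the cell whose colored vertices are the two corners with second
          lattice coordinate \<open>y\<close>.\<close>
        have "test p q (y \<noteq> q) (y = q) \<in> R"
          using ins[OF n] ins[OF o] w xy unfolding test_in_rect inside_def x'_def by auto
        then show False using contra[of "y \<noteq> q" "y = q"] o n False xy unfolding x'_def by auto
      qed
      then show ?thesis using False by blast
    qed (use val xy in auto)
    then show ?thesis using all[of p q] all[of "p + 1" q] all[of p "q + 1"] all[of "p + 1" "q + 1"] by simp argo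
  qed
qed

text \<open>Values on the part of the frame of a block outside \<open>R\<close> are recovered by reflection.\<close>
lemma tile_isblock:
  assumes t: "\<T> \<in> tilings" and u: "harmonic u" and agree: "\<And>p q. inside p q \<Longrightarrow> u p q = ones \<T> p q"
    and adm: "adm p1 p2 q1 q2" and T: "region p1 p2 q1 q2 \<inter> R \<in> \<T>"
  shows "isblock u p1 p2 q1 q2"
proof -
  have le: "p1 \<le> p2" "q1 \<le> q2" using adm adm_le by blast+
  define a where "a = (\<lambda>p. p1 \<le> p \<and> p \<le> p2)"
  define b where "b = (\<lambda>q. q1 \<le> q \<and> q \<le> q2)"
  have refl: "u (- 1 - c - q) (- 1 - c - p) = u p q" "u (m - c - q) (m - c - p) = u p q"
     "u (q - 1) (p + 1) = u p q" "u (q + n) (p - n) = u p q" for p q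
    using u unfolding harmonic_def by auto
  have zero: "\<not> u p q" if "p + q = - 1 - c \<or> p + q = m - c \<or> p - q = - 1 \<or> p - q = n" for p q
    using u that unfolding harmonic_def by blast
  have line: "u p q = (a p \<noteq> b q)" if "lpt p q \<in> region p1 p2 q1 q2"
     "p + q = - 1 - c \<or> p + q = m - c \<or> p - q = - 1 \<or> p - q = n" for p q
    using adm_lpt_outside[OF adm that] zero[OF that(2)] unfolding a_def b_def by blast
  have inner: "u p q = (a p \<noteq> b q)" if "lpt p q \<in> region p1 p2 q1 q2" "inside p q" for p q
    using agree[OF that(2)] ones_region[OF t T adm that(2,1)] unfolding a_def b_def by blast
  have vertical: "u p q = (a p \<noteq> b q)" if l: "lpt p q \<in> region p1 p2 q1 q2" and x: "0 \<le> p + q + c" "p + q + c \<le> m - 1" for p q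
  proof -
    consider "inside p q" | "p - q = - 1 \<or> p - q = n" | "p - q < - 1" | "n < p - q"
      using x unfolding inside_def by linarith
    then show ?thesis
    proof cases
      case 1 then show ?thesis using inner l by blast
    next
      case 2 then show ?thesis using line l by blast
    next
      case 3
      have B: "p1 = q1 - 1" "p2 = q2 - 1" "p2 - q1 + 1 \<le> n - 1"
        using l 3 adm n2 unfolding lpt_def int_in_region adm_def by linarith+
      have l': "lpt (q - 1) (p + 1) \<in> region p1 p2 q1 q2"
        using l 3 B le unfolding lpt_in_region[OF le] by linarith
      have "inside (q - 1) (p + 1)"
        using l l' 3 B x unfolding inside_def lpt_def int_in_region by linarith
      then have "u (q - 1) (p + 1) = (a (q - 1) \<noteq> b (p + 1))"
        by (rule inner[OF l'])
      moreover have "a (q - 1) = b q" "b (p + 1) = a p"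
        unfolding a_def b_def using B by auto
      ultimately show ?thesis using refl(3) by auto
    next
      case 4
      have B: "p1 = q1 + n" "p2 = q2 + n" "0 \<le> p1 - q2 - 1"
        using l 4 adm n2 unfolding lpt_def int_in_region adm_def by linarith+
      have l': "lpt (q + n) (p - n) \<in> region p1 p2 q1 q2"
        using l 4 B le unfolding lpt_in_region[OF le] by linarith
      have "inside (q + n) (p - n)"
        using l l' 4 B x unfolding inside_def lpt_def int_in_region by linarith
      then have "u (q + n) (p - n) = (a (q + n) \<noteq> b (p - n))"
        by (rule inner[OF l'])
      moreover have "a (q + n) = b q" "b (p - n) = a p"
        unfolding a_def b_def using B by auto
      ultimately show ?thesis using refl(4) by auto
    qed
  qed
  have all: "u p q = (a p \<noteq> b q)" if l: "lpt p q \<in> region p1 p2 q1 q2" for p q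
  proof -
    consider "0 \<le> p + q + c" "p + q + c \<le> m - 1" | "p + q = - 1 - c \<or> p + q = m - c" | "p + q < - 1 - c" | "m - c < p + q"
      by linarith
    then show ?thesis
    proof cases
      case 1 then show ?thesis using vertical l by blast
    next
      case 2 then show ?thesis using line l by blast
    next
      case 3
      have B: "p1 = - 1 - c - q2" "p2 = - 1 - c - q1" "p2 + q2 + c + 1 \<le> m - 1"
        using l 3 adm m2 unfolding lpt_def int_in_region adm_def by linarith+
      have l': "lpt (- 1 - c - q) (- 1 - c - p) \<in> region p1 p2 q1 q2"
        using l 3 B le unfolding lpt_in_region[OF le] by linarith
      have "u (- 1 - c - q) (- 1 - c - p) = (a (- 1 - c - q) \<noteq> b (- 1 - c - p))"
        by (rule vertical[OF l']) (use l l' 3 B in \<open>unfold lpt_def int_in_region, linarith+\<close>)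
      moreover have "a (- 1 - c - q) = b q" "b (- 1 - c - p) = a p"
        unfolding a_def b_def using B by auto
      ultimately show ?thesis using refl(1) by auto
    next
      case 4
      have B: "p1 = m - c - q2" "p2 = m - c - q1" "0 \<le> p1 + q1 + c - 1"
        using l 4 adm m2 unfolding lpt_def int_in_region adm_def by linarith+
      have l': "lpt (m - c - q) (m - c - p) \<in> region p1 p2 q1 q2"
        using l 4 B le unfolding lpt_in_region[OF le] by linarith
      have "u (m - c - q) (m - c - p) = (a (m - c - q) \<noteq> b (m - c - p))"
        by (rule vertical[OF l']) (use l l' 4 B in \<open>unfold lpt_def int_in_region, linarith+\<close>)
      moreover have "a (m - c - q) = b q" "b (m - c - p) = a p"
        unfolding a_def b_def using B by auto
      ultimately show ?thesis using refl(2) by auto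
    qed
  qed
  have "u p q = (a p \<noteq> b q)" if pq: "p1 - 1 \<le> p" "p \<le> p2 + 1" "q1 - 1 \<le> q" "q \<le> q2 + 1" for p q
  proof (cases "a p \<or> b q")
    case True
    then show ?thesis using all[of p q] pq unfolding lpt_in_region[OF le] a_def b_def by blast
  next
    case False
    \<comment> \<open>The corners of the enlarged rectangle are not in the region; the rectangle
      rule gives them from three points that are.\<close>
    have ab: "a p1" "b q1" unfolding a_def b_def using le by auto
    have "u p1 q = (a p1 \<noteq> b q)" "u p q1 = (a p \<noteq> b q1)" "u p1 q1 = (a p1 \<noteq> b q1)"
      using ab pq le all[of p1 q] all[of p q1] all[of p1 q1] unfolding lpt_in_region[OF le] a_def b_def by auto
    then show ?thesis using harmonic_rectangle[OF u, of p q p1 q1] ab False by auto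
  qed
  then show ?thesis unfolding isblock_def a_def b_def using le by blast
qed

text \<open>By \<open>tile_isblock\<close> every tile is one of \<open>u\<close>. Conversely, a tile
  of \<open>u\<close> has a cell, some tile of the tiling covers this cell, and
  \<open>tilesof_disjoint\<close> identifies the two.\<close>

lemma tiling_eq_tilesof:
  assumes t: "\<T> \<in> tilings" and u: "harmonic u" and agree: "\<And>p q. inside p q \<Longrightarrow> u p q = ones \<T> p q"
  shows "(\<exists>p q. u p q) \<and> tilesof u = \<T>"
proof -
  note gd = tiling_good[OF t]
  have dia_ones: "u x y" if "dia p q \<in> \<T>" "x = p \<or> x = p + 1" "y = q \<or> y = q + 1" for p q x y
  proof -
    have "lpt x y \<in> dia p q" using that lpt_in_dia by simp
    then have "ones \<T> x y" by (rule ones_dia[OF t that(1)])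
    then show ?thesis using agree unfolding ones_def by blast
  qed
  have sub: "T \<in> tilesof u" if T: "T \<in> \<T>" for T
    using t T
  proof (cases rule: tiling_cases)
    case (1 p q)
    then show ?thesis
      using dia_ones[of p q] T good_subset_rect[OF gd[OF T]] unfolding tilesof_def by blast
  next
    case (2 p1 p2 q1 q2)
    then show ?thesis
      using tile_isblock[OF t u agree 2(1)] T good_has_test[OF gd[OF T]] unfolding tilesof_def by blast
  qed
  have "0 \<in> R" using m2 n2 by (auto simp: mem_rect zero_prod_def)
  then obtain p q g h where "test p q g h \<in> R" by (rule rect_cell)
  then obtain T where T: "T \<in> \<T>" using tiling_cover[OF t] by blast
  have ne: "\<exists>p q. u p q"
    using t T
  proof (cases rule: tiling_cases)
    case (1 p q)
    then show ?thesis using dia_ones[of p q] T by blast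
  next
    case (2 p1 p2 q1 q2)
    then have B: "isblock u p1 p2 q1 q2" using tile_isblock[OF t u agree 2(1)] T by blast
    have "p1 \<le> p2" "q1 \<le> q2" using 2 adm_le by blast+
    then show ?thesis using isblockD[OF B, of "p1 - 1" q1] by auto
  qed
  moreover have "S \<in> \<T>" if S: "S \<in> tilesof u" for S
  proof -
    obtain p q g h where p: "test p q g h \<in> S" using good_has_test[OF tilesof_good[OF S]] by blast
    then have "test p q g h \<in> R" using good_subset_rect[OF tilesof_good[OF S]] by blast
    then obtain T where "T \<in> \<T>" "test p q g h \<in> T" using tiling_cover[OF t] by blast
    then show ?thesis using tilesof_disjoint[OF S p] sub by blast
  qed
  ultimately show ?thesis using sub by blast
qed

section \<open>The bijection\<close>

definition on_color :: "(int \<times> int) set" where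
  "on_color = {b \<in> grid m n. even (fst b + snd b + c)}"

definition off_color :: "(int \<times> int) set" where
  "off_color = {b \<in> grid m n. odd (fst b + snd b + c)}"

text \<open>This is the kernel of \<open>BW\<close> for \<open>c = 0\<close> and of \<open>WB\<close> for \<open>c = 1\<close>.\<close>
definition kernel :: "(int \<times> int \<Rightarrow> bit) set" where
  "kernel = {v \<in> on_color \<rightarrow>\<^sub>E UNIV. nbr_sum on_color off_color v = zero_on off_color}"

text \<open>Points off the board count as zeros, so boundary points have the same four-term equation
  as inner points.\<close>

definition one_at :: "(int \<times> int \<Rightarrow> bit) \<Rightarrow> int \<Rightarrow> int \<Rightarrow> bool" where
  "one_at v x y \<longleftrightarrow> (x, y) \<in> on_color \<and> v (x, y) = 1"

lemma sum_neighbours: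
  fixes v :: "int \<times> int \<Rightarrow> bit"
  shows "(\<Sum>p\<in>{p \<in> A. adjacent p (x, y)}. v p) =
    (if (x - 1, y) \<in> A then v (x - 1, y) else 0) + (if (x + 1, y) \<in> A then v (x + 1, y) else 0) +
    (if (x, y - 1) \<in> A then v (x, y - 1) else 0) + (if (x, y + 1) \<in> A then v (x, y + 1) else 0)"
proof -
  have "{p \<in> A. adjacent p (x, y)} = {(x - 1, y), (x + 1, y), (x, y - 1), (x, y + 1)} \<inter> A"
    unfolding adjacent_def by auto
  then have "(\<Sum>p\<in>{p \<in> A. adjacent p (x, y)}. v p) =
      (\<Sum>p\<in>{(x - 1, y), (x + 1, y), (x, y - 1), (x, y + 1)}. if p \<in> A then v p else 0)"
    by (simp only: sum.inter_restrict[OF finite.insertI[OF finite.insertI[OF finite.insertI[OF finite.insertI[OF finite.emptyI]]]]])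
  then show ?thesis by (simp add: add.assoc)
qed

lemma kernel_iff:
  "v \<in> kernel \<longleftrightarrow> v \<in> extensional on_color \<and>
     (\<forall>x y. 0 \<le> x \<and> x \<le> m - 1 \<and> 0 \<le> y \<and> y \<le> n - 1 \<and> odd (x + y + c) \<longrightarrow>
        (one_at v (x - 1) y \<noteq> one_at v (x + 1) y) = (one_at v x (y - 1) \<noteq> one_at v x (y + 1)))"
proof -
  have val: "(if (x, y) \<in> on_color then v (x, y) else 0) = 1 \<longleftrightarrow> one_at v x y" for x y
    by (simp add: one_at_def)
  have at: "(\<Sum>p\<in>{p \<in> on_color. adjacent p (x, y)}. v p) = 0 \<longleftrightarrow>
      (one_at v (x - 1) y \<noteq> one_at v (x + 1) y) = (one_at v x (y - 1) \<noteq> one_at v x (y + 1))" for x y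
    unfolding sum_neighbours bit_sum_zero_iff val ..
  have "nbr_sum on_color off_color v = zero_on off_color \<longleftrightarrow>
      (\<forall>w\<in>off_color. (\<Sum>p\<in>{p \<in> on_color. adjacent p w}. v p) = 0)"
    unfolding nbr_sum_def zero_on_def restrict_def fun_eq_iff by auto
  also have "\<dots> \<longleftrightarrow> (\<forall>x y. (x, y) \<in> off_color \<longrightarrow>
      (one_at v (x - 1) y \<noteq> one_at v (x + 1) y) = (one_at v x (y - 1) \<noteq> one_at v x (y + 1)))"
    unfolding Ball_def split_paired_All at ..
  also have "\<dots> \<longleftrightarrow> (\<forall>x y. 0 \<le> x \<and> x \<le> m - 1 \<and> 0 \<le> y \<and> y \<le> n - 1 \<and> odd (x + y + c) \<longrightarrow>
        (one_at v (x - 1) y \<noteq> one_at v (x + 1) y) = (one_at v x (y - 1) \<noteq> one_at v x (y + 1)))"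
    unfolding off_color_def grid_def by auto
  finally show ?thesis
    unfolding kernel_def PiE_def by simp
qed

lemma mem_on_color: "(p + q + c, p - q) \<in> on_color \<longleftrightarrow> inside p q"
  unfolding on_color_def grid_def inside_def by auto

lemma on_color_cases:
  assumes "b \<in> on_color"
  obtains p q where "b = (p + q + c, p - q)" "inside p q"
proof -
  obtain x y where b: "b = (x, y)" by fastforce
  have "even (x + y - c)" using assms unfolding b on_color_def by simp
  then obtain p where p: "x + y - c = 2 * p" by (elim evenE)
  have "b = (p + (p - y) + c, p - (p - y))" unfolding b using p by simp
  then show thesis using that assms mem_on_color by metis
qed

section \<open>Extension by reflection\<close>

definition extend :: "(int \<times> int \<Rightarrow> bit) \<Rightarrow> int \<Rightarrow> int \<Rightarrow> bool" where
  "extend v p q = one_at v (fold_coord m (p + q + c)) (fold_coord n (p - q))"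

lemma one_at_outside: "x = - 1 \<or> x = m \<or> y = - 1 \<or> y = n \<Longrightarrow> \<not> one_at v x y"
  unfolding one_at_def on_color_def grid_def by auto

lemma extend_inside:
  assumes "inside p q"
  shows "extend v p q = (v (p + q + c, p - q) = 1)"
  using assms mem_on_color[of p q] m2 n2 unfolding extend_def one_at_def inside_def by (simp add: fold_id)

lemma harmonic_extend:
  assumes v: "v \<in> kernel"
  shows "harmonic (extend v)"
proof -
  have m0: "0 < m" and n0: "0 < n" using m2 n2 by auto
  have K: "(one_at v (x - 1) y \<noteq> one_at v (x + 1) y) = (one_at v x (y - 1) \<noteq> one_at v x (y + 1))"
    if "0 \<le> x" "x \<le> m - 1" "0 \<le> y" "y \<le> n - 1" "odd (x + y + c)" for x y
    using v that unfolding kernel_iff by blast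
  have unit: "(extend v p q \<noteq> extend v (p + 1) q) = (extend v p (q + 1) \<noteq> extend v (p + 1) (q + 1))" for p q
  proof -
    \<comment> \<open>\<open>(X, Y)\<close> is the off-color point whose four neighbours are the
      corners of the unit square.\<close>
    define X Y where "X = p + q + 1 + c" and "Y = p - q"
    have e: "extend v p q = one_at v (fold_coord m (X - 1)) (fold_coord n Y)" "extend v (p + 1) (q + 1) = one_at v (fold_coord m (X + 1)) (fold_coord n Y)"
      "extend v (p + 1) q = one_at v (fold_coord m X) (fold_coord n (Y + 1))" "extend v p (q + 1) = one_at v (fold_coord m X) (fold_coord n (Y - 1))"
      unfolding extend_def X_def Y_def by (simp_all add: algebra_simps)
    have "odd (X + Y + c)" unfolding X_def Y_def by simp
    then have odd: "odd (fold_coord m X + fold_coord n Y + c)"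
      using even_fold[OF m0, of X] even_fold[OF n0, of Y] by simp
    show ?thesis
    proof (cases "(fold_coord m X = - 1 \<or> fold_coord m X = m) \<or> (fold_coord n Y = - 1 \<or> fold_coord n Y = n)")
      case True
      then show ?thesis
      proof
        \<comment> \<open>On a mirror two of the neighbours are zeros and the other two are mirror
          images of each other.\<close>
        assume x: "fold_coord m X = - 1 \<or> fold_coord m X = m"
        then have "fold_coord m (X + 1) = fold_coord m (X - 1)" using fold_step[OF m0, of X] by linarith
        then show ?thesis unfolding e using one_at_outside[of "fold_coord m X"] x by auto
      next
        assume y: "fold_coord n Y = - 1 \<or> fold_coord n Y = n"
        then have "fold_coord n (Y + 1) = fold_coord n (Y - 1)" using fold_step[OF n0, of Y] by linarith
        then show ?thesis unfolding e using one_at_outside[of _ "fold_coord n Y"] y by auto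
      qed
    next
      case False
      then have X: "0 \<le> fold_coord m X" "fold_coord m X \<le> m - 1" "fold_coord m (X + 1) = fold_coord m X + 1 \<and> fold_coord m (X - 1) = fold_coord m X - 1 \<or>
          fold_coord m (X + 1) = fold_coord m X - 1 \<and> fold_coord m (X - 1) = fold_coord m X + 1"
        using fold_step[OF m0, of X] by linarith+
      have Y: "0 \<le> fold_coord n Y" "fold_coord n Y \<le> n - 1" "fold_coord n (Y + 1) = fold_coord n Y + 1 \<and> fold_coord n (Y - 1) = fold_coord n Y - 1 \<or>
          fold_coord n (Y + 1) = fold_coord n Y - 1 \<and> fold_coord n (Y - 1) = fold_coord n Y + 1"
        using False fold_step[OF n0, of Y] by linarith+
      \<comment> \<open>Folding at most exchanges opposite neighbours, which leaves the equation
        unchanged.\<close>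
      show ?thesis
        unfolding e using K[OF X(1,2) Y(1,2) odd] X(3) Y(3) by (elim disjE conjE) (simp; argo)+
    qed
  qed
  have refl: "extend v (- 1 - c - q) (- 1 - c - p) = extend v p q \<and> extend v (m - c - q) (m - c - p) = extend v p q \<and>
      extend v (q - 1) (p + 1) = extend v p q \<and> extend v (q + n) (p - n) = extend v p q" for p q
  proof -
    have "(- 1 - c - q) + (- 1 - c - p) + c = - 2 - (p + q + c)" "(- 1 - c - q) - (- 1 - c - p) = p - q"
      "(m - c - q) + (m - c - p) + c = 2 * m - (p + q + c)" "(m - c - q) - (m - c - p) = p - q"
      "(q - 1) + (p + 1) + c = p + q + c" "(q - 1) - (p + 1) = - 2 - (p - q)"
      "(q + n) + (p - n) + c = p + q + c" "(q + n) - (p - n) = 2 * n - (p - q)"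
      by simp_all
    then show ?thesis
      unfolding extend_def by (simp only: fold_reflect_low[OF m0] fold_reflect_high[OF m0] fold_reflect_low[OF n0] fold_reflect_high[OF n0] simp_thms)
  qed
  have zero: "\<not> extend v p q" if "p + q = - 1 - c \<or> p + q = m - c \<or> p - q = - 1 \<or> p - q = n" for p q
  proof -
    have "p + q + c = - 1 \<or> p + q + c = m \<or> p - q = - 1 \<or> p - q = n" using that by linarith
    then show ?thesis
      unfolding extend_def using m0 n0 by (intro one_at_outside) (auto simp: fold_id)
  qed
  \<comment> \<open>A shift of \<open>p\<close> or \<open>q\<close> moves both plane coordinates, so
    the period is a common multiple of \<open>2 * (m + 1)\<close> and
    \<open>2 * (n + 1)\<close>.\<close>
  have period: "extend v (p + 2 * (m + 1) * (n + 1)) q = extend v p q \<and> extend v p (q + 2 * (m + 1) * (n + 1)) = extend v p q" for p q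
  proof -
    have "(p + 2 * (m + 1) * (n + 1)) + q + c = p + q + c + 2 * (m + 1) * (n + 1)"
      "(p + 2 * (m + 1) * (n + 1)) - q = p - q + 2 * (n + 1) * (m + 1)"
      "p + (q + 2 * (m + 1) * (n + 1)) + c = p + q + c + 2 * (m + 1) * (n + 1)"
      "p - (q + 2 * (m + 1) * (n + 1)) = p - q + 2 * (n + 1) * (- (m + 1))"
      by (simp_all add: algebra_simps)
    then show ?thesis
      unfolding extend_def by (simp only: fold_periodic)
  qed
  have "0 < 2 * (m + 1) * (n + 1)" using m0 n0 by simp
  then show ?thesis
    unfolding harmonic_def using unit refl zero period by blast
qed

lemma extend_nonzero:
  assumes "v \<in> kernel"
  shows "(\<exists>p q. extend v p q) \<longleftrightarrow> v \<noteq> zero_on on_color"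
proof
  assume "\<exists>p q. extend v p q"
  then show "v \<noteq> zero_on on_color"
    unfolding extend_def one_at_def zero_on_def by auto
next
  assume ne: "v \<noteq> zero_on on_color"
  have "v \<in> extensional on_color" using assms kernel_iff by blast
  then have "\<exists>b\<in>on_color. v b \<noteq> 0"
    using ne extensionalityI[of v on_color "zero_on on_color"] unfolding zero_on_def by auto
  then obtain b where b: "b \<in> on_color" "v b \<noteq> 0" by blast
  obtain p q where pq: "b = (p + q + c, p - q)" "inside p q" using b(1) by (rule on_color_cases)
  have "v b = 1" using b(2) by (cases "v b") auto
  then show "\<exists>p q. extend v p q" using extend_inside[OF pq(2)] pq(1) by blast
qed

text \<open>The quotients are the lattice coordinates of the point; the divisions are exact on
  \<open>on_color\<close>.\<close>

definition of_ones :: "(int \<Rightarrow> int \<Rightarrow> bool) \<Rightarrow> int \<times> int \<Rightarrow> bit" where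
  "of_ones f = (\<lambda>b\<in>on_color. if f ((fst b + snd b - c) div 2) ((fst b - snd b - c) div 2) then 1 else 0)"

lemma one_at_of_ones:
  assumes "\<And>p q. f p q \<Longrightarrow> inside p q"
  shows "one_at (of_ones f) (p + q + c) (p - q) = f p q"
  using assms[of p q] mem_on_color[of p q] unfolding one_at_def of_ones_def by auto

lemma of_ones_kernel:
  assumes t: "\<T> \<in> tilings"
  shows "of_ones (ones \<T>) \<in> kernel"
  unfolding kernel_iff
proof (intro conjI allI impI)
  show "of_ones (ones \<T>) \<in> extensional on_color"
    unfolding of_ones_def by simp
  fix x y assume xy: "0 \<le> x \<and> x \<le> m - 1 \<and> 0 \<le> y \<and> y \<le> n - 1 \<and> odd (x + y + c)"
  then have "even (x + y - c - 1)" by simp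
  then obtain p where p: "x + y - c - 1 = 2 * p" by (elim evenE)
  define q where "q = p - y"
  have X: "x = p + q + 1 + c" and Y: "y = p - q" using p unfolding q_def by auto
  have one: "one_at (of_ones (ones \<T>)) (p + q + c) (p - q) = ones \<T> p q" for p q
    by (rule one_at_of_ones) (simp add: ones_def)
  have "one_at (of_ones (ones \<T>)) (x - 1) y = ones \<T> p q"
    "one_at (of_ones (ones \<T>)) (x + 1) y = ones \<T> (p + 1) (q + 1)"
    "one_at (of_ones (ones \<T>)) x (y - 1) = ones \<T> p (q + 1)"
    "one_at (of_ones (ones \<T>)) x (y + 1) = ones \<T> (p + 1) q"
    using one[of p q] one[of "p + 1" "q + 1"] one[of p "q + 1"] one[of "p + 1" q] unfolding X Y
    by (simp_all add: algebra_simps)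
  \<comment> \<open>\<open>ones_parity\<close> asks for a cell of \<open>R\<close> around the
    off-color point. At the right or upper side the cell is taken to the west or south, where
    \<open>m\<close> and \<open>n\<close> being at least 2 leaves room.\<close>
  moreover have "test p q (x < m - 1) (y < n - 1) \<in> R"
    using xy m2 n2 unfolding test_in_rect X Y by auto
  ultimately show "(one_at (of_ones (ones \<T>)) (x - 1) y \<noteq> one_at (of_ones (ones \<T>)) (x + 1) y) =
      (one_at (of_ones (ones \<T>)) x (y - 1) \<noteq> one_at (of_ones (ones \<T>)) x (y + 1))"
    using ones_parity[OF t] by auto
qed

theorem kernel_tilings_bij:
  "bij_betw (\<lambda>v. tilesof (extend v)) (kernel - {zero_on on_color}) tilings"
  unfolding bij_betw_def
proof
  show "inj_on (\<lambda>v. tilesof (extend v)) (kernel - {zero_on on_color})"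
  proof (rule inj_onI)
    fix v w assume v: "v \<in> kernel - {zero_on on_color}" and w: "w \<in> kernel - {zero_on on_color}"
      and eq: "tilesof (extend v) = tilesof (extend w)"
    have "v b = w b" if b: "b \<in> on_color" for b
    proof -
      obtain p q where pq: "b = (p + q + c, p - q)" "inside p q" by (rule on_color_cases[OF b])
      have "extend v p q = extend w p q"
        using v w eq extend_nonzero by (intro tilesof_determines[OF _ _ _ _ _ pq(2)] harmonic_extend) auto
      then show ?thesis
        unfolding extend_inside[OF pq(2)] pq(1) by (metis bit_not_one_iff)
    qed
    then show "v = w"
      using v w kernel_iff by (intro extensionalityI[of v on_color w]) auto
  qed
  show "(\<lambda>v. tilesof (extend v)) ` (kernel - {zero_on on_color}) = tilings"
  proof
    show "(\<lambda>v. tilesof (extend v)) ` (kernel - {zero_on on_color}) \<subseteq> tilings"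
      using tilesof_tiling harmonic_extend extend_nonzero by blast
    show "tilings \<subseteq> (\<lambda>v. tilesof (extend v)) ` (kernel - {zero_on on_color})"
    proof
      fix \<T> assume t: "\<T> \<in> tilings"
      let ?v = "of_ones (ones \<T>)"
      have v: "?v \<in> kernel" by (rule of_ones_kernel[OF t])
      have "extend ?v p q = ones \<T> p q" if "inside p q" for p q
        using extend_inside[OF that, of ?v] one_at_of_ones[of "ones \<T>" p q] mem_on_color[of p q] that
        unfolding one_at_def ones_def by auto
      from tiling_eq_tilesof[OF t harmonic_extend[OF v] this]
      show "\<T> \<in> (\<lambda>v. tilesof (extend v)) ` (kernel - {zero_on on_color})"
        using v extend_nonzero[OF v] by blast
    qed
  qed
qed

end

theorem theorem2:
  fixes m n :: int
  assumes "m \<ge> 2" and "n \<ge> 2"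
  shows "(\<exists>\<Phi>. bij_betw \<Phi> ((ker_BW m n :: (int \<times> int \<Rightarrow> bit) set) - {zero_on (blacks m n)})
                (black_tilings m n)) \<and>
         (\<exists>\<Phi>. bij_betw \<Phi> ((ker_WB m n :: (int \<times> int \<Rightarrow> bit) set) - {zero_on (whites m n)})
                (white_tilings m n))"
proof -
  interpret black: board 0 m n by standard (use assms in auto)
  interpret white: board 1 m n by standard (use assms in auto)
  have b: "black.on_color = blacks m n" "black.off_color = whites m n"
    unfolding black.on_color_def black.off_color_def blacks_def whites_def by auto
  have w: "white.on_color = whites m n" "white.off_color = blacks m n"
    unfolding white.on_color_def white.off_color_def blacks_def whites_def by auto
  have "black.kernel = ker_BW m n" "black.tilings = black_tilings m n"
    unfolding black.kernel_def ker_BW_def BW_def b black.tilings_def black_tilings_def black_tile_iff by auto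
  moreover have "white.kernel = ker_WB m n" "white.tilings = white_tilings m n"
    unfolding white.kernel_def ker_WB_def WB_def w white.tilings_def white_tilings_def white_tile_iff by auto
  ultimately show ?thesis
    using black.kernel_tilings_bij white.kernel_tilings_bij unfolding b w by metis
qed

end
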